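(* Up to automorphism of $\mathbb{P}^2_{\mathbb{C}}$ (i.e. up to the action of $\mathrm{Aut}(\mathbb{P}^2_{\mathbb{C}})=\mathrm{PGL}_3(\mathbb{C})$), the Fermat foliation $\mathcal{F}_0^4$, defined in the affine chart $(x,y)=[x:y:1]$ by $$(x^{4}-x)\,\mathrm{d}y-(y^{4}-y)\,\mathrm{d}x,$$ and the Hesse pencil $\mathcal{F}_H^4$ of degree $4$, defined in the affine chart $(x,y)=[x:y:1]$ by $$(2x^{3}-y^{3}-1)\,y\,\mathrm{d}x+(2y^{3}-x^{3}-1)\,x\,\mathrm{d}y,$$ are the only reduced convex foliations of degree $4$ on $\mathbb{P}^2_{\mathbb{C}}$.
   Context: A (holomorphic) foliation $\mathcal{F}$ of degree $d$ on $\mathbb{P}^2_{\mathbb{C}}$ is given in homogeneous coordinates $[x:y:z]$, up to a nonzero scalar factor, by a $1$-form $\omega=a\,\mathrm{d}x+b\,\mathrm{d}y+c\,\mathrm{d}z$ with $a,b,c\in\mathbb{C}[x,y,z]$ homogeneous of degree $d+1$ without common factor and $xa+yb+zc=0$. In the affine chart $z=1$ it is described by the restriction of $\omega$; conversely a polynomial $1$-form in $(x,y)$ whose coefficients have no common factor defines a foliation on $\mathbb{P}^2_{\mathbb{C}}$ by homogenization. A line is invariant by $\mathcal{F}$ if $\omega$ restricts to zero on it. A foliation of degree $d\geq 1$ on $\mathbb{P}^2_{\mathbb{C}}$ has at most $3d$ distinct invariant lines. A foliation of degree $d$ is called reduced convex if this bound is reached, i.e. if it has exactly $3d$ distinct invariant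 lines. (Such a foliation is automatically convex, meaning that its leaves other than straight lines have no inflection points.) *)

theory Defs
  imports "HOL-Analysis.Analysis"
begin

unbundle no fps_syntax

text \<open>
  The ring \<open>\<complex>[x, y]\<close> is \<open>complex poly poly\<close>, with \<open>x\<close> the inner and \<open>y\<close> the outer variable, and
  \<open>\<complex>[x, y, z]\<close> is \<open>complex poly poly poly\<close>, i.e. \<open>\<complex>[x, y][z]\<close>, with outer variable \<open>z\<close>.
  Thus \<open>coeff (coeff (coeff p k) j) i\<close> is the coefficient of \<open>x^i y^j z^k\<close>, and \<open>poly p 1\<close>
  is the restriction of \<open>p\<close> to the chart \<open>z = 1\<close>.
\<close>

type_synonym poly2 = "complex poly poly"
type_synonym poly3 = "complex poly poly poly"

definition affX :: poly2 where "affX = [:[:0, 1:]:]"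
definition affY :: poly2 where "affY = [:0, 1:]"

definition varX :: poly3 where "varX = [:affX:]"
definition varY :: poly3 where "varY = [:affY:]"
definition varZ :: poly3 where "varZ = [:0, 1:]"

definition eval3 :: "poly3 \<Rightarrow> complex ^ 3 \<Rightarrow> complex" where
  "eval3 p v = poly (poly (poly p [:[:v $ 3:]:]) [:v $ 2:]) (v $ 1)"

definition homogeneous :: "nat \<Rightarrow> poly3 \<Rightarrow> bool" where
  "homogeneous n p \<longleftrightarrow>
     (\<forall>i j k. coeff (coeff (coeff p k) j) i \<noteq> 0 \<longrightarrow> i + j + k = n)"

text \<open>
  \<open>(a, b, c)\<close> is the form \<open>a dx + b dy + c dz\<close> on \<open>\<complex>\<^sup>3\<close>; \<open>(p, q)\<close> is \<open>p dx + q dy\<close> on \<open>\<complex>\<^sup>2\<close>.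
\<close>

type_synonym form3 = "poly3 \<times> poly3 \<times> poly3"
type_synonym form2 = "poly2 \<times> poly2"

text \<open>The value of the 1-form at the point \<open>v\<close> on the tangent vector \<open>w\<close>.\<close>

definition form_at :: "form3 \<Rightarrow> complex ^ 3 \<Rightarrow> complex ^ 3 \<Rightarrow> complex" where
  "form_at \<omega> v w = (case \<omega> of (a, b, c) \<Rightarrow>
     eval3 a v * w $ 1 + eval3 b v * w $ 2 + eval3 c v * w $ 3)"

text \<open>
  A foliation is represented by any one of its defining forms, which are unique up to a nonzero
  scalar; \<open>foliation_iso\<close> below identifies proportional forms.
\<close>

definition foliation :: "nat \<Rightarrow> form3 \<Rightarrow> bool" where
  "foliation d \<omega> \<longleftrightarrow> (case \<omega> of (a, b, c) \<Rightarrow>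
     homogeneous (d + 1) a \<and> homogeneous (d + 1) b \<and> homogeneous (d + 1) c \<and>
     (\<forall>g. g dvd a \<and> g dvd b \<and> g dvd c \<longrightarrow> is_unit g) \<and>
     varX * a + varY * b + varZ * c = 0)"

text \<open>A line of the projective plane is represented by its cone, a plane through \<open>0\<close> in \<open>\<complex>\<^sup>3\<close>.\<close>

definition proj_line :: "(complex ^ 3) set \<Rightarrow> bool" where
  "proj_line L \<longleftrightarrow>
     (\<exists>l :: complex ^ 3. l \<noteq> 0 \<and> L = {v. l $ 1 * v $ 1 + l $ 2 * v $ 2 + l $ 3 * v $ 3 = 0})"

text \<open>The tangent space of the plane \<open>L\<close> at each of its points is \<open>L\<close> itself.\<close>

definition invariant_line :: "form3 \<Rightarrow> (complex ^ 3) set \<Rightarrow> bool" where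
  "invariant_line \<omega> L \<longleftrightarrow> proj_line L \<and> (\<forall>v\<in>L. \<forall>w\<in>L. form_at \<omega> v w = 0)"

definition reduced_convex :: "nat \<Rightarrow> form3 \<Rightarrow> bool" where
  "reduced_convex d \<omega> \<longleftrightarrow>
     d \<ge> 1 \<and> foliation d \<omega> \<and> card {L. invariant_line \<omega> L} = 3 * d"

text \<open>
  \<open>\<omega>'\<close> is, up to a nonzero scalar, the pullback of \<open>\<omega>\<close> by the automorphism of the projective plane
  induced by the invertible matrix \<open>A\<close>.
\<close>

definition foliation_iso :: "form3 \<Rightarrow> form3 \<Rightarrow> bool" where
  "foliation_iso \<omega> \<omega>' \<longleftrightarrow>
     (\<exists>(A :: complex ^ 3 ^ 3) s. invertible A \<and> s \<noteq> 0 \<and>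
        (\<forall>v w. form_at \<omega>' v w = s * form_at \<omega> (A *v v) (A *v w)))"

text \<open>\<open>z^n p(x/z, y/z)\<close>, for \<open>p\<close> of total degree at most \<open>n\<close>\<close>

definition homogenize_poly :: "nat \<Rightarrow> poly2 \<Rightarrow> poly3" where
  "homogenize_poly n p =
     (\<Sum>j\<le>n. \<Sum>i\<le>n - j. monom (monom (monom (coeff (coeff p j) i) i) j) (n - i - j))"

definition form_degree :: "form2 \<Rightarrow> nat" where
  "form_degree \<eta> = (case \<eta> of (p, q) \<Rightarrow>
     LEAST n. \<forall>i j. coeff (coeff p j) i \<noteq> 0 \<or> coeff (coeff q j) i \<noteq> 0 \<longrightarrow> i + j \<le> n)"

text \<open>
  Since \<open>d(x/z) = (z dx - x dz) / z\<^sup>2\<close>, the form \<open>p dx + q dy\<close> becomes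
  \<open>z P dx + z Q dy - (x P + y Q) dz\<close> after substituting \<open>x/z\<close>, \<open>y/z\<close> and multiplying by
  \<open>z^(n+2)\<close>, where \<open>P\<close> and \<open>Q\<close> are the homogenizations of \<open>p\<close> and \<open>q\<close> in degree
  \<open>n = form_degree (p, q)\<close>. If \<open>p\<close> and \<open>q\<close> are coprime, the only possible common factor of the
  coefficients is a single \<open>z\<close>, when \<open>z\<close> divides \<open>x P + y Q\<close> (that is, when the line at infinity
  is not invariant).
\<close>

definition homogenize_form :: "form2 \<Rightarrow> form3" where
  "homogenize_form \<eta> = (case \<eta> of (p, q) \<Rightarrow>
     let n = form_degree (p, q);
         P = homogenize_poly n p;
         Q = homogenize_poly n q;
         R = varX * P + varY * Q
     in if varZ dvd R then (P, Q, - (R div varZ)) else (varZ * P, varZ * Q, - R))"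

definition fermat_foliation :: form3 where
  "fermat_foliation = homogenize_form (- (affY ^ 4 - affY), affX ^ 4 - affX)"

definition hesse_pencil :: form3 where
  "hesse_pencil = homogenize_form
     ((2 * affX ^ 3 - affY ^ 3 - 1) * affY, (2 * affY ^ 3 - affX ^ 3 - 1) * affX)"

end

theory Submission
  imports Defs "HOL-Computational_Algebra.Polynomial_Factorial" "HOL-Computational_Algebra.Field_as_Ring"
    "HOL-Computational_Algebra.Fundamental_Theorem_Algebra"
begin

text \<open>
  Let \<open>\<omega>\<close> define a reduced convex foliation of degree 4. Contracting \<open>d\<omega>\<close> with the radial field shows
  that \<open>\<omega> = v \<times> Z\<close> for the homogeneous vector field \<open>Z = - curl \<omega> / 6\<close> of degree 4, so a line,
  viewed as a plane \<open>L\<close> through the origin, is invariant iff \<open>Z\<close> maps \<open>L\<close> into itself, and the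
  singular points are the eigendirections \<open>Z s = \<kappa> s\<close>.

  The extactic polynomial \<open>E(v) = det (v, Z v, DZ(v) (Z v))\<close> has degree 12 and vanishes
  on every invariant line. It is not zero, because otherwise every nonsingular point would lie on an
  invariant line (\<open>extactic_nonzero\<close>). Having 12 invariant lines, \<open>E\<close> is a constant times the product of
  their equations, so its order at a point is exactly the number of invariant lines through that point.
  Comparing this with the expansion of \<open>E\<close> at a singular point shows that at least two and at most five
  invariant lines pass through it, and that the linear part of the foliation there is invertible, and
  scalar if at least three lines pass (\<open>through_ge_2\<close>, \<open>through_le_5\<close>, \<open>multiplier_eq\<close>,
  \<open>multiplier_nonzero\<close>).

  Hence the foliation has five simple singular points on every invariant line \<open>L\<close>, namely
  the points where \<open>L\<close> meets the other eleven lines, and the Camacho-Sad indices of \<open>L\<close> at these points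
  add up to 1 (\<open>camacho_sad\<close>). The index is 1 at a point of at least three lines; at a point on
  exactly two lines the two indices are inverse to each other.

  If some line carries two points of multiplicity five, these can be put at infinity in
  the horizontal and the vertical direction. The arrangement then consists of the line at infinity, a
  \<open>4 \<times> 4\<close> grid and three more lines, which must permute the grid points. Three affine maps between two
  four-element sets that pairwise agree at one point are, in suitable coordinates, the multiplications by the
  cube roots of unity, with the centroid as the origin, and this is the arrangement of the Fermat
  foliation (\<open>fermat_type\<close>). Otherwise the index theorem and a minimality argument force two double points on every line (\<open>two_doubles\<close>), and a divisibility
  argument leaves only quadruple points besides (\<open>hesse_type\<close>). There is then a triangle of lines with double
  vertices, and the other nine lines \<open>u x + v y + z = 0\<close> are those with \<open>(u, v) \<in> U \<times> V\<close> for two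
  three-element sets whose quotient set has again three elements. So \<open>U\<close> and \<open>V\<close> are cosets of the cube
  roots of unity, and this is the Hesse arrangement (\<open>hesse_coordinates\<close>).

  Finally, the invariant lines determine the foliation: for two foliations \<open>\<omega>\<close> and \<open>\<omega>'\<close> of degree 4, the components
  of \<open>\<omega> \<times> \<omega>'\<close> are forms of degree 10, and they vanish on every common invariant line (\<open>foliation_unique\<close>).
\<close>

section \<open>Homogeneous polynomial functions on \<open>\<complex>\<^sup>3\<close>\<close>

text \<open>
  The inductive form makes every closure property (line restriction, differentiation, linear change of
  coordinates) a rule induction, without reference to coefficients of polynomials in three variables.
\<close>

inductive hompoly :: "nat \<Rightarrow> (complex ^ 3 \<Rightarrow> complex) \<Rightarrow> bool" where
  const: "hompoly 0 (\<lambda>v. c)"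
| coord: "hompoly (Suc 0) (\<lambda>v. v $ i)"
| zero: "hompoly n (\<lambda>v. 0)"
| add: "hompoly n f \<Longrightarrow> hompoly n g \<Longrightarrow> hompoly n (\<lambda>v. f v + g v)"
| mult: "hompoly n f \<Longrightarrow> hompoly m g \<Longrightarrow> hompoly (n + m) (\<lambda>v. f v * g v)"

lemma hompoly_mult: "hompoly n f \<Longrightarrow> hompoly m g \<Longrightarrow> k = n + m \<Longrightarrow> hompoly k (\<lambda>v. f v * g v)"
  using hompoly.mult by simp

lemma hompoly_coord: "k = 1 \<Longrightarrow> hompoly k (\<lambda>v. v $ i)"
  using hompoly.coord by simp

lemma hompoly_const: "k = 0 \<Longrightarrow> hompoly k (\<lambda>v. c)"
  using hompoly.const by simp

lemma hompoly_cmult: "hompoly n f \<Longrightarrow> hompoly n (\<lambda>v. c * f v)"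
  using hompoly.mult[OF hompoly.const, of n f c] by simp

lemma hompoly_uminus: "hompoly n f \<Longrightarrow> hompoly n (\<lambda>v. - f v)"
  using hompoly_cmult[of n f "-1"] by simp

lemma hompoly_diff: "hompoly n f \<Longrightarrow> hompoly n g \<Longrightarrow> hompoly n (\<lambda>v. f v - g v)"
  using hompoly.add[OF _ hompoly_uminus, of n f g] by simp

lemma hompoly_power: "hompoly n f \<Longrightarrow> m = k * n \<Longrightarrow> hompoly m (\<lambda>v. f v ^ k)"
  by (induction k arbitrary: m) (auto intro: hompoly.const hompoly.mult)

lemma hompoly_sum: "(\<And>i. i \<in> I \<Longrightarrow> hompoly n (f i)) \<Longrightarrow> hompoly n (\<lambda>v. \<Sum>i\<in>I. f i v)"
  by (induction I rule: infinite_finite_induct) (auto intro: hompoly.zero hompoly.add)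

lemma hompoly_prod: "(\<And>i. i \<in> I \<Longrightarrow> hompoly (n i) (f i)) \<Longrightarrow> hompoly (\<Sum>i\<in>I. n i) (\<lambda>v. \<Prod>i\<in>I. f i v)"
  by (induction I rule: infinite_finite_induct) (auto intro: hompoly.const hompoly.mult)

lemma hompoly_prod_linear:
  "(\<And>i. i \<in> I \<Longrightarrow> hompoly 1 (f i)) \<Longrightarrow> hompoly (card I) (\<lambda>v. \<Prod>i\<in>I. f i v)"
  using hompoly_prod[of I "\<lambda>_. 1" f] by simp

lemmas hompoly_intros = hompoly.zero hompoly.add hompoly_diff hompoly_uminus hompoly_cmult hompoly_mult
   hompoly_coord hompoly_const

lemma hompoly_scale: "hompoly n f \<Longrightarrow> f (c *s v) = c ^ n * f v"
  by (induction rule: hompoly.induct) (auto simp: algebra_simps power_add)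

lemma hompoly_linear_comp: "hompoly n f \<Longrightarrow> hompoly n (\<lambda>v. f (A *v v))" for A :: "complex ^ 3 ^ 3"
proof (induction rule: hompoly.induct)
  case (coord i)
  show ?case unfolding matrix_vector_mult_def
    by (auto intro!: hompoly_sum hompoly_cmult hompoly_coord)
qed (auto intro: hompoly.intros)

text \<open>
  The restriction to the lines through \<open>u\<close>, as a polynomial in the line parameter: it is used along a single
  line for counting zeros, where its degree matters, and as a Taylor expansion at \<open>u\<close>, whose term of order
  \<open>j\<close> is a form of degree \<open>j\<close> in the direction.
\<close>

lemma taylor_poly_exists:
  assumes "hompoly n f"
  shows "\<exists>P. (\<forall>w t. f (u + t *s w) = poly (P w) t) \<and> (\<forall>j. hompoly j (\<lambda>w. coeff (P w) j)) \<and>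
    (\<forall>w. degree (P w) \<le> n \<and> coeff (P w) n = f w)"
  using assms
proof (induction rule: hompoly.induct)
  case (const c)
  have "hompoly j (\<lambda>w. coeff [:c:] j)" for j
    by (cases j) (auto intro: hompoly_intros)
  then show ?case by (intro exI[of _ "\<lambda>w. [:c:]"]) auto
next
  case (coord i)
  have "hompoly j (\<lambda>w. coeff [:u $ i, w $ i:] j)" for j
    by (cases j; cases "j - 1") (auto intro: hompoly_intros)
  then show ?case by (intro exI[of _ "\<lambda>w. [:u $ i, w $ i:]"]) auto
next
  case (zero n)
  show ?case by (intro exI[of _ "\<lambda>w. 0"]) (auto intro: hompoly_intros)
next
  case (add n f g)
  then obtain P Q where "\<forall>w t. f (u + t *s w) = poly (P w) t" "\<forall>j. hompoly j (\<lambda>w. coeff (P w) j)"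
    "\<forall>w. degree (P w) \<le> n \<and> coeff (P w) n = f w"
    "\<forall>w t. g (u + t *s w) = poly (Q w) t" "\<forall>j. hompoly j (\<lambda>w. coeff (Q w) j)"
    "\<forall>w. degree (Q w) \<le> n \<and> coeff (Q w) n = g w"
    by blast
  then show ?case
    by (intro exI[of _ "\<lambda>w. P w + Q w"]) (auto intro: hompoly.add degree_add_le)
next
  case (mult n f m g)
  then obtain P Q where *: "\<forall>w t. f (u + t *s w) = poly (P w) t" "\<forall>j. hompoly j (\<lambda>w. coeff (P w) j)"
    "\<forall>w. degree (P w) \<le> n \<and> coeff (P w) n = f w"
    "\<forall>w t. g (u + t *s w) = poly (Q w) t" "\<forall>j. hompoly j (\<lambda>w. coeff (Q w) j)"
    "\<forall>w. degree (Q w) \<le> m \<and> coeff (Q w) m = g w"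
    by blast
  have 1: "hompoly j (\<lambda>w. coeff (P w * Q w) j)" for j
    unfolding coeff_mult using *(2,5)
    by (intro hompoly_sum hompoly_mult[where n = i and m = "j - i" for i]) auto
  have 2: "degree (P w * Q w) \<le> n + m" for w
    using *(3,6) by (meson add_mono degree_mult_le order_trans)
  have 3: "coeff (P w * Q w) (n + m) = f w * g w" for w
  proof -
    have "coeff (P w * Q w) (n + m) = (\<Sum>i\<le>n+m. coeff (P w) i * coeff (Q w) (n+m-i))"
      by (simp add: coeff_mult)
    also have "\<dots> = (\<Sum>i\<in>{n}. coeff (P w) i * coeff (Q w) (n+m-i))"
    proof (rule sum.mono_neutral_right)
      show "\<forall>i\<in>{..n + m} - {n}. coeff (P w) i * coeff (Q w) (n + m - i) = 0"
      proof
        fix i assume "i \<in> {..n + m} - {n}"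
        then consider "i > n" | "i < n" by fastforce
        then show "coeff (P w) i * coeff (Q w) (n + m - i) = 0"
        proof cases
          case 1
          then have "coeff (P w) i = 0" using *(3) by (meson coeff_eq_0 le_less_trans)
          then show ?thesis by simp
        next
          case 2
          then have "m < n + m - i" by simp
          then have "coeff (Q w) (n + m - i) = 0" using *(6) by (meson coeff_eq_0 le_less_trans)
          then show ?thesis by simp
        qed
      qed
    qed auto
    finally show ?thesis using * by simp
  qed
  show ?case
    by (intro exI[of _ "\<lambda>w. P w * Q w"]) (use * 1 2 3 in auto)
qed

definition along :: "(complex ^ 3 \<Rightarrow> complex) \<Rightarrow> complex ^ 3 \<Rightarrow> complex ^ 3 \<Rightarrow> complex poly" where
  "along f u w = (THE q. \<forall>t. f (u + t *s w) = poly q t)"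

lemma along_eqI: "(\<And>t. f (u + t *s w) = poly q t) \<Longrightarrow> along f u w = q"
  unfolding along_def by (rule the_equality) (auto simp: poly_eq_poly_eq_iff[symmetric])

lemma
  assumes "hompoly n f"
  shows poly_along: "poly (along f u w) t = f (u + t *s w)"
    and degree_along: "degree (along f u w) \<le> n"
    and coeff_along_top: "coeff (along f u w) n = f w"
    and hompoly_coeff_along: "hompoly j (\<lambda>w. coeff (along f u w) j)"
proof -
  obtain P where P: "\<forall>w t. f (u + t *s w) = poly (P w) t" "\<forall>j. hompoly j (\<lambda>w. coeff (P w) j)"
    "\<forall>w. degree (P w) \<le> n \<and> coeff (P w) n = f w" 
    using taylor_poly_exists[OF assms, of u] by blast
  have "along f u w = P w" for w using P by (intro along_eqI) auto
  then show "poly (along f u w) t = f (u + t *s w)" "degree (along f u w) \<le> n"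
    "coeff (along f u w) n = f w" "hompoly j (\<lambda>w. coeff (along f u w) j)"
    using P by auto
qed

lemma coeff_along_0: "hompoly n f \<Longrightarrow> coeff (along f u w) 0 = f u"
  using poly_along[of n f u w 0] by (simp add: poly_0_coeff_0)

definition dderiv :: "(complex ^ 3 \<Rightarrow> complex) \<Rightarrow> complex ^ 3 \<Rightarrow> complex ^ 3 \<Rightarrow> complex" where
  "dderiv f v w = coeff (along f v w) 1"

lemma poly_pderiv_along:
  assumes "hompoly n f"
  shows "poly (pderiv (along f u w)) t = dderiv f (u + t *s w) w"
proof -
  have "along f (u + t *s w) w = pcompose (along f u w) [:t, 1:]"
    by (rule along_eqI) (simp add: poly_pcompose poly_along[OF assms] algebra_simps vec_eq_iff)
  then have "dderiv f (u + t *s w) w = poly (pderiv (pcompose (along f u w) [:t, 1:])) 0"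
    unfolding dderiv_def by (simp add: poly_0_coeff_0 coeff_pderiv)
  also have "\<dots> = poly (pderiv (along f u w)) t"
    by (simp add: pderiv_pcompose poly_pcompose pderiv_pCons)
  finally show ?thesis by simp
qed

lemma hompoly_1_linear:
  assumes "hompoly 1 f"
  shows "f (u + w) = f u + f w" "f (c *s u) = c * f u"
proof -
  have "degree (along f u w) \<le> 1" by (rule degree_along[OF assms])
  then have "poly (along f u w) 1 = coeff (along f u w) 0 + coeff (along f u w) 1"
    by (subst poly_altdef, cases "degree (along f u w)") (auto simp: coeff_eq_0)
  then show "f (u + w) = f u + f w"
    using poly_along[OF assms, of u w 1] coeff_along_0[OF assms, of u w] coeff_along_top[OF assms, of u w]
    by simp
  show "f (c *s u) = c * f u" using hompoly_scale[OF assms] by simp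
qed

lemma
  assumes "hompoly n f"
  shows dderiv_add: "dderiv f v (w + w') = dderiv f v w + dderiv f v w'"
    and dderiv_scale: "dderiv f v (c *s w) = c * dderiv f v w"
  using hompoly_1_linear[OF hompoly_coeff_along[OF assms, where j=1]] by (auto simp: dderiv_def)

lemma dderiv_const: "dderiv (\<lambda>v. c) v w = 0"
proof -
  have "along (\<lambda>v. c) v w = [:c:]" by (rule along_eqI) simp
  then show ?thesis by (simp add: dderiv_def)
qed

lemma dderiv_coord: "dderiv (\<lambda>v. v $ i) v w = w $ i"
proof -
  have "along (\<lambda>v. v $ i) v w = [:v $ i, w $ i:]" by (rule along_eqI) simp
  then show ?thesis by (simp add: dderiv_def)
qed

lemma dderiv_plus:
  assumes "hompoly n f" "hompoly m g"
  shows "dderiv (\<lambda>v. f v + g v) v w = dderiv f v w + dderiv g v w"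
proof -
  have "along (\<lambda>v. f v + g v) v w = along f v w + along g v w"
    by (rule along_eqI) (simp add: poly_along[OF assms(1)] poly_along[OF assms(2)])
  then show ?thesis by (simp add: dderiv_def)
qed

lemma dderiv_mult:
  assumes "hompoly n f" "hompoly m g"
  shows "dderiv (\<lambda>v. f v * g v) v w = f v * dderiv g v w + dderiv f v w * g v"
proof -
  have "along (\<lambda>v. f v * g v) v w = along f v w * along g v w"
    by (rule along_eqI) (simp add: poly_along[OF assms(1)] poly_along[OF assms(2)])
  then show ?thesis by (simp add: dderiv_def coeff_mult coeff_along_0[OF assms(1)] coeff_along_0[OF assms(2)])
qed

lemma dderiv_cmult:
  assumes "hompoly n f"
  shows "dderiv (\<lambda>v. c * f v) v w = c * dderiv f v w"
  using dderiv_mult[OF hompoly.const assms, of c] by (simp add: dderiv_const)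

lemma dderiv_uminus:
  assumes "hompoly n f"
  shows "dderiv (\<lambda>v. - f v) v w = - dderiv f v w"
  using dderiv_cmult[OF assms, of "-1"] by simp

lemma dderiv_diff:
  assumes "hompoly n f" "hompoly m g"
  shows "dderiv (\<lambda>v. f v - g v) v w = dderiv f v w - dderiv g v w"
  using dderiv_plus[OF assms(1) hompoly_uminus[OF assms(2)]] by (simp add: dderiv_uminus[OF assms(2)])

lemma dderiv_power:
  assumes "hompoly n f"
  shows "dderiv (\<lambda>v. f v ^ Suc k) v w = of_nat (Suc k) * f v ^ k * dderiv f v w"
proof (induction k)
  case (Suc k)
  have "dderiv (\<lambda>v. f v * f v ^ Suc k) v w = f v * dderiv (\<lambda>v. f v ^ Suc k) v w + dderiv f v w * f v ^ Suc k"
    by (rule dderiv_mult[OF assms hompoly_power[OF assms refl]])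
  then show ?case using Suc by (simp add: algebra_simps)
qed simp

lemma euler_identity:
  assumes "hompoly n f"
  shows "dderiv f v v = of_nat n * f v"
proof -
  have "along f v v = smult (f v) ([:1, 1:] ^ n)"
  proof (rule along_eqI)
    fix t
    have "v + t *s v = (1 + t) *s v" by (simp add: vec_eq_iff algebra_simps)
    then show "f (v + t *s v) = poly (smult (f v) ([:1, 1:] ^ n)) t"
      using hompoly_scale[OF assms, of "1 + t" v] by (simp add: poly_power)
  qed
  moreover have "coeff ([:1, 1:] ^ n :: complex poly) 1 = of_nat n"
  proof -
    have "coeff ([:1, 1:] ^ n :: complex poly) 1 = poly (pderiv ([:1, 1:] ^ n)) 0"
      by (simp add: poly_0_coeff_0 coeff_pderiv)
    also have "\<dots> = of_nat n" by (cases n) (simp_all add: pderiv_power_Suc pderiv_pCons poly_power del: power_Suc)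
    finally show ?thesis .
  qed
  ultimately show ?thesis by (simp add: dderiv_def mult.commute)
qed

text \<open>
  Differentiation lowers the degree by one. Constants have to be treated apart, because the product rule
  applied to a constant factor would otherwise ask for a form of degree \<open>- 1\<close>.
\<close>

lemma hompoly_dderiv_aux:
  assumes "hompoly n f" "\<And>i. hompoly m (\<lambda>v. W v $ i)"
  shows "(n = 0 \<longrightarrow> (\<forall>v w. dderiv f v w = 0)) \<and> (n > 0 \<longrightarrow> hompoly (n - 1 + m) (\<lambda>v. dderiv f v (W v)))"
  using assms(1)
proof (induction rule: hompoly.induct)
  case (mult n f l g)
  note D = dderiv_mult[OF mult.hyps]
  have 1: "hompoly (n + l - 1 + m) (\<lambda>v. f v * dderiv g v (W v))" if "n + l > 0"
  proof (cases "l = 0")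
    case False then show ?thesis using mult.IH mult.hyps(1) by (intro hompoly_mult) auto
  qed (use mult.IH in \<open>simp add: hompoly.zero\<close>)
  have 2: "hompoly (n + l - 1 + m) (\<lambda>v. dderiv f v (W v) * g v)" if "n + l > 0"
  proof (cases "n = 0")
    case False then show ?thesis using mult.IH mult.hyps(2) by (intro hompoly_mult) auto
  qed (use mult.IH in \<open>simp add: hompoly.zero\<close>)
  show ?case using 1 2 mult.IH by (auto simp: D intro!: hompoly.add)
qed (use assms(2) in \<open>auto simp: dderiv_const dderiv_coord dderiv_plus intro: hompoly.add hompoly.zero\<close>)

lemma hompoly_dderiv:
  "hompoly (Suc n) f \<Longrightarrow> (\<And>i. hompoly m (\<lambda>v. W v $ i)) \<Longrightarrow> k = n + m \<Longrightarrow> hompoly k (\<lambda>v. dderiv f v (W v))"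
  using hompoly_dderiv_aux[of "Suc n" f m W] by simp

lemma dderiv_scale_point:
  assumes "hompoly (Suc n) f"
  shows "dderiv f (c *s v) w = c ^ n * dderiv f v w"
proof -
  have "hompoly n (\<lambda>v. dderiv f v w)"
    by (rule hompoly_dderiv[OF assms hompoly.const]) simp
  then show ?thesis by (rule hompoly_scale)
qed

lemma dderiv_axis:
  assumes "hompoly n f"
  shows "dderiv f v w = (\<Sum>i\<in>UNIV. w $ i * dderiv f v (axis i 1))"
proof -
  have *: "dderiv f v (\<Sum>i\<in>I. w $ i *s axis i 1) = (\<Sum>i\<in>I. w $ i * dderiv f v (axis i 1))" for I
  proof (induction I rule: infinite_finite_induct)
    case empty
    then show ?case using dderiv_scale[OF assms, of v 0 0] by simp
  next
    case (infinite A)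
    then show ?case using dderiv_scale[OF assms, of v 0 0] by simp
  qed (simp add: dderiv_add[OF assms] dderiv_scale[OF assms])
  have "(\<Sum>i\<in>UNIV. w $ i *s axis i 1) = w"
    by (simp add: vec_eq_iff axis_def if_distrib cong: if_cong)
  then show ?thesis using *[of UNIV] by simp
qed

text \<open>
  Polynomial dependence on one parameter, for expressions that are built along a curve and whose
  coefficients are irrelevant.
\<close>

definition polyfn :: "(complex \<Rightarrow> complex) \<Rightarrow> bool" where
  "polyfn f \<longleftrightarrow> (\<exists>p. \<forall>t. f t = poly p t)"

lemma polyfn_const: "polyfn (\<lambda>t. c)"
  unfolding polyfn_def by (rule exI[of _ "[:c:]"]) simp
lemma polyfn_id: "polyfn (\<lambda>t. t)"
  unfolding polyfn_def by (rule exI[of _ "[:0,1:]"]) simp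
lemma polyfn_add: "polyfn f \<Longrightarrow> polyfn g \<Longrightarrow> polyfn (\<lambda>t. f t + g t)"
  unfolding polyfn_def by (metis poly_add)
lemma polyfn_mult: "polyfn f \<Longrightarrow> polyfn g \<Longrightarrow> polyfn (\<lambda>t. f t * g t)"
  unfolding polyfn_def by (metis poly_mult)
lemma polyfn_diff: "polyfn f \<Longrightarrow> polyfn g \<Longrightarrow> polyfn (\<lambda>t. f t - g t)"
  unfolding polyfn_def by (metis poly_diff)
lemma polyfn_uminus: "polyfn f \<Longrightarrow> polyfn (\<lambda>t. - f t)"
  unfolding polyfn_def by (metis poly_minus)
lemma polyfn_power: "polyfn f \<Longrightarrow> polyfn (\<lambda>t. f t ^ k)"
  by (induction k) (auto intro: polyfn_const polyfn_mult)
lemma polyfn_sum: "(\<And>i. i \<in> I \<Longrightarrow> polyfn (f i)) \<Longrightarrow> polyfn (\<lambda>t. \<Sum>i\<in>I. f i t)"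
  by (induction I rule: infinite_finite_induct) (auto intro: polyfn_const polyfn_add)

lemma polyfn_hompoly: "hompoly n f \<Longrightarrow> (\<And>i. polyfn (\<lambda>t. v t $ i)) \<Longrightarrow> polyfn (\<lambda>t. f (v t))"
  by (induction rule: hompoly.induct) (auto intro: polyfn_const polyfn_add polyfn_mult)

lemma polyfn_dderiv:
  assumes "hompoly n f" "\<And>i. polyfn (\<lambda>t. v t $ i)" "\<And>i. polyfn (\<lambda>t. w t $ i)"
  shows "polyfn (\<lambda>t. dderiv f (v t) (w t))"
proof -
  have "polyfn (\<lambda>t. dderiv f (v t) (axis i 1))" for i
  proof (cases n)
    case 0
    then have "dderiv f v w = 0" for v w using hompoly_dderiv_aux[OF assms(1), of 0 "\<lambda>_. 0"] by (simp add: hompoly.zero)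
    then show ?thesis by (simp add: polyfn_const)
  next
    case (Suc m)
    have "hompoly m (\<lambda>v. dderiv f v (axis i 1))"
      by (rule hompoly_dderiv[OF assms(1)[unfolded Suc] hompoly.const]) simp
    then show ?thesis by (rule polyfn_hompoly[OF _ assms(2)])
  qed
  then show ?thesis unfolding dderiv_axis[OF assms(1), of _ "w _"]
    by (intro polyfn_sum polyfn_mult assms(3))
qed

text \<open>
  On the line joining a point where \<open>f\<close> does not vanish to one where \<open>g\<close> does not vanish, both restrict to
  nonzero polynomials, and \<open>\<complex>[t]\<close> has no zero divisors.
\<close>

lemma hompoly_nonzero_mult:
  assumes "hompoly n f" "hompoly m g" "f u \<noteq> 0" "g w \<noteq> 0"
  shows "\<exists>v. f v \<noteq> 0 \<and> g v \<noteq> 0"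
proof -
  let ?p = "along f u (w - u)" and ?q = "along g u (w - u)"
  have "poly ?p 0 \<noteq> 0" "poly ?q 1 \<noteq> 0" using assms by (simp_all add: poly_along)
  then have "?p * ?q \<noteq> 0" by auto
  then obtain t where "poly (?p * ?q) t \<noteq> 0" using poly_all_0_iff_0 by blast
  then show ?thesis using assms(1,2) by (auto simp: poly_along)
qed

lemma common_nonzero_point:
  assumes "finite I" "\<And>i. i \<in> I \<Longrightarrow> hompoly (n i) (f i)" "\<And>i. i \<in> I \<Longrightarrow> \<exists>v. f i v \<noteq> 0"
  shows "\<exists>v. \<forall>i\<in>I. f i v \<noteq> 0"
  using assms
proof (induction I rule: finite_induct)
  case (insert i I)
  then obtain v where "\<forall>i\<in>I. f i v \<noteq> 0" by auto
  then have "(\<Prod>i\<in>I. f i v) \<noteq> 0" using insert.hyps by simp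
  moreover obtain u where "f i u \<noteq> 0" using insert.prems by auto
  ultimately obtain v where "f i v \<noteq> 0" "(\<Prod>i\<in>I. f i v) \<noteq> 0"
    using hompoly_nonzero_mult[of "n i" "f i" _ "\<lambda>v. \<Prod>i\<in>I. f i v" u v] hompoly_prod[of I n f] insert.prems(1)
    by blast
  then show ?case using insert.hyps by (intro exI[of _ v]) auto
qed simp

lemma eval3_simps [simp]:
  "eval3 0 v = 0" "eval3 1 v = 1" "eval3 (p + q) v = eval3 p v + eval3 q v" "eval3 (p * q) v = eval3 p v * eval3 q v"
  "eval3 (p - q) v = eval3 p v - eval3 q v"  "eval3 (- p) v = - eval3 p v"
  "eval3 (p ^ n) v = eval3 p v ^ n" "eval3 [:[:[:c:]:]:] v = c"
  "eval3 varX v = v $ 1" "eval3 varY v = v $ 2" "eval3 varZ v = v $ 3"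
  by (simp_all add: eval3_def varX_def varY_def varZ_def affX_def affY_def poly_power)

lemma eval3_sum: "eval3 (\<Sum>i\<in>I. f i) v = (\<Sum>i\<in>I. eval3 (f i) v)"
  by (induction I rule: infinite_finite_induct) auto

lemma eval3_eq_0_imp:
  assumes "\<And>v. eval3 p v = 0"
  shows "p = 0"
proof -
  have C: "q = 0" if "\<And>y. poly q [:y:] = 0" for q :: "complex poly poly"
  proof (rule ccontr)
    assume "q \<noteq> 0"
    then have "finite {r. poly q r = 0}" by (rule poly_roots_finite)
    then have "finite (range (\<lambda>y::complex. [:y:]))" by (rule finite_subset[rotated]) (use that in auto)
    then show False by (subst (asm) finite_image_iff) (auto simp: inj_on_def infinite_UNIV_char_0)
  qed
  have C2: "q = 0" if "\<And>z. poly q [:[:z:]:] = 0" for q :: "complex poly poly poly"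
  proof (rule ccontr)
    assume "q \<noteq> 0"
    then have "finite {r. poly q r = 0}" by (rule poly_roots_finite)
    then have "finite (range (\<lambda>y::complex. [:[:y:]:]))" by (rule finite_subset[rotated]) (use that in auto)
    then show False by (subst (asm) finite_image_iff) (auto simp: inj_on_def infinite_UNIV_char_0)
  qed
  have "poly (poly (poly p [:[:z:]:]) [:y:]) x = 0" for x y z
    using assms[of "vector [x, y, z]"] by (simp add: eval3_def)
  then have "poly (poly p [:[:z:]:]) [:y:] = 0" for y z using poly_all_0_iff_0 by blast
  then have "poly p [:[:z:]:] = 0" for z using C by blast
  then show ?thesis using C2 by blast
qed

lemma eval3_inject: "(\<And>v. eval3 p v = eval3 q v) \<Longrightarrow> p = q"
  using eval3_eq_0_imp[of "p - q"] by simp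

lemma hompoly_imp_eval3: "hompoly n f \<Longrightarrow> \<exists>p. f = eval3 p"
proof (induction rule: hompoly.induct)
  case (const c)
  show ?case by (intro exI[of _ "[:[:[:c:]:]:]"]) auto
next
  case (coord i)
  show ?case by (intro exI[of _ "if i = 1 then varX else if i = 2 then varY else varZ"])
    (use exhaust_3[of i] in auto)
next
  case (zero n)
  show ?case by (intro exI[of _ 0]) auto
next
  case (add n f g)
  then show ?case by (metis eval3_simps(3))
next
  case (mult n f g)
  then show ?case by (metis eval3_simps(4))
qed

lemma homogeneous_imp_hompoly:
  assumes "homogeneous n p"
  shows "hompoly n (eval3 p)"
proof -
  let ?c = "\<lambda>i j k. coeff (coeff (coeff p k) j) i"
  have "eval3 p = (\<lambda>v. \<Sum>k\<le>degree p. \<Sum>j\<le>degree (coeff p k). \<Sum>i\<le>degree (coeff (coeff p k) j).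
          ?c i j k * ((v $ 1) ^ i * ((v $ 2) ^ j * (v $ 3) ^ k)))"
  proof
    fix v
    show "eval3 p v = (\<Sum>k\<le>degree p. \<Sum>j\<le>degree (coeff p k). \<Sum>i\<le>degree (coeff (coeff p k) j).
          ?c i j k * ((v $ 1) ^ i * ((v $ 2) ^ j * (v $ 3) ^ k)))"
    proof -
      have *: "poly (poly q [:y:]) x = (\<Sum>j\<le>degree q. \<Sum>i\<le>degree (coeff q j). coeff (coeff q j) i * (x ^ i * y ^ j))"
        for q :: "complex poly poly" and x y
        by (subst poly_altdef) (simp add: poly_sum poly_power poly_altdef[of "coeff q _"] sum_distrib_left sum_distrib_right mult_ac)
      have "eval3 p v = (\<Sum>k\<le>degree p. poly (poly (coeff p k) [:v $ 2:]) (v $ 1) * (v $ 3) ^ k)"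
        unfolding eval3_def by (subst poly_altdef[of p]) (simp add: poly_sum poly_power)
      then show ?thesis unfolding * by (simp add: sum_distrib_left sum_distrib_right mult_ac)
    qed
  qed
  moreover have "hompoly n (\<lambda>v. \<Sum>k\<le>degree p. \<Sum>j\<le>degree (coeff p k). \<Sum>i\<le>degree (coeff (coeff p k) j).
          ?c i j k * ((v $ 1) ^ i * ((v $ 2) ^ j * (v $ 3) ^ k)))"
  proof (intro hompoly_sum)
    fix i j k
    show "hompoly n (\<lambda>v. ?c i j k * ((v $ 1) ^ i * ((v $ 2) ^ j * (v $ 3) ^ k)))"
    proof (cases "?c i j k = 0")
      case False
      then have "n = i + (j + k)" using assms by (metis homogeneous_def add.assoc)
      then show ?thesis
        by (auto intro!: hompoly_cmult hompoly.mult intro: hompoly_power hompoly_coord)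
    qed (simp add: hompoly.zero)
  qed
  ultimately show ?thesis by simp
qed

section \<open>Planes in \<open>\<complex>\<^sup>3\<close>\<close>

definition dot :: "complex ^ 3 \<Rightarrow> complex ^ 3 \<Rightarrow> complex" where
  "dot a b = a $ 1 * b $ 1 + a $ 2 * b $ 2 + a $ 3 * b $ 3"

definition cross :: "complex ^ 3 \<Rightarrow> complex ^ 3 \<Rightarrow> complex ^ 3" where
  "cross a b = vector [a $ 2 * b $ 3 - a $ 3 * b $ 2, a $ 3 * b $ 1 - a $ 1 * b $ 3, a $ 1 * b $ 2 - a $ 2 * b $ 1]"

definition det3 :: "complex ^ 3 \<Rightarrow> complex ^ 3 \<Rightarrow> complex ^ 3 \<Rightarrow> complex" where
  "det3 a b c = dot (cross a b) c"

definition plane :: "complex ^ 3 \<Rightarrow> (complex ^ 3) set" where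
  "plane n = {v. dot n v = 0}"

lemma cross_component [simp]:
  "cross a b $ 1 = a $ 2 * b $ 3 - a $ 3 * b $ 2"
  "cross a b $ 2 = a $ 3 * b $ 1 - a $ 1 * b $ 3"
  "cross a b $ 3 = a $ 1 * b $ 2 - a $ 2 * b $ 1"
  by (simp_all add: cross_def)

lemmas vec3_eq_iff = vec_eq_iff[where 'b = 3, unfolded forall_3]

lemma dot_linear [simp]:
  "dot a (b + c) = dot a b + dot a c" "dot a (b - c) = dot a b - dot a c" "dot a (x *s b) = x * dot a b"
  "dot (b + c) a = dot b a + dot c a" "dot (b - c) a = dot b a - dot c a" "dot (x *s b) a = x * dot b a"
  "dot 0 a = 0" "dot a 0 = 0" "dot (- b) a = - dot b a" "dot a (- b) = - dot a b"
  by (simp_all add: dot_def algebra_simps)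

lemma dot_commute: "dot a b = dot b a"
  by (simp add: dot_def mult.commute)

lemma cross_swap: "cross a b = - cross b a"
  by (simp add: vec3_eq_iff)

lemma dot_cross_self [simp]: "dot (cross a b) a = 0" "dot (cross a b) b = 0"
   "dot a (cross a b) = 0" "dot b (cross a b) = 0"
  by (simp_all add: dot_def algebra_simps)

lemma det3_linear [simp]:
  "det3 (a + a') b c = det3 a b c + det3 a' b c"
  "det3 (x *s a) b c = x * det3 a b c"
  "det3 a (b + b') c = det3 a b c + det3 a b' c"
  "det3 a (x *s b) c = x * det3 a b c"
  "det3 a b (c + c') = det3 a b c + det3 a b c'"
  "det3 a b (x *s c) = x * det3 a b c"
  "det3 (a - a') b c = det3 a b c - det3 a' b c"
  "det3 a (b - b') c = det3 a b c - det3 a b' c"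
  "det3 a b (c - c') = det3 a b c - det3 a b c'"
  "det3 a a b = 0" "det3 a b a = 0" "det3 b a a = 0" 
  "det3 0 a b = 0" "det3 a 0 b = 0" "det3 a b 0 = 0"
  by (simp_all add: det3_def dot_def algebra_simps)

lemma det3_swap: "det3 b a c = - det3 a b c" "det3 a c b = - det3 a b c" "det3 c b a = - det3 a b c"
  by (simp_all add: det3_def dot_def algebra_simps)

lemma det3_rotate: "det3 b c a = det3 a b c"
  by (simp add: det3_def dot_def algebra_simps)

text \<open>
  Cramer's rule as an identity: the linear relation between any four vectors of \<open>\<complex>\<^sup>3\<close>.
\<close>

lemma vectors4_relation:
  "det3 b c d *s a - det3 a c d *s b + det3 a b d *s c - det3 a b c *s d = 0"
  by (simp add: det3_def dot_def vec3_eq_iff algebra_simps)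

lemma dot_eq_0_all:
  assumes "\<And>b. dot a b = 0"
  shows "a = 0"
  using assms[of "vector [1, 0, 0]"] assms[of "vector [0, 1, 0]"] assms[of "vector [0, 0, 1]"]
  by (simp add: dot_def vec3_eq_iff)

lemma proportional_if_cross_0:
  assumes "cross m n = 0" "n \<noteq> 0"
  obtains c where "m = c *s n"
proof -
  have c: "m $ 2 * n $ 3 = m $ 3 * n $ 2" "m $ 3 * n $ 1 = m $ 1 * n $ 3" "m $ 1 * n $ 2 = m $ 2 * n $ 1"
    using assms(1) by (simp_all add: vec3_eq_iff)
  obtain i where i: "n $ i \<noteq> 0" using assms(2) by (auto simp: vec_eq_iff)
  have "m = (m $ i / n $ i) *s n"
    using i exhaust_3[of i] c by (auto simp: vec3_eq_iff field_simps)
  then show ?thesis by (rule that)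
qed

lemma cross_nonzero_exists:
  assumes "n \<noteq> 0"
  shows "\<exists>e. cross n e \<noteq> 0"
proof (rule ccontr)
  assume "\<not> ?thesis"
  then have "cross n (vector [1, 0, 0]) = 0" "cross n (vector [0, 1, 0]) = 0" by blast+
  then have "n = 0" by (simp add: vec3_eq_iff)
  then show False using assms by simp
qed

lemma det3_nonzero_exists:
  assumes "cross a b \<noteq> 0"
  shows "\<exists>c. det3 a b c \<noteq> 0"
  using dot_eq_0_all[of "cross a b"] assms unfolding det3_def by blast

lemma combination_if_det3_0:
  assumes "cross a b \<noteq> 0" "det3 a b c = 0"
  obtains x y where "c = x *s a + y *s b"
proof -
  obtain d where d: "det3 a b d \<noteq> 0" using det3_nonzero_exists[OF assms(1)] by blast
  have "det3 b d c *s a - det3 a d c *s b - det3 a b d *s c = 0"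
    using vectors4_relation[of b d c a] assms(2) by simp
  then have "det3 a b d *s c = det3 b d c *s a + (- det3 a d c) *s b"
    by (simp add: vec3_eq_iff algebra_simps)
  then have "c = (det3 b d c / det3 a b d) *s a + (- det3 a d c / det3 a b d) *s b"
    using d by (simp add: vec3_eq_iff field_simps)
  then show ?thesis by (rule that)
qed

lemma det3_in_plane:
  assumes "n \<noteq> 0" "a \<in> plane n" "b \<in> plane n" "c \<in> plane n"
  shows "det3 a b c = 0"
proof (rule ccontr)
  assume d: "det3 a b c \<noteq> 0"
  have "dot n v = 0" for v
  proof -
    have "dot n (det3 b c v *s a - det3 a c v *s b + det3 a b v *s c - det3 a b c *s v) = 0"
      unfolding vectors4_relation by simp
    then show ?thesis using d assms by (simp add: plane_def)
  qed
  then show False using dot_eq_0_all assms(1) by blast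
qed

lemma normal_of_two:
  assumes "n \<noteq> 0" "a \<in> plane n" "b \<in> plane n"
  shows "cross n (cross a b) = 0"
  using assms unfolding plane_def dot_def by (simp add: vec3_eq_iff) algebra

lemma plane_eq_span:
  assumes "n \<noteq> 0" "a \<in> plane n" "b \<in> plane n" "cross a b \<noteq> 0"
  shows "plane n = plane (cross a b)" "\<And>v. v \<in> plane n \<longleftrightarrow> det3 a b v = 0"
proof -
  obtain c where c: "n = c *s cross a b"
    using proportional_if_cross_0[OF normal_of_two[OF assms(1-3)] assms(4)] by blast
  then have "c \<noteq> 0" using assms(1) by auto
  then show "plane n = plane (cross a b)" unfolding c plane_def by simp
  then show "\<And>v. v \<in> plane n \<longleftrightarrow> det3 a b v = 0" by (simp add: plane_def det3_def)
qed

lemma plane_basis: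
  assumes "n \<noteq> 0"
  obtains a b where "a \<in> plane n" "b \<in> plane n" "cross a b \<noteq> 0"
proof -
  obtain e where e: "cross n e \<noteq> 0" using cross_nonzero_exists[OF assms] by blast
  show ?thesis
  proof (cases "\<exists>f. cross (cross n e) (cross n f) \<noteq> 0")
    case True
    then obtain f where "cross (cross n e) (cross n f) \<noteq> 0" by blast
    then show ?thesis using that[of "cross n e" "cross n f"] by (simp add: plane_def)
  next
    case False
    then have "cross (cross n e) (cross n f) = det3 n e f *s n" for f 
      by (simp add: vec3_eq_iff det3_def dot_def algebra_simps)
    then have "det3 n e f = 0" for f using False assms by auto
    then show ?thesis using det3_nonzero_exists[OF e] by blast
  qed
qed

lemma plane_complete:
  assumes "n \<noteq> 0" "a \<in> plane n" "a \<noteq> 0"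
  obtains b where "b \<in> plane n" "cross a b \<noteq> 0"
proof -
  obtain u w where uw: "u \<in> plane n" "w \<in> plane n" "cross u w \<noteq> 0" using plane_basis[OF assms(1)] by blast
  have "cross a u \<noteq> 0 \<or> cross a w \<noteq> 0"
  proof (rule ccontr)
    assume *: "\<not> ?thesis"
    then have "cross u a = 0" "cross w a = 0" using cross_swap[of u a] cross_swap[of w a] by auto
    then obtain x y where "u = x *s a" "w = y *s a"
      using proportional_if_cross_0 assms(3) by metis
    then show False using uw(3) by (simp add: vec3_eq_iff)
  qed
  then show ?thesis using uw that by blast
qed

lemma plane_subset_imp:
  assumes "n \<noteq> 0" "plane n \<subseteq> plane m"
  obtains c where "m = c *s n"
proof -
  obtain u w where uw: "u \<in> plane n" "w \<in> plane n" "cross u w \<noteq> 0" using plane_basis[OF assms(1)] by blast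
  show ?thesis
  proof (cases "m = 0")
    case False
    obtain c d where c: "n = c *s cross u w" "m = d *s cross u w"
      using proportional_if_cross_0[OF normal_of_two uw(3)] False assms uw by (metis subsetD)
    then have "c \<noteq> 0" using assms(1) by auto
    then have "m = (d / c) *s n" using c by simp
    then show ?thesis by (rule that)
  qed (use that[of 0] in simp)
qed

lemma proj_line_iff: "proj_line L \<longleftrightarrow> (\<exists>n. n \<noteq> 0 \<and> L = plane n)"
  by (simp add: proj_line_def plane_def dot_def)

definition normal :: "(complex ^ 3) set \<Rightarrow> complex ^ 3" where
  "normal L = (SOME n. n \<noteq> 0 \<and> L = plane n)"

lemma
  assumes "proj_line L"
  shows normal_nonzero: "normal L \<noteq> 0" and plane_normal: "plane (normal L) = L"
  using someI_ex[OF assms[unfolded proj_line_iff]] by (auto simp: normal_def)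

lemma in_line_iff: "proj_line L \<Longrightarrow> v \<in> L \<longleftrightarrow> dot (normal L) v = 0"
  using plane_normal[of L] by (auto simp: plane_def)

lemma proj_line_plane: "n \<noteq> 0 \<Longrightarrow> proj_line (plane n)"
  by (auto simp: proj_line_iff)

lemma line_subset_imp_eq: "proj_line L \<Longrightarrow> proj_line M \<Longrightarrow> L \<subseteq> M \<Longrightarrow> L = M"
proof -
  assume *: "proj_line L" "proj_line M" "L \<subseteq> M"
  obtain n m where nm: "n \<noteq> 0" "L = plane n" "m \<noteq> 0" "M = plane m" using *(1,2) by (auto simp: proj_line_iff)
  obtain c where c: "m = c *s n" using plane_subset_imp[OF nm(1)] nm *(3) by blast
  then have "c \<noteq> 0" using nm by auto
  then show "L = M" using c nm by (simp add: plane_def)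
qed

lemma hompoly_dot: "hompoly n (\<lambda>v. F v $ 1) \<Longrightarrow> hompoly n (\<lambda>v. F v $ 2) \<Longrightarrow> hompoly n (\<lambda>v. F v $ 3) \<Longrightarrow> hompoly n (\<lambda>v. dot a (F v))"
  unfolding dot_def by (intro hompoly_intros)

lemma hompoly_dot_id: "hompoly 1 (\<lambda>v. dot a v)"
  by (intro hompoly_dot hompoly_coord) auto

lemma common_nonzero_point':
  assumes "finite F" "\<And>f. f \<in> F \<Longrightarrow> (\<exists>n. hompoly n f) \<and> (\<exists>v. f v \<noteq> 0)"
  shows "\<exists>v. \<forall>f\<in>F. f v \<noteq> 0"
proof -
  obtain n where "\<And>f. f \<in> F \<Longrightarrow> hompoly (n f) f" using assms(2) by metis
  then show ?thesis using common_nonzero_point[of F n id] assms by simp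
qed

lemma point_off_lines:
  assumes "finite S" "\<And>L. L \<in> S \<Longrightarrow> proj_line L"
  shows "\<exists>v. \<forall>L\<in>S. dot (normal L) v \<noteq> 0"
proof (rule common_nonzero_point[of S "\<lambda>_. 1"])
  show "\<exists>v. dot (normal L) v \<noteq> 0" if "L \<in> S" for L
    using dot_eq_0_all normal_nonzero assms(2)[OF that] by blast
qed (use assms in \<open>auto simp: hompoly_dot_id[simplified]\<close>)

text \<open>
  Choose \<open>k\<close> so that the difference \<open>F\<close> of the two sides vanishes at a point \<open>v0\<close> off all the planes. A
  generic line through \<open>v0\<close> meets the planes in as many distinct points as there are planes; together
  with \<open>v0\<close> these are more zeros than the degree of \<open>F\<close> allows.
\<close>

lemma product_of_lines:
  assumes "finite S" "\<And>L. L \<in> S \<Longrightarrow> proj_line L" "hompoly (card S) f" "\<And>L v. L \<in> S \<Longrightarrow> v \<in> L \<Longrightarrow> f v = 0"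
  obtains k where "\<And>v. f v = k * (\<Prod>L\<in>S. dot (normal L) v)"
proof -
  obtain v0 where v0: "\<And>L. L \<in> S \<Longrightarrow> dot (normal L) v0 \<noteq> 0" using point_off_lines[OF assms(1,2)] by blast
  define k where "k = f v0 / (\<Prod>L\<in>S. dot (normal L) v0)"
  define F where "F = (\<lambda>v. f v - k * (\<Prod>L\<in>S. dot (normal L) v))"
  have F: "hompoly (card S) F" unfolding F_def
    by (intro hompoly_diff assms(3) hompoly_cmult hompoly_prod_linear hompoly_dot_id)
  have F0: "F v0 = 0" using v0 assms(1) by (simp add: F_def k_def)
  have FL: "F v = 0" if "L \<in> S" "v \<in> L" for L v
  proof -
    have "dot (normal L) v = 0" using that in_line_iff assms(2) by blast
    then have "(\<Prod>L\<in>S. dot (normal L) v) = 0" using that assms(1) by (meson prod_zero)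
    then show ?thesis using assms(4) that by (simp add: F_def)
  qed
  have "F v = 0" for v
  proof (rule ccontr)
    assume Fv: "F v \<noteq> 0"
    \<comment> \<open>a direction on which the functions in \<open>Fs\<close> do not vanish is parallel to none of the planes, hits no
      two planes at the same parameter, and restricts \<open>F\<close> to a polynomial of full degree\<close>
    define G where "G = (\<lambda>(L,M). dot (dot (normal L) v0 *s normal M - dot (normal M) v0 *s normal L))"
    define Fs where "Fs = insert F ((\<lambda>L. dot (normal L)) ` S \<union>
       G ` {(L,M)\<in>S \<times> S. L \<noteq> M})"
    have "\<exists>w. \<forall>g\<in>Fs. g w \<noteq> 0"
    proof (rule common_nonzero_point')
      have "finite {(L,M)\<in>S \<times> S. L \<noteq> M}" by (rule finite_subset[of _ "S \<times> S"]) (use assms(1) in auto)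
      then show "finite Fs" using assms(1) by (simp add: Fs_def)
      fix g assume "g \<in> Fs"
      then consider "g = F" | L where "L \<in> S" "g = dot (normal L)" |
        L M where "L \<in> S" "M \<in> S" "L \<noteq> M" 
          "g = dot (dot (normal L) v0 *s normal M - dot (normal M) v0 *s normal L)"
        unfolding Fs_def by (auto simp only: G_def prod.case Un_iff insert_iff image_iff mem_Collect_eq mem_Sigma_iff)
      then show "(\<exists>n. hompoly n g) \<and> (\<exists>v. g v \<noteq> 0)"
      proof cases
        case 1 then show ?thesis using F Fv by blast
      next
        case 2
        then have "hompoly 1 g" "g v0 \<noteq> 0" using hompoly_dot_id v0 by auto
        then show ?thesis by blast
      next
        case 3
        have "dot (normal L) v0 *s normal M - dot (normal M) v0 *s normal L \<noteq> 0"
        proof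
          assume "dot (normal L) v0 *s normal M - dot (normal M) v0 *s normal L = 0"
          then have "dot (dot (normal L) v0 *s normal M - dot (normal M) v0 *s normal L) v = 0" for v by simp
          then have eq: "dot (normal L) v0 * dot (normal M) v = dot (normal M) v0 * dot (normal L) v" for v
            by simp
          have "dot (normal M) v = 0" if "dot (normal L) v = 0" for v
            using eq[of v] v0[OF 3(1)] unfolding that by simp
          then have "L \<subseteq> M"
            using in_line_iff[OF assms(2)[OF 3(1)]] in_line_iff[OF assms(2)[OF 3(2)]] by (simp add: subset_iff)
          then show False using line_subset_imp_eq[OF assms(2)[OF 3(1)] assms(2)[OF 3(2)]] 3(3) by simp
        qed
        then have "\<exists>v. g v \<noteq> 0" unfolding 3(4) using dot_eq_0_all by blast
        moreover have "hompoly 1 g" unfolding 3(4) by (rule hompoly_dot_id)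
        ultimately show ?thesis by blast
      qed
    qed
    then obtain w where w: "\<And>g. g \<in> Fs \<Longrightarrow> g w \<noteq> 0" by blast
    have w1: "F w \<noteq> 0" by (rule w) (simp add: Fs_def)
    have w2: "dot (normal L) w \<noteq> 0" if "L \<in> S" for L by (rule w) (use that in \<open>simp add: Fs_def\<close>)
    have w3: "dot (normal L) v0 * dot (normal M) w \<noteq> dot (normal M) v0 * dot (normal L) w" 
      if "L \<in> S" "M \<in> S" "L \<noteq> M" for L M
    proof -
      have "G (L, M) \<in> Fs"
        using that unfolding Fs_def by blast
      then have "G (L, M) w \<noteq> 0" by (rule w)
      then show ?thesis by (simp add: G_def)
    qed
    define t where "t = (\<lambda>L. - dot (normal L) v0 / dot (normal L) w)"
    have inj: "inj_on t S"
    proof (rule inj_onI, rule ccontr)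
      fix L M assume *: "L \<in> S" "M \<in> S" "t L = t M" "L \<noteq> M"
      then show False using w2[OF *(1)] w2[OF *(2)] w3[OF *(1,2,4)] by (simp add: t_def field_simps)
    qed
    have t0: "t L \<noteq> 0" if "L \<in> S" for L using v0[OF that] w2[OF that] by (simp add: t_def)
    let ?q = "along F v0 w"
    have "?q \<noteq> 0" using coeff_along_top[OF F, of v0 w] w1 by auto
    then have fin: "finite {x. poly ?q x = 0}" by (rule poly_roots_finite)
    have "insert 0 (t ` S) \<subseteq> {x. poly ?q x = 0}"
    proof clarsimp
      have "poly ?q (t L) = 0" if "L \<in> S" for L
      proof -
        have "dot (normal L) (v0 + t L *s w) = 0" using w2[OF that] by (simp add: t_def)
        then show ?thesis using FL[OF that] in_line_iff assms(2) that by (simp add: poly_along[OF F])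
      qed
      then show "poly ?q 0 = 0 \<and> t ` S \<subseteq> {x. poly ?q x = 0}" using F0 by (auto simp: poly_along[OF F])
    qed
    then have "card (insert 0 (t ` S)) \<le> card {x. poly ?q x = 0}" using fin by (rule card_mono[rotated])
    moreover have "card (insert 0 (t ` S)) = Suc (card S)"
      using t0 assms(1) inj by (subst card_insert_disjoint) (auto simp: card_image)
    moreover have "card {x. poly ?q x = 0} \<le> degree ?q" by (rule card_poly_roots_bound[OF \<open>?q \<noteq> 0\<close>])
    ultimately show False using degree_along[OF F, of v0 w] by simp
  qed
  then show ?thesis using that[of k] by (simp add: F_def)
qed

text \<open>
  Multiply \<open>f\<close> by a power of a linear form, so that the degree becomes the number of planes. If the
  linear form vanishes at a point off all the planes, the constant in \<open>product_of_lines\<close> is 0.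
\<close>

lemma zero_if_many_lines:
  assumes "finite S" "\<And>L. L \<in> S \<Longrightarrow> proj_line L" "hompoly n f" "n < card S" "\<And>L v. L \<in> S \<Longrightarrow> v \<in> L \<Longrightarrow> f v = 0"
  shows "f v = 0"
proof (rule ccontr)
  assume fv: "f v \<noteq> 0"
  obtain v0 where v0: "\<And>L. L \<in> S \<Longrightarrow> dot (normal L) v0 \<noteq> 0" using point_off_lines[OF assms(1,2)] by blast
  have "v0 \<noteq> 0" using v0 assms(4) by fastforce
  then obtain e where e: "cross v0 e \<noteq> 0" using cross_nonzero_exists by blast
  define j where "j = card S - n"
  define g where "g = (\<lambda>v. dot (cross v0 e) v ^ j)"
  have "hompoly j g" unfolding g_def by (rule hompoly_power[OF hompoly_dot_id]) simp
  then have "hompoly (card S) (\<lambda>v. f v * g v)" using assms(3,4) by (intro hompoly_mult) (auto simp: j_def)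
  then obtain k where k: "\<And>v. f v * g v = k * (\<Prod>L\<in>S. dot (normal L) v)"
    using product_of_lines[OF assms(1,2), of "\<lambda>v. f v * g v"] assms(5) by auto
  have "g v0 = 0" using assms(4) by (simp add: g_def j_def)
  then have "k = 0" using k[of v0] v0 assms(1) by simp
  moreover obtain u where "dot (cross v0 e) u \<noteq> 0" using dot_eq_0_all e by blast
  then have "g u \<noteq> 0" by (simp add: g_def)
  ultimately show False using hompoly_nonzero_mult[OF assms(3) \<open>hompoly j g\<close> fv] k by auto
qed

text \<open>
  The algebraic form of uniqueness for the linear differential equation \<open>b G' = R G\<close> with \<open>G(0) = 0\<close>: the
  order of vanishing at 0 drops by one on the left and cannot drop on the right.
\<close>

lemma zero_by_order:
  fixes G b R :: "complex poly"
  assumes "b * pderiv G = G * R" "poly b 0 \<noteq> 0" "poly G 0 = 0"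
  shows "G = 0"
proof (rule ccontr)
  assume G: "G \<noteq> 0"
  have p: "pderiv G \<noteq> 0"
  proof
    assume "pderiv G = 0"
    then have "degree G = 0" by (simp add: pderiv_eq_0_iff)
    then show False using G assms(3) by (metis degree_0_id poly_const_conv leading_coeff_0_iff degree_eq_zeroE)
  qed
  have b: "b \<noteq> 0" using assms(2) by auto
  have "order 0 G = Suc (order 0 (pderiv G))"
    using order_pderiv[OF G] assms(3) G by (simp add: order_root)
  moreover have "order 0 (b * pderiv G) = order 0 (pderiv G)"
    using p b assms(2) by (simp add: order_mult order_0I)
  moreover have "R \<noteq> 0" using assms(1) p b by auto
  then have "order 0 (G * R) = order 0 G + order 0 R" using G by (simp add: order_mult)
  ultimately show False using assms(1) by simp
qed

lemma polyfn_det3: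
  "(\<And>i. polyfn (\<lambda>t. a t $ i)) \<Longrightarrow> (\<And>i. polyfn (\<lambda>t. b t $ i)) \<Longrightarrow> (\<And>i. polyfn (\<lambda>t. c t $ i)) \<Longrightarrow>
    polyfn (\<lambda>t. det3 (a t) (b t) (c t))"
  unfolding det3_def dot_def cross_component by (intro polyfn_add polyfn_mult polyfn_diff) auto

lemma hompoly_det3:
  assumes "\<And>i. hompoly n (\<lambda>t. a t $ i)" "\<And>i. hompoly m (\<lambda>t. b t $ i)" "\<And>i. hompoly k (\<lambda>t. c t $ i)" "l = n + m + k"
  shows "hompoly l (\<lambda>t. det3 (a t) (b t) (c t))"
  unfolding det3_def dot_def cross_component assms(4)
  by (intro hompoly.add hompoly.mult hompoly_diff hompoly_mult[OF _ _ refl] assms)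

section \<open>Homogeneous vector fields and their invariant lines\<close>

locale vfield =
  fixes Z :: "complex ^ 3 \<Rightarrow> complex ^ 3"
  assumes hpZ: "hompoly 4 (\<lambda>v. Z v $ i)"
begin

definition DZ :: "complex ^ 3 \<Rightarrow> complex ^ 3 \<Rightarrow> complex ^ 3" where
  "DZ v w = (\<chi> i. dderiv (\<lambda>v. Z v $ i) v w)"

definition inv_line :: "(complex ^ 3) set \<Rightarrow> bool" where
  "inv_line L \<longleftrightarrow> proj_line L \<and> (\<forall>v\<in>L. Z v \<in> L)"

text \<open>
  The extactic polynomial. It vanishes at a nonsingular point iff the leaf through the point is
  inflectional there.
\<close>

definition extactic :: "complex ^ 3 \<Rightarrow> complex" where
  "extactic v = det3 v (Z v) (DZ v (Z v))"

lemma hpZ': "hompoly (Suc 3) (\<lambda>v. Z v $ i)"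
  using hpZ[of i] by (simp add: eval_nat_numeral)

lemma hompoly_dotZ: "hompoly 4 (\<lambda>v. dot n (Z v))"
  by (intro hompoly_dot hpZ)

lemma Z_scale: "Z (c *s v) = c ^ 4 *s Z v"
  using hompoly_scale[OF hpZ] by (simp add: vec_eq_iff)

lemma DZ_add: "DZ v (w + w') = DZ v w + DZ v w'"
  by (simp add: DZ_def vec_eq_iff dderiv_add[OF hpZ])

lemma DZ_scale: "DZ v (c *s w) = c *s DZ v w"
  by (simp add: DZ_def vec_eq_iff dderiv_scale[OF hpZ])

lemma DZ_diff: "DZ v (w - w') = DZ v w - DZ v w'"
  using DZ_add[of v "w - w'" w'] by simp

lemma DZ_scale_point: "DZ (c *s v) w = c ^ 3 *s DZ v w"
  by (simp add: DZ_def vec_eq_iff dderiv_scale_point[OF hpZ'])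

lemma DZ_self: "DZ v v = 4 *s Z v"
  by (simp add: DZ_def vec_eq_iff euler_identity[OF hpZ])

lemma dderiv_dotZ: "dderiv (\<lambda>v. dot n (Z v)) v w = dot n (DZ v w)"
proof -
  have "dderiv (\<lambda>v. (n $ 1 * Z v $ 1 + n $ 2 * Z v $ 2) + n $ 3 * Z v $ 3) v w =
     n $ 1 * dderiv (\<lambda>v. Z v $ 1) v w + n $ 2 * dderiv (\<lambda>v. Z v $ 2) v w + n $ 3 * dderiv (\<lambda>v. Z v $ 3) v w"
    by (subst dderiv_plus[where n=4 and m=4] dderiv_cmult[where n=4], (intro hompoly_intros hpZ)+)+ simp
  then show ?thesis by (simp add: dot_def DZ_def)
qed

lemma hompoly_DZ: "(\<And>i. hompoly m (\<lambda>v. W v $ i)) \<Longrightarrow> k = 3 + m \<Longrightarrow> hompoly k (\<lambda>v. DZ v (W v) $ i)"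
  unfolding DZ_def vec_lambda_beta by (rule hompoly_dderiv[OF hpZ'])

lemma polyfn_Z: "(\<And>i. polyfn (\<lambda>t. v t $ i)) \<Longrightarrow> polyfn (\<lambda>t. Z (v t) $ i)"
  by (rule polyfn_hompoly[OF hpZ])

lemma polyfn_DZ:
  "(\<And>i. polyfn (\<lambda>t. v t $ i)) \<Longrightarrow> (\<And>i. polyfn (\<lambda>t. w t $ i)) \<Longrightarrow> polyfn (\<lambda>t. DZ (v t) (w t) $ i)"
  by (simp add: DZ_def polyfn_dderiv[OF hpZ])

lemma inv_line_proj: "inv_line L \<Longrightarrow> proj_line L"
  by (simp add: inv_line_def)

lemma DZ_tangent:
  assumes "inv_line L" "v \<in> L" "w \<in> L"
  shows "DZ v w \<in> L"
proof -
  have p: "proj_line L" using assms(1) by (rule inv_line_proj)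
  have "along (\<lambda>v. dot (normal L) (Z v)) v w = 0"
  proof (rule along_eqI)
    fix t
    have "v + t *s w \<in> L" using assms(2,3) by (simp add: in_line_iff[OF p])
    then have "Z (v + t *s w) \<in> L" using assms(1) by (auto simp: inv_line_def)
    then show "dot (normal L) (Z (v + t *s w)) = poly 0 t" by (simp add: in_line_iff[OF p])
  qed
  then have "dot (normal L) (DZ v w) = 0" unfolding dderiv_dotZ[symmetric] by (simp add: dderiv_def)
  then show ?thesis by (simp add: in_line_iff[OF p])
qed

lemma hompoly_extactic: "hompoly 12 extactic"
  unfolding extactic_def
  by (intro hompoly_det3[where n=1 and m=4 and k=7] hompoly_coord hpZ hompoly_DZ) (auto intro: hpZ)

lemma extactic_invariant:
  assumes "inv_line L" "v \<in> L"
  shows "extactic v = 0"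
proof -
  have p: "proj_line L" using assms(1) by (rule inv_line_proj)
  have "Z v \<in> L" using assms by (simp add: inv_line_def)
  then have "DZ v (Z v) \<in> L" by (rule DZ_tangent[OF assms])
  then show ?thesis unfolding extactic_def
    using det3_in_plane[OF normal_nonzero[OF p]] plane_normal[OF p] assms(2) \<open>Z v \<in> L\<close> by auto
qed

text \<open>
  \<open>Z\<close> matters only modulo the radial field, so at each point any multiple of \<open>v\<close> may be subtracted. At a
  singular point this makes the second and third argument small.
\<close>

lemma extactic_shift:
  "extactic v = det3 v (Z v - c *s v) (DZ v (Z v - c *s v) - d *s (Z v - c *s v))"
  by (simp add: extactic_def DZ_diff DZ_scale DZ_self)

text \<open>
  If all points are inflectional, the leaf through a nonsingular \<open>v0\<close> is its tangent line. Let \<open>G(t)\<close> be the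
  normal component of \<open>Z\<close> at the point \<open>v0 + t Z(v0)\<close> of that line. The vanishing of the extactic polynomial
  turns the derivative of \<open>G\<close> into a multiple of \<open>G\<close> itself, up to a factor \<open>\<beta>\<^sup>2\<close> that is 1 at \<open>t = 0\<close>.
\<close>

lemma invariant_line_of_extactic_0:
  assumes "\<And>v. extactic v = 0" "cross v0 (Z v0) \<noteq> 0"
  shows "inv_line (plane (cross v0 (Z v0)))"
proof -
  define Z0 where "Z0 = Z v0"
  define V where "V = (\<lambda>t. v0 + t *s Z0)"
  obtain n' where "det3 v0 Z0 n' \<noteq> 0" using det3_nonzero_exists[OF assms(2)] by (auto simp: Z0_def)
  define n where "n = (1 / det3 v0 Z0 n') *s n'"
  have n: "det3 v0 Z0 n = 1" using \<open>det3 v0 Z0 n' \<noteq> 0\<close> by (simp add: n_def)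
  define G where "G = along (\<lambda>v. dot (cross v0 Z0) (Z v)) v0 Z0"
  have G: "poly G t = det3 v0 Z0 (Z (V t))" for t
    by (simp add: G_def V_def poly_along[OF hompoly_dotZ] det3_def)
  have G': "poly (pderiv G) t = det3 v0 Z0 (DZ (V t) Z0)" for t
    unfolding G_def V_def poly_pderiv_along[OF hompoly_dotZ] dderiv_dotZ det3_def ..
  define \<alpha> where "\<alpha> = (\<lambda>t. det3 Z0 n (Z (V t)))"
  define \<beta> where "\<beta> = (\<lambda>t. - det3 (V t) n (Z (V t)))"
  define \<rho> where "\<rho> = (\<lambda>t. - det3 (V t) n (DZ (V t) (Z (V t))) - 4 * \<alpha> t * \<beta> t - \<beta> t * det3 (V t) Z0 (DZ (V t) n))"
  have V: "polyfn (\<lambda>t. V t $ i)" for i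
    unfolding V_def by (simp add: polyfn_add polyfn_mult polyfn_const polyfn_id)
  have "polyfn (\<lambda>t. \<beta> t ^ 2)" "polyfn \<rho>" unfolding \<rho>_def \<beta>_def \<alpha>_def
    by (intro polyfn_power polyfn_uminus polyfn_diff polyfn_mult polyfn_const polyfn_det3 polyfn_DZ polyfn_Z V)+
  then obtain b R where bR: "\<And>t. \<beta> t ^ 2 = poly b t" "\<And>t. \<rho> t = poly R t" unfolding polyfn_def by blast
  have "poly (b * pderiv G) t = poly (G * R) t" for t
  proof -
    let ?v = "V t" and ?z = "Z (V t)" and ?W = "DZ (V t) (Z (V t))" and ?g = "poly G t"
    have VZ: "det3 ?v Z0 x = det3 v0 Z0 x" for x by (simp add: V_def)
    have "det3 Z0 n ?z *s ?v - det3 ?v n ?z *s Z0 + det3 ?v Z0 ?z *s n - det3 ?v Z0 n *s ?z = 0"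
      by (rule vectors4_relation)
    then have z: "\<beta> t *s Z0 = ?z - \<alpha> t *s ?v - ?g *s n"
      by (simp add: VZ n G \<alpha>_def \<beta>_def vec3_eq_iff algebra_simps)
    \<comment> \<open>\<open>\<beta> t *s Z0\<close> is replaced twice, in the steps 1 and 2; the vanishing of the extactic polynomial removes
      the only term without a factor \<open>G\<close>\<close>
    have "\<beta> t * poly (pderiv G) t = det3 ?v Z0 (DZ ?v (\<beta> t *s Z0))"
      by (simp add: G' VZ DZ_scale)
    also have "\<dots> = det3 ?v Z0 ?W - 4 * \<alpha> t * ?g - ?g * det3 ?v Z0 (DZ ?v n)"
      unfolding z by (simp add: DZ_diff DZ_scale DZ_self) (simp add: VZ G)
    finally have 1: "\<beta> t * poly (pderiv G) t = det3 ?v Z0 ?W - 4 * \<alpha> t * ?g - ?g * det3 ?v Z0 (DZ ?v n)" .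
    have "\<beta> t * det3 ?v Z0 ?W = det3 ?v (\<beta> t *s Z0) ?W" by simp
    also have "\<dots> = - ?g * det3 ?v n ?W"
      unfolding z using assms(1)[of ?v] by (simp add: extactic_def)
    finally have 2: "\<beta> t * det3 ?v Z0 ?W = - ?g * det3 ?v n ?W" .
    have "\<beta> t ^ 2 * poly (pderiv G) t = \<beta> t * (\<beta> t * poly (pderiv G) t)" by (simp add: power2_eq_square)
    also have "\<dots> = \<beta> t * det3 ?v Z0 ?W - 4 * \<alpha> t * \<beta> t * ?g - \<beta> t * ?g * det3 ?v Z0 (DZ ?v n)"
      unfolding 1 by (simp add: algebra_simps)
    also have "\<dots> = ?g * \<rho> t" unfolding 2 \<rho>_def by (simp add: algebra_simps)
    finally show ?thesis by (simp add: bR)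
  qed
  then have "b * pderiv G = G * R" using poly_eq_poly_eq_iff by blast
  moreover have "\<beta> 0 = 1" using n det3_swap(2)[of v0 n Z0] by (simp add: \<beta>_def V_def Z0_def[symmetric])
  then have "poly b 0 \<noteq> 0" using bR(1)[of 0] by simp
  moreover have "poly G 0 = 0" by (simp add: G V_def Z0_def[symmetric])
  ultimately have "G = 0" by (rule zero_by_order)
  have "det3 v0 Z0 (Z (x *s v0 + y *s Z0)) = 0" for x y
  proof (cases "x = 0")
    case True
    have "coeff G 4 = dot (cross v0 Z0) (Z Z0)" unfolding G_def by (rule coeff_along_top[OF hompoly_dotZ])
    then show ?thesis using \<open>G = 0\<close> True by (simp add: det3_def Z_scale)
  next
    case False
    then have "x *s v0 + y *s Z0 = x *s V (y / x)" by (simp add: V_def vec_eq_iff algebra_simps)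
    then show ?thesis using G[of "y / x"] \<open>G = 0\<close> by (simp add: Z_scale)
  qed
  then have "Z v \<in> plane (cross v0 Z0)" if "v \<in> plane (cross v0 Z0)" for v
  proof -
    have "det3 v0 Z0 v = 0" using that by (simp add: plane_def det3_def)
    then obtain x y where "v = x *s v0 + y *s Z0"
      using combination_if_det3_0[OF assms(2), of v] by (auto simp: Z0_def)
    then show ?thesis using \<open>\<And>x y. det3 v0 Z0 (Z (x *s v0 + y *s Z0)) = 0\<close> by (simp add: plane_def det3_def)
  qed
  then show ?thesis using assms(2) by (simp add: inv_line_def proj_line_plane Z0_def)
qed

text \<open>
  Finitely many invariant lines cannot pass through all nonsingular points.
\<close>

lemma extactic_nonzero:
  assumes "finite {L. inv_line L}" "cross u (Z u) \<noteq> 0"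
  shows "\<exists>v. extactic v \<noteq> 0"
proof (rule ccontr)
  assume "\<not> ?thesis"
  then have E: "extactic v = 0" for v by blast
  obtain i where i: "cross u (Z u) $ i \<noteq> 0" using assms(2) by (auto simp: vec_eq_iff)
  let ?c = "\<lambda>v. cross v (Z v) $ i"
  have c: "hompoly 5 ?c"
    using exhaust_3[of i] by (auto intro!: hompoly_diff hompoly_mult[where n=1 and m=4] hompoly_coord hpZ)
  have "\<exists>v. \<forall>f\<in>insert ?c ((\<lambda>L. dot (normal L)) ` {L. inv_line L}). f v \<noteq> 0"
  proof (rule common_nonzero_point')
    show "finite (insert ?c ((\<lambda>L. dot (normal L)) ` {L. inv_line L}))" using assms(1) by simp
    fix f assume "f \<in> insert ?c ((\<lambda>L. dot (normal L)) ` {L. inv_line L})"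
    then consider "f = ?c" | L where "inv_line L" "f = dot (normal L)" by auto
    then show "(\<exists>n. hompoly n f) \<and> (\<exists>v. f v \<noteq> 0)"
    proof cases
      case 1
      then show ?thesis using c i by blast
    next
      case 2
      have "\<exists>v. f v \<noteq> 0" unfolding 2(2) using dot_eq_0_all normal_nonzero[OF inv_line_proj[OF 2(1)]] by blast
      then show ?thesis using hompoly_dot_id[of "normal L"] 2(2) by blast
    qed
  qed
  then obtain v where v: "?c v \<noteq> 0" "\<And>L. inv_line L \<Longrightarrow> dot (normal L) v \<noteq> 0" by auto
  have "cross v (Z v) \<noteq> 0" using v(1) by auto
  then have L: "inv_line (plane (cross v (Z v)))" by (rule invariant_line_of_extactic_0[OF E])
  have "v \<in> plane (cross v (Z v))" by (simp add: plane_def)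
  then show False using v(2)[OF L] in_line_iff[OF inv_line_proj[OF L]] by simp
qed

end

section \<open>Local structure at the singular points\<close>

lemma polyfn_cancel_power:
  assumes "polyfn a" "polyfn b" "\<And>t. t ^ n * a t = t ^ n * b t"
  shows "a t = b t"
proof -
  obtain p q where pq: "\<And>t. a t = poly p t" "\<And>t. b t = poly q t" using assms(1,2) unfolding polyfn_def by blast
  have "monom 1 n * p = monom 1 n * q"
    by (rule poly_eq_poly_eq_iff[THEN iffD1]) (use assms(3) in \<open>auto simp: fun_eq_iff poly_monom pq\<close>)
  then show ?thesis by (simp add: pq)
qed

lemma polyfn_cancel_at_0:
  assumes "polyfn a" "polyfn b" "\<And>t. t ^ n * a t = t ^ m * b t" "n < m"
  shows "a 0 = 0"
proof -
  have "a 0 = 0 ^ (m - n) * b 0"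
  proof (rule polyfn_cancel_power[where t = 0 and n = n])
    fix t
    show "t ^ n * a t = t ^ n * (t ^ (m - n) * b t)"
      using assms(3)[of t] assms(4) by (simp add: mult.assoc[symmetric] power_add[symmetric])
  qed (intro assms polyfn_mult polyfn_power polyfn_id)+
  then show ?thesis using assms(4) by simp
qed

lemma polyfn_vanish_0:
  assumes "polyfn f" "f 0 = 0"
  obtains q where "polyfn q" "\<And>t. f t = t * q t"
proof -
  obtain p where p: "\<And>t. f t = poly p t" using assms(1) unfolding polyfn_def by blast
  then obtain r where "p = [:0, 1:] * r" using assms(2) poly_eq_0_iff_dvd[of p 0] by (auto elim: dvdE)
  then show ?thesis using p by (intro that[of "poly r"]) (auto simp: polyfn_def)
qed

lemma second_order:
  assumes "hompoly n f"
  obtains q where "polyfn q" "\<And>t. f (s + t *s w) = f s + t * dderiv f s w + t ^ 2 * q t"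
proof -
  obtain a p where p: "along f s w = pCons a p" by (cases "along f s w")
  obtain b q where q: "p = pCons b q" by (cases p)
  have "a = f s" "b = dderiv f s w"
    using coeff_along_0[OF assms, of s w] by (simp_all add: p q dderiv_def)
  then have "f (s + t *s w) = f s + t * dderiv f s w + t ^ 2 * poly q t" for t
    using poly_along[OF assms, of s w t] by (simp add: p q algebra_simps power2_eq_square)
  then show ?thesis by (rule that[rotated]) (auto simp: polyfn_def)
qed

lemma polyfn_dot: "(\<And>i. polyfn (\<lambda>t. b t $ i)) \<Longrightarrow> polyfn (\<lambda>t. dot a (b t))"
  unfolding dot_def by (intro polyfn_add polyfn_mult polyfn_const) auto

lemma polyfn_vec_scale: "polyfn f \<Longrightarrow> (\<And>i. polyfn (\<lambda>t. b t $ i)) \<Longrightarrow> polyfn (\<lambda>t. (f t *s b t) $ i)"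
  by (simp add: polyfn_mult)

lemma polyfn_vec_diff: "(\<And>i. polyfn (\<lambda>t. a t $ i)) \<Longrightarrow> (\<And>i. polyfn (\<lambda>t. b t $ i)) \<Longrightarrow> polyfn (\<lambda>t. (a t - b t) $ i)"
  by (simp add: polyfn_diff)

lemma polyfn_vec_add: "(\<And>i. polyfn (\<lambda>t. a t $ i)) \<Longrightarrow> (\<And>i. polyfn (\<lambda>t. b t $ i)) \<Longrightarrow> polyfn (\<lambda>t. (a t + b t) $ i)"
  by (simp add: polyfn_add)

lemmas polyfn_intros = polyfn_const polyfn_id polyfn_add polyfn_diff polyfn_uminus polyfn_mult polyfn_power
  polyfn_dot polyfn_det3 polyfn_vec_scale polyfn_vec_diff polyfn_vec_add

text \<open>
  The coprimality of the coefficients of the 1-form enters in the form \<open>nonvanishing\<close>, which is visibly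
  invariant under linear changes of coordinates: a line on which the 1-form vanishes would be a common factor.
\<close>

locale convex4 = vfield +
  assumes card12: "card {L. inv_line L} = 12"
    and nonvanishing: "proj_line L \<Longrightarrow> \<exists>v\<in>L. cross v (Z v) \<noteq> 0"
begin

definition S where "S = {L. inv_line L}"

lemma finite_S: "finite S" and card_S: "card S = 12"
  using card12 card.infinite[of S] by (auto simp: S_def)

lemma S_line: "L \<in> S \<Longrightarrow> proj_line L"
  by (simp add: S_def inv_line_proj)

lemma in_S_iff: "L \<in> S \<Longrightarrow> v \<in> L \<longleftrightarrow> dot (normal L) v = 0"
  using in_line_iff S_line by blast

lemma normal_S: "L \<in> S \<Longrightarrow> normal L \<noteq> 0"
  using normal_nonzero S_line by blast

lemma Z_in: "L \<in> S \<Longrightarrow> v \<in> L \<Longrightarrow> Z v \<in> L"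
  by (simp add: S_def inv_line_def)

lemma extactic_not_0: "\<exists>v. extactic v \<noteq> 0"
proof -
  have "proj_line (plane (vector [1, 0, 0]))" by (rule proj_line_plane) (simp add: vec3_eq_iff)
  then show ?thesis using nonvanishing extactic_nonzero finite_S unfolding S_def by blast
qed

text \<open>
  This is where the maximal number of lines is used: the degree of the extactic polynomial is exhausted by
  the invariant lines.
\<close>

lemma extactic_product:
  obtains k where "k \<noteq> 0" "\<And>v. extactic v = k * (\<Prod>L\<in>S. dot (normal L) v)"
proof -
  obtain k where k: "\<And>v. extactic v = k * (\<Prod>L\<in>S. dot (normal L) v)"
    using product_of_lines[OF finite_S S_line, of extactic] hompoly_extactic extactic_invariant
    unfolding card_S by (auto simp: S_def)
  moreover have "k \<noteq> 0" using k extactic_not_0 by auto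
  ultimately show ?thesis by (rule that[rotated])
qed

definition through :: "complex ^ 3 \<Rightarrow> (complex ^ 3) set set" where
  "through s = {L \<in> S. s \<in> L}"

lemma finite_through: "finite (through s)"
  using finite_S by (simp add: through_def)

text \<open>
  The factors of lines through \<open>s\<close> contribute \<open>t\<close> each along \<open>s + t w\<close>, and the others do not vanish at \<open>s\<close>.
\<close>

lemma extactic_order:
  obtains a where "polyfn a" "\<And>t. extactic (s + t *s w) = t ^ card (through s) * a t"
    "(\<And>L. L \<in> through s \<Longrightarrow> w \<notin> L) \<Longrightarrow> a 0 \<noteq> 0"
proof -
  obtain k where k: "k \<noteq> 0" "\<And>v. extactic v = k * (\<Prod>L\<in>S. dot (normal L) v)" by (rule extactic_product) blast
  define a where "a = (\<lambda>t. k * (\<Prod>L\<in>through s. dot (normal L) w) * (\<Prod>L\<in>S - through s. dot (normal L) (s + t *s w)))"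
  have "polyfn (\<lambda>t. \<Prod>L\<in>A. dot (normal L) (s + t *s w))" for A
    by (induction A rule: infinite_finite_induct) (auto simp: polyfn_intros)
  then have 1: "polyfn a" unfolding a_def by (intro polyfn_intros)
  have 2: "extactic (s + t *s w) = t ^ card (through s) * a t" for t
  proof -
    have "(\<Prod>L\<in>S. dot (normal L) (s + t *s w)) =
       (\<Prod>L\<in>through s. dot (normal L) (s + t *s w)) * (\<Prod>L\<in>S - through s. dot (normal L) (s + t *s w))"
      using prod.subset_diff[of "through s" S] finite_S by (simp add: through_def mult.commute)
    also have "(\<Prod>L\<in>through s. dot (normal L) (s + t *s w)) = (\<Prod>L\<in>through s. t * dot (normal L) w)"
      by (rule prod.cong) (auto simp: through_def in_S_iff)
    finally show ?thesis by (simp add: k a_def prod.distrib)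
  qed
  have 3: "a 0 \<noteq> 0" if "\<And>L. L \<in> through s \<Longrightarrow> w \<notin> L"
  proof -
    have "dot (normal L) w \<noteq> 0" if "L \<in> through s" for L
      using that \<open>\<And>L. L \<in> through s \<Longrightarrow> w \<notin> L\<close>[OF that] in_S_iff by (auto simp: through_def)
    then show ?thesis using finite_S k by (auto simp: a_def through_def in_S_iff)
  qed
  show ?thesis by (rule that[OF 1 2 3])
qed

lemma generic_direction:
  "\<exists>w. \<forall>L\<in>through s. w \<notin> L"
  using point_off_lines[OF finite_through, of s] S_line in_S_iff by (auto simp: through_def)

lemma Z_expansion:
  obtains Q where "\<And>i. polyfn (\<lambda>t. Q t $ i)" "\<And>t. Z (s + t *s w) = Z s + t *s DZ s w + t ^ 2 *s Q t"
proof -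
  have "\<exists>q. polyfn q \<and> (\<forall>t. Z (s + t *s w) $ i = Z s $ i + t * DZ s w $ i + t ^ 2 * q t)" for i
    by (rule second_order[OF hpZ[of i], of s w]) (auto simp: DZ_def)
  then have "\<exists>q. \<forall>i. polyfn (q i) \<and> (\<forall>t. Z (s + t *s w) $ i = Z s $ i + t * DZ s w $ i + t ^ 2 * q i t)"
    by (intro choice allI)
  then obtain q where
    q: "\<forall>i. polyfn (q i) \<and> (\<forall>t. Z (s + t *s w) $ i = Z s $ i + t * DZ s w $ i + t ^ 2 * q i t)" ..
  show ?thesis by (rule that[of "\<lambda>t. \<chi> i. q i t"]) (auto simp: q vec_eq_iff)
qed

text \<open>
  At a singular point \<open>Z - \<kappa> v\<close> is divisible by \<open>t\<close> along every line through the point, with the linear part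
  \<open>M\<close> of the foliation as the leading term, and it occurs twice in the extactic polynomial.
\<close>

lemma singular_order_2:
  assumes "Z s = \<kappa> *s s"
  defines "M \<equiv> \<lambda>w. DZ s w - \<kappa> *s w"
  obtains b where "polyfn b" "\<And>t. extactic (s + t *s w) = t ^ 2 * b t" "b 0 = det3 s (M w) (M (M w))"
proof -
  obtain Q where Q: "\<And>i. polyfn (\<lambda>t. Q t $ i)" "\<And>t. Z (s + t *s w) = Z s + t *s DZ s w + t ^ 2 *s Q t"
    by (rule Z_expansion[of s w]) blast
  define v where "v = (\<lambda>t. s + t *s w)"
  define Y where "Y = (\<lambda>t. M w + t *s Q t)"
  define b where "b = (\<lambda>t. det3 (v t) (Y t) (DZ (v t) (Y t) - \<kappa> *s Y t))"
  have Y: "Z (v t) - \<kappa> *s v t = t *s Y t" for t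
    by (simp add: v_def Q(2) Y_def M_def assms(1) vec_eq_iff algebra_simps power2_eq_square)
  have "polyfn b" unfolding b_def Y_def v_def by (intro polyfn_intros polyfn_DZ Q)
  moreover have "extactic (v t) = t ^ 2 * b t" for t
    unfolding extactic_shift[of "v t" \<kappa> \<kappa>] Y b_def
    by (simp add: DZ_scale power2_eq_square algebra_simps)
  moreover have "b 0 = det3 s (M w) (M (M w))" by (simp add: b_def Y_def v_def M_def)
  ultimately show ?thesis unfolding v_def by (rule that)
qed

lemma through_ge_2:
  assumes "Z s = \<kappa> *s s"
  shows "card (through s) \<ge> 2"
proof (rule ccontr)
  assume lt: "\<not> 2 \<le> card (through s)"
  obtain w where w: "\<forall>L\<in>through s. w \<notin> L" using generic_direction by blast
  obtain a where a: "polyfn a" "\<And>t. extactic (s + t *s w) = t ^ card (through s) * a t"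
    "(\<And>L. L \<in> through s \<Longrightarrow> w \<notin> L) \<Longrightarrow> a 0 \<noteq> 0" by (rule extactic_order[of s w]) blast
  obtain b where b: "polyfn b" "\<And>t. extactic (s + t *s w) = t ^ 2 * b t"
    by (rule singular_order_2[OF assms, of w]) blast
  have "a 0 = 0" by (rule polyfn_cancel_at_0[OF a(1) b(1)]) (use a(2) b(2) lt in \<open>simp_all add: linorder_not_le\<close>)
  then show False using a w by blast
qed

definition transversal :: "(complex ^ 3) set \<Rightarrow> complex ^ 3" where
  "transversal L = (SOME t. dot (normal L) t = 1)"

lemma transversal: "L \<in> S \<Longrightarrow> dot (normal L) (transversal L) = 1"
proof -
  assume "L \<in> S"
  then obtain t where "dot (normal L) t \<noteq> 0" using normal_S dot_eq_0_all by blast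
  then have "dot (normal L) ((1 / dot (normal L) t) *s t) = 1" by simp
  then show ?thesis unfolding transversal_def by (rule someI)
qed

definition eigenvalue :: "complex ^ 3 \<Rightarrow> complex" where
  "eigenvalue s = (THE \<kappa>. Z s = \<kappa> *s s)"

lemma eigenvalue: "s \<noteq> 0 \<Longrightarrow> Z s = \<kappa> *s s \<Longrightarrow> eigenvalue s = \<kappa>"
  unfolding eigenvalue_def by (rule the_equality) (auto simp: vec_eq_iff)

text \<open>
  For an invariant line \<open>L\<close> through the singular point \<open>s\<close>, the linear part acts on the normal direction of
  \<open>L\<close> by a scalar: this is the eigenvalue transversal to \<open>L\<close>, hence along any other invariant line it is
  the tangential eigenvalue (\<open>multiplier_other\<close>). It scales with the third power of the representative \<open>s\<close>.
\<close>

definition multiplier :: "(complex ^ 3) set \<Rightarrow> complex ^ 3 \<Rightarrow> complex" where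
  "multiplier L s = dot (normal L) (DZ s (transversal L)) - eigenvalue s"

lemma multiplier:
  assumes "L \<in> S" "s \<in> L" "s \<noteq> 0" "Z s = \<kappa> *s s"
  shows "dot (normal L) (DZ s w) = (\<kappa> + multiplier L s) * dot (normal L) w"
proof -
  define x where "x = dot (normal L) w"
  have "w - x *s transversal L \<in> L" by (simp add: in_S_iff[OF assms(1)] transversal[OF assms(1)] x_def)
  then have "DZ s (w - x *s transversal L) \<in> L" using DZ_tangent assms(1,2) by (simp add: S_def)
  then have "dot (normal L) (DZ s w) = x * dot (normal L) (DZ s (transversal L))"
    by (simp add: DZ_diff DZ_scale in_S_iff[OF assms(1)])
  then show ?thesis using eigenvalue[OF assms(3,4)] by (simp add: multiplier_def x_def)
qed

lemma multiplier_scale: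
  assumes "c \<noteq> 0" "L \<in> S" "s \<in> L" "s \<noteq> 0" "Z s = \<kappa> *s s"
  shows "multiplier L (c *s s) = c ^ 3 * multiplier L s"
proof -
  have "Z (c *s s) = (c ^ 3 * \<kappa>) *s (c *s s)"
    using assms(5) by (simp add: Z_scale eval_nat_numeral vec_eq_iff)
  moreover have "c *s s \<noteq> 0" using assms(1,4) by simp
  ultimately have "eigenvalue (c *s s) = c ^ 3 * eigenvalue s"
    using eigenvalue[of "c *s s"] eigenvalue[OF assms(4,5)] by simp
  then show ?thesis by (simp add: multiplier_def DZ_scale_point algebra_simps)
qed

text \<open>
  The tangential eigenvalue of \<open>L\<close> is the transversal eigenvalue of every other invariant line \<open>M\<close>: if \<open>u\<close> is
  not a multiple of \<open>s\<close>, it spans \<open>L\<close> modulo \<open>s\<close> and is transversal to \<open>M\<close>.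
\<close>

lemma multiplier_other:
  assumes "L \<in> S" "M \<in> S" "L \<noteq> M" "s \<in> L" "s \<in> M" "s \<noteq> 0" "Z s = \<kappa> *s s" "u \<in> L"
  obtains c where "DZ s u = (\<kappa> + multiplier M s) *s u + c *s s"
proof (cases "cross s u = 0")
  case True
  then have "cross u s = 0" using cross_swap[of u s] by simp
  then obtain c where "u = c *s s" using proportional_if_cross_0 assms(6) by blast
  then have "DZ s u = (\<kappa> + multiplier M s) *s u + (c * 4 * \<kappa> - (\<kappa> + multiplier M s) * c) *s s"
    unfolding \<open>u = c *s s\<close> DZ_scale DZ_self assms(7) by (simp add: vec_eq_iff algebra_simps)
  then show ?thesis by (rule that)
next
  case False
  have Ln: "normal L \<noteq> 0" "plane (normal L) = L" using assms(1) normal_S plane_normal S_line by auto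
  have "DZ s u \<in> L" using DZ_tangent assms(1,4,8) by (simp add: S_def)
  then have "det3 s u (DZ s u) = 0" using det3_in_plane[OF Ln(1)] assms(4,8) Ln(2) by simp
  then obtain x y where xy: "DZ s u = x *s s + y *s u" using combination_if_det3_0[OF False] by blast
  have "dot (normal M) u \<noteq> 0"
  proof
    assume *: "dot (normal M) u = 0"
    have "L = plane (cross s u)"
      using plane_eq_span(1)[OF Ln(1) _ _ False] assms(4,8) Ln(2) by simp
    moreover have "M = plane (cross s u)"
      using plane_eq_span(1)[OF normal_S[OF assms(2)] _ _ False] assms(2,5) * plane_normal[OF S_line[OF assms(2)]]
      by (simp add: in_S_iff plane_def)
    ultimately show False using assms(3) by simp
  qed
  moreover have "dot (normal M) s = 0" using assms(2,5) in_S_iff by blast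
  then have "y * dot (normal M) u = (\<kappa> + multiplier M s) * dot (normal M) u"
    using multiplier[OF assms(2,5,6,7), of u] by (simp only: xy dot_linear mult_zero_right add_0)
  ultimately have "y = \<kappa> + multiplier M s" using mult_right_cancel[THEN iffD1] by blast
  then show ?thesis using xy that[of x] by (simp add: add.commute[of "x *s s"])
qed

text \<open>
  Both sides are the tangential eigenvalue of the third line \<open>L\<close>.
\<close>

lemma multiplier_eq:
  assumes "L \<in> through s" "M \<in> through s" "N \<in> through s" "L \<noteq> M" "L \<noteq> N" "s \<noteq> 0" "Z s = \<kappa> *s s"
  shows "multiplier M s = multiplier N s"
proof -
  have T: "L \<in> S" "M \<in> S" "N \<in> S" "s \<in> L" "s \<in> M" "s \<in> N" using assms by (auto simp: through_def)
  obtain u where u: "u \<in> L" "cross s u \<noteq> 0"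
    using plane_complete[OF normal_S[OF T(1)], of s] T(4) assms(6) unfolding plane_normal[OF S_line[OF T(1)]] by auto
  obtain c where c: "DZ s u = (\<kappa> + multiplier M s) *s u + c *s s"
    using multiplier_other[OF T(1,2) assms(4) T(4,5) assms(6,7) u(1)] by blast
  obtain d where d: "DZ s u = (\<kappa> + multiplier N s) *s u + d *s s"
    using multiplier_other[OF T(1,3) assms(5) T(4,6) assms(6,7) u(1)] by blast
  have e: "(\<kappa> + multiplier M s) *s u + c *s s = (\<kappa> + multiplier N s) *s u + d *s s"
    by (rule trans[OF c[symmetric] d])
  have "((multiplier M s - multiplier N s) *s u) $ i = ((d - c) *s s) $ i" for i
    using arg_cong[OF e, of "\<lambda>v. v $ i"] by (simp add: algebra_simps)
  then have "(multiplier M s - multiplier N s) *s u = (d - c) *s s" unfolding vec_eq_iff by blast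
  then have "cross s ((multiplier M s - multiplier N s) *s u) = cross s ((d - c) *s s)" by simp
  also have "\<dots> = 0" by (simp add: vec3_eq_iff algebra_simps)
  finally have "cross s ((multiplier M s - multiplier N s) *s u) = 0" .
  moreover have "cross s ((multiplier M s - multiplier N s) *s u) = (multiplier M s - multiplier N s) *s cross s u"
    by (simp add: vec3_eq_iff algebra_simps)
  ultimately show ?thesis using u(2) by simp
qed

text \<open>
  With only two lines the order of the extactic polynomial is exactly 2, so its leading term
  \<open>det (s, M w, M (M w))\<close> is not zero. If the multiplier of \<open>L\<close> were zero, the image of \<open>M\<close> would lie in \<open>L\<close>.
\<close>

lemma multiplier_nonzero_double:
  assumes "L \<in> through s" "card (through s) = 2" "s \<noteq> 0" "Z s = \<kappa> *s s"
  shows "multiplier L s \<noteq> 0"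
proof
  assume 0: "multiplier L s = 0"
  have L: "L \<in> S" "s \<in> L" using assms(1) by (auto simp: through_def)
  obtain w where w: "\<forall>L\<in>through s. w \<notin> L" using generic_direction by blast
  obtain a where a: "polyfn a" "\<And>t. extactic (s + t *s w) = t ^ card (through s) * a t"
    "(\<And>L. L \<in> through s \<Longrightarrow> w \<notin> L) \<Longrightarrow> a 0 \<noteq> 0" by (rule extactic_order[of s w]) blast
  define M where "M = (\<lambda>w. DZ s w - \<kappa> *s w)"
  obtain b where b: "polyfn b" "\<And>t. extactic (s + t *s w) = t ^ 2 * b t" "b 0 = det3 s (M w) (M (M w))"
    unfolding M_def by (rule singular_order_2[OF assms(4), of w]) blast
  have "t ^ 2 * a t = t ^ 2 * b t" for t using a(2)[of t] unfolding assms(2) b(2) by (rule sym)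
  then have "a 0 = b 0" by (rule polyfn_cancel_power[OF a(1) b(1)])
  moreover have "M x \<in> plane (normal L)" for x
    using multiplier[OF L assms(3,4), of x] 0 by (simp add: M_def plane_def)
  then have "b 0 = 0" unfolding b(3)
    using det3_in_plane[OF normal_S[OF L(1)]] plane_normal[OF S_line[OF L(1)]] L(2) by simp
  ultimately show False using a w by auto
qed

text \<open>
  The contraction of the 1-form with the constant vector \<open>s\<close>. It measures the tangency of the foliation with
  the pencil of lines through \<open>s\<close>, and vanishes on every invariant line of that pencil.
\<close>

definition pencil_form :: "complex ^ 3 \<Rightarrow> complex ^ 3 \<Rightarrow> complex" where
  "pencil_form s v = det3 s v (Z v)"

lemma hompoly_pencil_form: "hompoly 5 (pencil_form s)"
  unfolding pencil_form_def
  by (intro hompoly_det3[where n=0 and m=1 and k=4] hompoly_coord hompoly_const hpZ) auto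

text \<open>
  Otherwise all lines through \<open>s\<close> would be invariant and the extactic polynomial would vanish everywhere.
\<close>

lemma pencil_form_not_0:
  assumes "s \<noteq> 0" "Z s = \<kappa> *s s"
  shows "\<exists>v. pencil_form s v \<noteq> 0"
proof (rule ccontr)
  assume "\<not> ?thesis"
  then have c: "det3 s v (Z v) = 0" for v by (auto simp: pencil_form_def)
  have "extactic v = 0" for v
  proof (cases "cross s v = 0")
    case True
    then have "cross v s = 0" using cross_swap[of v s] by simp
    then obtain x where x: "v = x *s s" using proportional_if_cross_0 assms(1) by blast
    have "Z v = (x ^ 3 * \<kappa>) *s v" by (simp add: x Z_scale assms(2) eval_nat_numeral vec_eq_iff)
    then show ?thesis by (simp add: extactic_def)
  next
    case False
    let ?P = "plane (cross s v)"
    have "Z y \<in> ?P" if y: "y \<in> ?P" for y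
    proof (cases "cross s y = 0")
      case True
      then have "cross y s = 0" using cross_swap[of y s] by simp
      then obtain x where x: "y = x *s s" using proportional_if_cross_0 assms(1) by blast
      then show ?thesis by (simp add: Z_scale assms(2) plane_def)
    next
      case F: False
      have "s \<in> ?P" by (simp add: plane_def)
      then show ?thesis using plane_eq_span(2)[OF False _ y F] c by blast
    qed
    then have "inv_line ?P" using False by (simp add: inv_line_def proj_line_plane)
    moreover have "v \<in> ?P" by (simp add: plane_def)
    ultimately show ?thesis by (rule extactic_invariant)
  qed
  then show False using extactic_not_0 by blast
qed

lemma pencil_form_line:
  assumes "L \<in> through s" "v \<in> L"
  shows "pencil_form s v = 0"
proof -
  have L: "L \<in> S" "s \<in> L" using assms(1) by (auto simp: through_def)
  show ?thesis unfolding pencil_form_def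
    using det3_in_plane[OF normal_S[OF L(1)]] plane_normal[OF S_line[OF L(1)]] L assms(2) Z_in by simp
qed

lemma through_le_5:
  assumes "s \<noteq> 0" "Z s = \<kappa> *s s"
  shows "card (through s) \<le> 5"
proof (rule ccontr)
  assume *: "\<not> ?thesis"
  have "pencil_form s v = 0" for v
    by (rule zero_if_many_lines[OF finite_through _ hompoly_pencil_form])
       (use * pencil_form_line S_line in \<open>auto simp: through_def\<close>)
  then show False using pencil_form_not_0[OF assms] by blast
qed

text \<open>
  The order \<open>j0\<close> of the pencil form at \<open>s\<close> is at least the number of invariant lines through \<open>s\<close>, because its
  leading form vanishes on them. The direction \<open>w\<close> is chosen off the zeros of the leading form, and
  \<open>cf\<close>, \<open>df\<close> are the pencil form and its derivative along \<open>w\<close> with the powers of \<open>t\<close> split off.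
\<close>

lemma pencil_form_order:
  assumes "s \<noteq> 0" "Z s = \<kappa> *s s" "card (through s) > 0"
  obtains w j0 cf df where "cross s w \<noteq> 0" "\<forall>L\<in>through s. w \<notin> L" "j0 \<ge> card (through s)"
    "polyfn cf" "\<And>t. pencil_form s (s + t *s w) = t ^ j0 * cf t"
    "\<And>y t. dderiv (pencil_form s) (s + t *s w) y = t ^ (j0 - 1) * df t y"
    "\<And>y. (\<And>i. polyfn (\<lambda>t. y t $ i)) \<Longrightarrow> polyfn (\<lambda>t. df t (y t))"
    "\<And>t c y. df t (c *s y) = c * df t y"
proof -
  let ?c = "pencil_form s"
  define cj where "cj = (\<lambda>j w. coeff (along ?c s w) j)"
  note hpc = hompoly_pencil_form[of s]
  have hpj: "hompoly j (cj j)" for j unfolding cj_def by (rule hompoly_coeff_along[OF hpc])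
  have expand: "?c (s + x) = (\<Sum>j\<le>5. cj j x)" for x
  proof -
    have "?c (s + x) = poly (along ?c s x) 1" by (simp add: poly_along[OF hpc])
    also have "\<dots> = (\<Sum>j\<le>5. cj j x)"
      unfolding poly_altdef cj_def
      by (rule sum.mono_neutral_cong_left) (use degree_along[OF hpc, of s x] in \<open>auto simp: coeff_eq_0\<close>)
    finally show ?thesis .
  qed
  have ex: "\<exists>j w. cj j w \<noteq> 0"
  proof -
    obtain v where "?c v \<noteq> 0" using pencil_form_not_0[OF assms(1,2)] by blast
    then have "(\<Sum>j\<le>5. cj j (v - s)) \<noteq> 0" using expand[of "v - s"] by simp
    then show ?thesis by (meson sum.not_neutral_contains_not_neutral)
  qed
  define j0 where "j0 = (LEAST j. \<exists>w. cj j w \<noteq> 0)"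
  have j0: "\<exists>w. cj j0 w \<noteq> 0" unfolding j0_def using ex by (rule LeastI_ex)
  have below: "cj j w = 0" if "j < j0" for j w using not_less_Least[of j] that unfolding j0_def by blast
  have vanish: "cj j w = 0" if "L \<in> through s" "w \<in> L" for j L w
  proof -
    have "along ?c s w = 0"
    proof (rule along_eqI)
      fix t
      have "s + t *s w \<in> L" using that by (auto simp: through_def in_S_iff)
      then show "?c (s + t *s w) = poly 0 t" using pencil_form_line that by simp
    qed
    then show ?thesis by (simp add: cj_def)
  qed
  have ge: "j0 \<ge> card (through s)"
  proof (rule ccontr)
    assume *: "\<not> ?thesis"
    have "cj j0 v = 0" for v
      by (rule zero_if_many_lines[OF finite_through _ hpj[of j0]]) (use * vanish S_line in \<open>auto simp: through_def\<close>)
    then show False using j0 by blast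
  qed
  have expand': "?c (s + x) = (\<Sum>j\<in>{j0..5}. cj j x)" for x
    unfolding expand by (rule sum.mono_neutral_right) (use below in auto)
  have D: "dderiv ?c (s + x) y = (\<Sum>j\<in>{j0..5}. dderiv (cj j) x y)" for x y
  proof -
    have "along ?c (s + x) y = (\<Sum>j\<in>{j0..5}. along (cj j) x y)"
    proof (rule along_eqI)
      fix t
      show "?c (s + x + t *s y) = poly (\<Sum>j\<in>{j0..5}. along (cj j) x y) t"
        using expand'[of "x + t *s y"] by (simp add: poly_sum poly_along[OF hpj] add.assoc)
    qed
    then show ?thesis by (simp add: dderiv_def coeff_sum)
  qed
  obtain w where w: "cj j0 w \<noteq> 0" using j0 by blast
  have off: "\<forall>L\<in>through s. w \<notin> L" using w vanish by blast
  obtain L where L: "L \<in> through s" using assms(3) by fastforce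
  have sw: "cross s w \<noteq> 0"
  proof
    assume "cross s w = 0"
    then have "cross w s = 0" using cross_swap[of w s] by simp
    then obtain x where "w = x *s s" using proportional_if_cross_0 assms(1) by blast
    then have "w \<in> L" using L by (auto simp: through_def in_S_iff)
    then show False using off L by blast
  qed
  define cf where "cf = (\<lambda>t. \<Sum>j\<in>{j0..5}. t ^ (j - j0) * cj j w)"
  define df where "df = (\<lambda>t y. \<Sum>j\<in>{j0..5}. t ^ (j - j0) * dderiv (cj j) w y)"
  have 1: "polyfn cf" unfolding cf_def by (intro polyfn_sum polyfn_mult polyfn_power polyfn_id polyfn_const)
  have 2: "?c (s + t *s w) = t ^ j0 * cf t" for t
    unfolding expand' cf_def sum_distrib_left
    by (rule sum.cong) (simp_all add: hompoly_scale[OF hpj] mult.assoc[symmetric] power_add[symmetric])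
  have j0pos: "j0 > 0" using ge assms(3) by simp
  have 3: "dderiv ?c (s + t *s w) y = t ^ (j0 - 1) * df t y" for t y
    unfolding D df_def sum_distrib_left
  proof (rule sum.cong)
    fix j assume "j \<in> {j0..5}"
    then have j: "j = Suc (j - 1)" "j - 1 = (j0 - 1) + (j - j0)" using j0pos by auto
    have "dderiv (cj j) (t *s w) y = t ^ (j - 1) * dderiv (cj j) w y"
      by (rule dderiv_scale_point) (use hpj[of j] j(1) in simp)
    also have "t ^ (j - 1) = t ^ (j0 - 1) * t ^ (j - j0)" by (subst j(2)) (rule power_add)
    finally show "dderiv (cj j) (t *s w) y = t ^ (j0 - 1) * (t ^ (j - j0) * dderiv (cj j) w y)" by (simp add: mult.assoc)
  qed simp
  have 4: "polyfn (\<lambda>t. df t (y t))" if "\<And>i. polyfn (\<lambda>t. y t $ i)" for y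
    unfolding df_def by (intro polyfn_sum polyfn_mult polyfn_power polyfn_id polyfn_dderiv[OF hpj] polyfn_const that)
  have 5: "df t (c *s y) = c * df t y" for t c y
    unfolding df_def dderiv_scale[OF hpj] sum_distrib_left by (rule sum.cong) auto
  show ?thesis by (rule that[OF sw off ge 1 2 3 4 5])
qed

lemma dderiv_pencil_form:
  "dderiv (pencil_form s) v y = det3 s y (Z v) + det3 s v (DZ v y)"
proof -
  obtain Q where Q: "\<And>i. polyfn (\<lambda>t. Q t $ i)" "\<And>t. Z (v + t *s y) = Z v + t *s DZ v y + t ^ 2 *s Q t"
    by (rule Z_expansion[of v y]) blast
  have "polyfn (\<lambda>t. det3 s y (DZ v y) + det3 s v (Q t) + t * det3 s y (Q t))"
    by (intro polyfn_intros Q)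
  then obtain q where q: "\<And>t. det3 s y (DZ v y) + det3 s v (Q t) + t * det3 s y (Q t) = poly q t" unfolding polyfn_def by blast
  have "along (pencil_form s) v y = pCons (pencil_form s v) (pCons (det3 s y (Z v) + det3 s v (DZ v y)) q)"
    by (rule along_eqI) (simp add: pencil_form_def Q(2) q[symmetric] algebra_simps power2_eq_square)
  then show ?thesis by (simp add: dderiv_def)
qed

text \<open>
  At a point of three or more lines the linear part is a scalar modulo \<open>s\<close>. If this scalar were 0, then
  \<open>Z\<close> could be normalized to vanish to second order at \<open>s\<close>. Writing the extactic polynomial through the
  pencil form (of order \<open>j0\<close>) by means of the relation between the four vectors \<open>s\<close>, \<open>v\<close>, \<open>Y\<close>, \<open>W\<close> would then
  give it order at least \<open>j0 + 2\<close>, but its order is the number of lines, which is at most \<open>j0\<close>.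
\<close>

lemma multiplier_nonzero_radial:
  assumes "L \<in> through s" "card (through s) \<ge> 3" "s \<noteq> 0" "Z s = \<kappa> *s s"
  shows "multiplier L s \<noteq> 0"
proof
  assume "multiplier L s = 0"
  obtain w j0 cf df where w: "cross s w \<noteq> 0" "\<forall>L\<in>through s. w \<notin> L" "j0 \<ge> card (through s)"
    "polyfn cf" "\<And>t. pencil_form s (s + t *s w) = t ^ j0 * cf t"
    "\<And>y t. dderiv (pencil_form s) (s + t *s w) y = t ^ (j0 - 1) * df t y"
    "\<And>y. (\<And>i. polyfn (\<lambda>t. y t $ i)) \<Longrightarrow> polyfn (\<lambda>t. df t (y t))"
    "\<And>t c y. df t (c *s y) = c * df t y"
    by (rule pencil_form_order[OF assms(3,4)]) (use assms(2) in auto)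
  have "card (through s - {L}) > 0"
    using assms(1,2) finite_through by (simp add: card_Diff_subset)
  then have "through s - {L} \<noteq> {}" by (simp only: card_gt_0_iff) blast
  then obtain M where M: "M \<in> through s" "M \<noteq> L" by blast
  have "card (through s - {L, M}) > 0"
    using assms(1,2) M finite_through by (simp add: card_Diff_subset)
  then have "through s - {L, M} \<noteq> {}" by (simp only: card_gt_0_iff) blast
  then obtain N where N: "N \<in> through s" "N \<noteq> L" "N \<noteq> M" by blast
  have mM: "multiplier M s = 0"
    using multiplier_eq[OF N(1) assms(1) M(1) N(2,3) assms(3,4)] \<open>multiplier L s = 0\<close> by simp
  have LM: "L \<in> S" "M \<in> S" "s \<in> L" "s \<in> M" using assms(1) M by (auto simp: through_def)
  have "\<exists>\<mu>. DZ s x - \<kappa> *s x = \<mu> *s s" for x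
  proof -
    let ?m = "DZ s x - \<kappa> *s x"
    have "?m \<in> L" "?m \<in> M"
      using multiplier[OF LM(1,3) assms(3,4), of x] multiplier[OF LM(2,4) assms(3,4), of x] mM \<open>multiplier L s = 0\<close>
      by (simp_all add: in_S_iff LM)
    have "cross ?m s = 0"
    proof (rule ccontr)
      assume *: "cross ?m s \<noteq> 0"
      have "L = plane (cross ?m s)"
        using plane_eq_span(1)[OF normal_S[OF LM(1)] _ _ *] \<open>?m \<in> L\<close> LM(3) plane_normal[OF S_line[OF LM(1)]] by simp
      moreover have "M = plane (cross ?m s)"
        using plane_eq_span(1)[OF normal_S[OF LM(2)] _ _ *] \<open>?m \<in> M\<close> LM(4) plane_normal[OF S_line[OF LM(2)]] by simp
      ultimately show False using M by simp
    qed
    then show ?thesis using proportional_if_cross_0 assms(3) by blast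
  qed
  then obtain \<mu> where \<mu>: "\<And>x. DZ s x - \<kappa> *s x = \<mu> x *s s" by metis
  obtain r' where "det3 s w r' \<noteq> 0" using det3_nonzero_exists[OF w(1)] by blast
  define r where "r = (1 / det3 s w r') *s r'"
  have r: "det3 s w r = 1" using \<open>det3 s w r' \<noteq> 0\<close> by (simp add: r_def)
  \<comment> \<open>dual coordinates for \<open>w\<close> and \<open>s\<close>\<close>
  define \<phi> where "\<phi> = dot (cross r s)"
  define \<psi> where "\<psi> = dot (cross w r)"
  have \<phi>: "\<phi> s = 0" "\<phi> w = 1" using r by (simp_all add: \<phi>_def dot_def algebra_simps det3_def)
  have \<psi>: "\<psi> s = 1" "\<psi> w = 0" using r by (simp_all add: \<psi>_def dot_def algebra_simps det3_def)
  obtain Q where Q: "\<And>i. polyfn (\<lambda>t. Q t $ i)" "\<And>t. Z (s + t *s w) = Z s + t *s DZ s w + t ^ 2 *s Q t"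
    by (rule Z_expansion[of s w]) blast
  define v where "v = (\<lambda>t. s + t *s w)"
  \<comment> \<open>the multiple of \<open>v\<close> to subtract from \<open>Z\<close>, so that the terms of order 0 and 1 cancel\<close>
  define \<gamma> where "\<gamma> = (\<lambda>t. \<kappa> + t * \<mu> w)"
  define Y where "Y = (\<lambda>t. Q t - \<mu> w *s w)"
  define W where "W = (\<lambda>t. DZ (v t) (Y t) - \<gamma> t *s Y t)"
  have pY: "polyfn (\<lambda>t. Y t $ i)" for i unfolding Y_def by (intro polyfn_intros Q)
  have pW: "polyfn (\<lambda>t. W t $ i)" for i unfolding W_def v_def \<gamma>_def by (intro polyfn_intros polyfn_DZ pY)
  have Y: "Z (v t) - \<gamma> t *s v t = t ^ 2 *s Y t" for t
  proof -
    have d: "DZ s w = \<kappa> *s w + \<mu> w *s s" using \<mu>[of w] by (simp add: vec_eq_iff algebra_simps)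
    show ?thesis unfolding v_def Q(2) d assms(4) Y_def \<gamma>_def by (simp add: vec_eq_iff algebra_simps power2_eq_square)
  qed
  have Zv: "Z (v t) = t ^ 2 *s Y t + \<gamma> t *s v t" for t using Y[of t] by (simp add: vec_eq_iff algebra_simps)
  have E: "extactic (v t) = t ^ 4 * det3 (v t) (Y t) (W t)" for t
    unfolding extactic_shift[of "v t" "\<gamma> t" "\<gamma> t"] Y W_def DZ_scale by (simp add: algebra_simps eval_nat_numeral)
  have c: "t ^ 2 * det3 s (v t) (Y t) = t ^ j0 * cf t" for t
  proof -
    have "pencil_form s (v t) = t ^ 2 * det3 s (v t) (Y t)" by (simp add: pencil_form_def Zv)
    then show ?thesis using w(5)[of t] by (simp add: v_def)
  qed
  have d: "t ^ 2 * det3 s (v t) (W t) = t ^ (j0 - 1) * (t ^ 2 * df t (Y t))" for t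
  proof -
    have "t ^ (j0 - 1) * (t ^ 2 * df t (Y t)) = dderiv (pencil_form s) (v t) (t ^ 2 *s Y t)"
      by (simp add: v_def w(6,8))
    also have "\<dots> = t ^ 2 * det3 s (v t) (W t)"
      unfolding dderiv_pencil_form Zv DZ_scale W_def using det3_swap(2)[of s "v t" "Y t"] by (simp add: algebra_simps)
    finally show ?thesis by (rule sym)
  qed
  have W0: "\<phi> (W 0) = 0"
    using \<mu>[of "Y 0"] \<phi>(1) by (simp add: W_def v_def \<gamma>_def \<phi>_def)
  have "polyfn (\<lambda>t. \<phi> (W t))" unfolding \<phi>_def by (intro polyfn_dot pW)
  then obtain p where p: "polyfn p" "\<And>t. \<phi> (W t) = t * p t" by (rule polyfn_vanish_0[where f = "\<lambda>t. \<phi> (W t)", OF _ W0]) blast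
  obtain a where a: "polyfn a" "\<And>t. extactic (s + t *s w) = t ^ card (through s) * a t"
    "(\<And>L. L \<in> through s \<Longrightarrow> w \<notin> L) \<Longrightarrow> a 0 \<noteq> 0" by (rule extactic_order[of s w]) blast
  define q where "q = (\<lambda>t. df t (Y t) * \<phi> (Y t) - cf t * p t - t * df t (Y t) * \<psi> (Y t) + cf t * \<psi> (W t))"
  have "polyfn q" unfolding q_def \<phi>_def \<psi>_def by (intro polyfn_intros w pY pW p)
  have "t ^ (card (through s) + 1) * a t = t ^ (j0 + 3) * q t" for t
  proof -
    obtain j where j: "j0 = Suc j" using w(3) assms(2) by (cases j0) auto
    let ?v = "v t" and ?Y = "Y t" and ?W = "W t"
    let ?R = "det3 ?v ?Y ?W *s s - det3 s ?Y ?W *s ?v + det3 s ?v ?W *s ?Y - det3 s ?v ?Y *s ?W"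
    have R: "?R = 0" by (rule vectors4_relation)
    have "\<phi> ?R = 0" "\<psi> ?R = 0" unfolding R by (simp_all add: \<phi>_def \<psi>_def)
    moreover have "\<phi> ?v = t" "\<psi> ?v = 1" using \<phi> \<psi> by (simp_all add: v_def \<phi>_def \<psi>_def)
    ultimately have 1: "det3 s ?Y ?W * t = det3 s ?v ?W * \<phi> ?Y - det3 s ?v ?Y * \<phi> ?W"
      and 2: "det3 ?v ?Y ?W = det3 s ?Y ?W - det3 s ?v ?W * \<psi> ?Y + det3 s ?v ?Y * \<psi> ?W"
      using \<phi> \<psi> by (simp_all add: \<phi>_def \<psi>_def algebra_simps)
    have "t ^ (card (through s) + 1) * a t = t * extactic ?v" by (simp add: a(2) v_def)
    also have "\<dots> = t ^ 4 * (det3 s ?Y ?W * t - t * det3 s ?v ?W * \<psi> ?Y + t * det3 s ?v ?Y * \<psi> ?W)"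
      unfolding E 2 by (simp add: algebra_simps)
    also have "\<dots> = t ^ 2 * (t ^ 2 * det3 s ?v ?W) * (\<phi> ?Y - t * \<psi> ?Y)
          + t ^ 2 * (t ^ 2 * det3 s ?v ?Y) * (t * \<psi> ?W - \<phi> ?W)"
      unfolding 1 by (simp add: algebra_simps eval_nat_numeral)
    also have "\<dots> = t ^ (j0 + 3) * q t"
      unfolding c d q_def p(2) j by (simp add: algebra_simps eval_nat_numeral)
    finally show ?thesis .
  qed
  then have "a 0 = 0" by (rule polyfn_cancel_at_0[OF a(1) \<open>polyfn q\<close>]) (use w(3) in simp)
  then show False using a(3) w(2) by blast
qed

lemma multiplier_nonzero:
  assumes "L \<in> through s" "s \<noteq> 0" "Z s = \<kappa> *s s"
  shows "multiplier L s \<noteq> 0"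
  using through_ge_2[OF assms(3)] multiplier_nonzero_double[OF assms(1) _ assms(2,3)]
    multiplier_nonzero_radial[OF assms(1) _ assms(2,3)] by (cases "card (through s) = 2") auto

end

section \<open>The index theorem on an invariant line\<close>

text \<open>
  Compare the leading coefficients of \<open>g\<close> and of its Lagrange interpolation at the roots of \<open>f\<close>.
\<close>
lemma sum_over_simple_roots:
  fixes f g :: "complex poly"
  assumes "degree f = Suc n" "\<And>x. poly f x = 0 \<Longrightarrow> poly (pderiv f) x \<noteq> 0" "degree g \<le> n"
  shows "card {x. poly f x = 0} = Suc n"
    "(\<Sum>x | poly f x = 0. poly g x / poly (pderiv f) x) = coeff g n / lead_coeff f"
proof -
  define R where "R = {x. poly f x = 0}"
  have f0: "f \<noteq> 0" using assms(1) by auto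
  then have fin: "finite R" unfolding R_def by (rule poly_roots_finite)
  have "rsquarefree f" unfolding rsquarefree_roots using assms(2) by blast
  then have dec: "smult (lead_coeff f) (\<Prod>z\<in>R. [:-z, 1:]) = f"
    unfolding R_def by (rule complex_poly_decompose_rsquarefree)
  have deg: "degree (\<Prod>z\<in>A. [:-z, 1:]) = card A" for A :: "complex set"
    by (induction A rule: infinite_finite_induct) (auto simp: degree_mult_eq simp del: mult_pCons_left)
  have card: "card R = Suc n"
  proof -
    have "degree f = degree (smult (lead_coeff f) (\<Prod>z\<in>R. [:-z, 1:]))" by (rule arg_cong[OF dec[symmetric]])
    also have "\<dots> = card R" using f0 deg by (simp add: degree_smult_eq)
    finally show ?thesis using assms(1) by simp
  qed
  then show "card {x. poly f x = 0} = Suc n" by (simp add: R_def)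
  have f': "poly (pderiv f) x = lead_coeff f * poly (\<Prod>z\<in>R - {x}. [:-z, 1:]) x" if x: "x \<in> R" for x
  proof -
    have "(\<Prod>z\<in>R. [:-z, 1:]) = [:-x, 1:] * (\<Prod>z\<in>R - {x}. [:-z, 1:])"
      using fin x by (rule prod.remove)
    then have "f = smult (lead_coeff f) ([:-x, 1:] * (\<Prod>z\<in>R - {x}. [:-z, 1:]))" using dec by simp
    then have "pderiv f = smult (lead_coeff f) (pderiv ([:-x, 1:] * (\<Prod>z\<in>R - {x}. [:-z, 1:])))"
      by (metis pderiv_smult)
    then show ?thesis unfolding pderiv_mult by (simp add: pderiv_pCons)
  qed
  define h where "h = (\<Sum>x\<in>R. smult (poly g x / poly (pderiv f) x) (smult (lead_coeff f) (\<Prod>z\<in>R - {x}. [:-z, 1:])))"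
  have cR: "card (R - {x}) = n" if "x \<in> R" for x using that card by simp
  have "degree h \<le> n" unfolding h_def
    by (rule degree_sum_le[OF fin]) (use deg cR degree_smult_le in \<open>metis order_trans order_refl\<close>)
  have "poly h y = poly g y" if y: "y \<in> R" for y
  proof -
    have "poly h y = (\<Sum>x\<in>R. poly g x / poly (pderiv f) x * (lead_coeff f * poly (\<Prod>z\<in>R - {x}. [:-z, 1:]) y))"
      by (simp add: h_def poly_sum mult.assoc)
    also have "\<dots> = (\<Sum>x\<in>{y}. poly g x / poly (pderiv f) x * (lead_coeff f * poly (\<Prod>z\<in>R - {x}. [:-z, 1:]) y))"
      by (rule sum.mono_neutral_right[OF fin]) (use y fin in \<open>auto simp: poly_prod\<close>)
    also have "\<dots> = poly g y" using f'[OF y] assms(2)[of y] y by (simp add: R_def)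
    finally show ?thesis .
  qed
  then have "h = g"
    by (rule poly_eqI_degree[of R]) (use card \<open>degree h \<le> n\<close> assms(3) in auto)
  moreover have "coeff h n = (\<Sum>x\<in>R. poly g x / poly (pderiv f) x) * lead_coeff f"
  proof -
    have "coeff (\<Prod>z\<in>R - {x}. [:-z, 1:]) n = 1" if "x \<in> R" for x
    proof -
      have "coeff (\<Prod>z\<in>R - {x}. [:-z, 1:]) n = lead_coeff (\<Prod>z\<in>R - {x}. [:-z, 1:])"
        by (simp only: deg cR[OF that])
      also have "\<dots> = 1" by (simp add: lead_coeff_prod)
      finally show ?thesis .
    qed
    then show ?thesis by (simp add: h_def coeff_sum sum_distrib_right)
  qed
  ultimately show "(\<Sum>x | poly f x = 0. poly g x / poly (pderiv f) x) = coeff g n / lead_coeff f"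
    using f0 by (simp add: R_def[symmetric] field_simps)
qed

definition ray :: "complex ^ 3 \<Rightarrow> (complex ^ 3) set" where
  "ray s = range (\<lambda>c. c *s s)"

lemma in_ray: "s \<in> ray s"
  unfolding ray_def by (rule range_eqI[of _ _ 1]) simp

context convex4
begin

definition points :: "(complex ^ 3) set \<Rightarrow> (complex ^ 3) set set" where
  "points L = (\<lambda>M. L \<inter> M) ` (S - {L})"

definition lines_through :: "(complex ^ 3) set \<Rightarrow> (complex ^ 3) set set" where
  "lines_through p = {M \<in> S. p \<subseteq> M}"

lemma ray_subset_iff: "M \<in> S \<Longrightarrow> ray s \<subseteq> M \<longleftrightarrow> s \<in> M"
proof
  assume "M \<in> S" "s \<in> M"
  then show "ray s \<subseteq> M" unfolding ray_def using in_S_iff by auto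
qed (use in_ray[of s] in blast)

lemma lines_through_ray: "lines_through (ray s) = through s"
  by (simp add: lines_through_def through_def ray_subset_iff cong: conj_cong)

lemma inter_eq_ray:
  assumes "L \<in> S" "M \<in> S" "L \<noteq> M" "s \<noteq> 0" "s \<in> L" "s \<in> M"
  shows "L \<inter> M = ray s"
proof
  show "ray s \<subseteq> L \<inter> M" using assms ray_subset_iff by blast
  show "L \<inter> M \<subseteq> ray s"
  proof
    fix y assume y: "y \<in> L \<inter> M"
    have "cross s y = 0"
    proof (rule ccontr)
      assume *: "cross s y \<noteq> 0"
      have "K = plane (cross s y)" if "K \<in> S" "s \<in> K" "y \<in> K" for K
        using plane_eq_span(1)[OF normal_S[OF that(1)] _ _ *] that plane_normal[OF S_line[OF that(1)]] by simp
      then show False using assms y by blast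
    qed
    then have "cross y s = 0" using cross_swap[of y s] by simp
    then obtain c where "y = c *s s" using proportional_if_cross_0 assms(4) by blast
    then show "y \<in> ray s" unfolding ray_def by blast
  qed
qed

lemma inter_nonzero:
  assumes "L \<in> S" "M \<in> S" "L \<noteq> M"
  obtains s where "s \<noteq> 0" "s \<in> L" "s \<in> M"
proof -
  let ?s = "cross (normal L) (normal M)"
  have "?s \<noteq> 0"
  proof
    assume "?s = 0"
    then obtain c where c: "normal L = c *s normal M"
      using proportional_if_cross_0 normal_S[OF assms(2)] by blast
    then have "M \<subseteq> L" using in_S_iff assms by auto
    then show False using line_subset_imp_eq S_line assms by blast
  qed
  moreover have "?s \<in> L" "?s \<in> M" using assms by (simp_all add: in_S_iff)
  ultimately show ?thesis by (rule that)
qed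

lemma singular_inter:
  assumes "L \<in> S" "M \<in> S" "L \<noteq> M" "s \<noteq> 0" "s \<in> L" "s \<in> M"
  obtains \<kappa> where "Z s = \<kappa> *s s"
proof -
  have "Z s \<in> L \<inter> M" using Z_in assms by blast
  then show ?thesis using that unfolding inter_eq_ray[OF assms] ray_def by blast
qed

lemma points_ray:
  assumes "L \<in> S" "p \<in> points L"
  obtains s \<kappa> M where "s \<noteq> 0" "s \<in> L" "Z s = \<kappa> *s s" "p = ray s" "M \<in> S" "M \<noteq> L" "s \<in> M"
proof -
  obtain M where M: "M \<in> S" "M \<noteq> L" "p = L \<inter> M" using assms(2) by (auto simp: points_def)
  obtain s where s: "s \<noteq> 0" "s \<in> L" "s \<in> M" using inter_nonzero[OF assms(1) M(1)] M(2) by metis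
  obtain \<kappa> where "Z s = \<kappa> *s s" using singular_inter[OF assms(1) M(1) _ s] M(2) by metis
  then show ?thesis using that M s inter_eq_ray[OF assms(1) M(1) _ s] by simp
qed

lemma ray_in_points: "L \<in> S \<Longrightarrow> M \<in> S \<Longrightarrow> L \<noteq> M \<Longrightarrow> s \<noteq> 0 \<Longrightarrow> s \<in> L \<Longrightarrow> s \<in> M \<Longrightarrow> ray s \<in> points L"
  using inter_eq_ray[of L M s] by (auto simp: points_def)

lemma other_line_through:
  assumes "Z s = \<kappa> *s s"
  obtains M where "M \<in> through s" "M \<noteq> L"
proof -
  have "through s \<noteq> {}" "\<not> through s \<subseteq> {L}"
    using through_ge_2[OF assms] card_mono[of "{L}" "through s"] by auto
  then show ?thesis using that by blast
qed

text \<open>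
  The Camacho-Sad index of \<open>L\<close> at the point \<open>p\<close>: transversal eigenvalue over tangential eigenvalue. The latter
  is the multiplier of any other invariant line through \<open>p\<close>, and the quotient does not depend on the
  choices (\<open>index_ray\<close>).
\<close>

definition index :: "(complex ^ 3) set \<Rightarrow> (complex ^ 3) set \<Rightarrow> complex" where
  "index L p = (let s = SOME s. s \<noteq> 0 \<and> s \<in> p; M = SOME M. M \<in> lines_through p \<and> M \<noteq> L in
     multiplier L s / multiplier M s)"

lemma index_ray:
  assumes "L \<in> through s" "M \<in> through s" "M \<noteq> L" "s \<noteq> 0" "Z s = \<kappa> *s s"
  shows "index L (ray s) = multiplier L s / multiplier M s"
proof -
  define s' where "s' = (SOME s'. s' \<noteq> 0 \<and> s' \<in> ray s)"
  define M' where "M' = (SOME M. M \<in> through s \<and> M \<noteq> L)"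
  have "s' \<noteq> 0 \<and> s' \<in> ray s" unfolding s'_def by (rule someI[of _ s]) (simp add: assms(4) in_ray)
  then obtain c where c: "s' = c *s s" "c \<noteq> 0" by (auto simp: ray_def)
  have M': "M' \<in> through s" "M' \<noteq> L" using someI[of "\<lambda>M. M \<in> through s \<and> M \<noteq> L" M] assms by (auto simp: M'_def)
  have "multiplier N (c *s s) = c ^ 3 * multiplier N s" if "N \<in> through s" for N
    using multiplier_scale[OF c(2) _ _ assms(4,5)] that by (auto simp: through_def)
  then have "index L (ray s) = multiplier L s / multiplier M' s"
    using c(2) assms(1) M'(1) unfolding index_def lines_through_ray s'_def[symmetric] M'_def[symmetric] c(1) Let_def by simp
  then show ?thesis using multiplier_eq[OF assms(1) M'(1) assms(2) M'(2)[symmetric] assms(3)[symmetric] assms(4,5)] by simp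
qed

lemma index_radial:
  assumes "L \<in> S" "p \<in> points L" "card (lines_through p) \<ge> 3"
  shows "index L p = 1"
proof -
  obtain s \<kappa> M where s: "s \<noteq> 0" "s \<in> L" "Z s = \<kappa> *s s" "p = ray s" "M \<in> S" "M \<noteq> L" "s \<in> M"
    by (rule points_ray[OF assms(1,2)])
  have LM: "L \<in> through s" "M \<in> through s" using s assms(1) by (auto simp: through_def)
  have c3: "card (through s) \<ge> 3" using assms(3) s(4) lines_through_ray by simp
  then have "card (through s - {L, M}) > 0"
    using LM s(6) finite_through by (simp add: card_Diff_subset)
  then have "through s - {L, M} \<noteq> {}" by (simp only: card_gt_0_iff) blast
  then obtain N where N: "N \<in> through s" "N \<noteq> L" "N \<noteq> M" by blast
  have "multiplier L s = multiplier M s"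
    by (rule multiplier_eq[OF N(1) LM N(2,3) s(1,3)])
  then show ?thesis
    using index_ray[OF LM s(6,1,3)] s(4) multiplier_nonzero[OF LM(2) s(1,3)] by simp
qed

lemma index_double:
  assumes "L \<in> S" "M \<in> S" "L \<noteq> M"
  shows "index L (L \<inter> M) * index M (L \<inter> M) = 1"
proof -
  obtain s where s: "s \<noteq> 0" "s \<in> L" "s \<in> M" using inter_nonzero[OF assms] by blast
  obtain \<kappa> where k: "Z s = \<kappa> *s s" using singular_inter[OF assms s] by blast
  have LM: "L \<in> through s" "M \<in> through s" using s assms by (auto simp: through_def)
  show ?thesis unfolding inter_eq_ray[OF assms s]
    using index_ray[OF LM assms(3)[symmetric] s(1) k] index_ray[OF LM(2,1) assms(3) s(1) k]
      multiplier_nonzero[OF LM(1) s(1) k] multiplier_nonzero[OF LM(2) s(1) k] by simp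
qed

text \<open>
  Parametrize \<open>L\<close> by \<open>\<sigma> x = w + x u\<close> with \<open>u\<close> nonsingular and \<open>w = Z u\<close>. The tangential component of \<open>Z\<close> is
  a polynomial \<open>f\<close> of degree 5 in \<open>x\<close> whose roots are the singular points. Its derivative at a root is the
  tangential eigenvalue, which is not 0, so there are five roots. The transversal eigenvalue is the value
  of a polynomial \<open>g\<close> of degree 4, and both leading coefficients are \<open>- 1\<close>.
\<close>

lemma camacho_sad:
  assumes "L \<in> S"
  shows "card (points L) = 5" "(\<Sum>p\<in>points L. index L p) = 1"
proof -
  note p = S_line[OF assms] and n = normal_S[OF assms]
  note inL = in_S_iff[OF assms]
  have pl: "plane (normal L) = L" using plane_normal[OF p] .
  obtain u where u: "u \<in> L" "cross u (Z u) \<noteq> 0" using nonvanishing[OF p] by blast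
  define w where "w = Z u"
  have wL: "w \<in> L" unfolding w_def using Z_in[OF assms u(1)] .
  obtain r' where "det3 u w r' \<noteq> 0" using det3_nonzero_exists u(2) w_def by blast
  \<comment> \<open>a vector off \<open>L\<close>, to take components inside \<open>L\<close> with \<open>det3 r\<close>\<close>
  define r where "r = (1 / det3 u w r') *s r'"
  have r: "det3 r u w = 1" using \<open>det3 u w r' \<noteq> 0\<close> det3_rotate[of u w r'] by (simp add: r_def det3_rotate)
  define \<sigma> where "\<sigma> = (\<lambda>x. w + x *s u)"
  have \<sigma>L: "\<sigma> x \<in> L" for x using u(1) wL by (simp add: \<sigma>_def inL)
  have r\<sigma>: "det3 r u (\<sigma> x) = 1" for x using r by (simp add: \<sigma>_def)
  have \<sigma>0: "\<sigma> x \<noteq> 0" for x using r\<sigma>[of x] by auto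
  define F where "F = (\<lambda>v. det3 r (Z v) v)"
  define H where "H = (\<lambda>v. dot (normal L) (DZ v (transversal L)))"
  define B where "B = (\<lambda>v. det3 r u (Z v))"
  have hF: "hompoly 5 F" unfolding F_def
    by (intro hompoly_det3[where n=0 and m=4 and k=1] hompoly_const hompoly_coord hpZ) auto
  have hH: "hompoly 3 H" unfolding H_def
    by (intro hompoly_dot hompoly_DZ[where m=0] hompoly_const) auto
  have hB: "hompoly 4 B" unfolding B_def
    by (intro hompoly_det3[where n=0 and m=0 and k=4] hompoly_const hpZ) auto
  define f where "f = along F w u"
  define g where "g = along H w u - along B w u"
  have cf: "coeff f 5 = -1"
    using coeff_along_top[OF hF, of w u] r det3_swap(2)[of r w u] by (simp add: f_def F_def w_def[symmetric])
  have df: "degree f = Suc 4"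
    using degree_along[OF hF, of w u] le_degree[of f 5] cf by (simp add: f_def)
  have dg: "degree g \<le> 4"
    unfolding g_def using degree_along[OF hH, of w u] degree_along[OF hB, of w u] by (intro degree_diff_le) auto
  have "coeff (along H w u) 4 = 0" using degree_along[OF hH, of w u] by (intro coeff_eq_0) simp
  then have cg: "coeff g 4 = -1"
    using coeff_along_top[OF hB, of w u] r by (simp add: g_def B_def w_def[symmetric])
  have f: "poly f x = det3 r (Z (\<sigma> x)) (\<sigma> x)" for x
    unfolding f_def poly_along[OF hF] by (simp only: F_def \<sigma>_def)
  have root: "poly f x = 0 \<longleftrightarrow> (\<exists>\<kappa>. Z (\<sigma> x) = \<kappa> *s \<sigma> x)" for x
  proof
    assume 0: "poly f x = 0"
    have ZL: "Z (\<sigma> x) \<in> L" using Z_in[OF assms \<sigma>L] .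
    have "cross (Z (\<sigma> x)) (\<sigma> x) = 0"
    proof (rule ccontr)
      assume *: "cross (Z (\<sigma> x)) (\<sigma> x) \<noteq> 0"
      have "det3 (Z (\<sigma> x)) (\<sigma> x) r = 0" using 0 det3_rotate by (simp add: f det3_rotate)
      then have rL: "r \<in> L" using plane_eq_span(2)[OF n _ _ *] ZL \<sigma>L by (simp add: pl)
      then have "det3 r u w = 0" using det3_in_plane[OF n] rL u(1) wL by (simp add: pl)
      then show False using r by simp
    qed
    then show "\<exists>\<kappa>. Z (\<sigma> x) = \<kappa> *s \<sigma> x" using proportional_if_cross_0 \<sigma>0 by blast
  next
    assume "\<exists>\<kappa>. Z (\<sigma> x) = \<kappa> *s \<sigma> x"
    then show "poly f x = 0" by (auto simp: f)
  qed
  have g: "poly g x = multiplier L (\<sigma> x)" if x0: "poly f x = 0" for x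
  proof -
    obtain \<kappa> where k: "Z (\<sigma> x) = \<kappa> *s \<sigma> x" using iffD1[OF root x0] by blast
    have "poly g x = H (\<sigma> x) - B (\<sigma> x)" by (simp add: g_def poly_along[OF hH] poly_along[OF hB] \<sigma>_def)
    also have "B (\<sigma> x) = \<kappa>" using r\<sigma> by (simp add: B_def k)
    also have "H (\<sigma> x) = \<kappa> + multiplier L (\<sigma> x)"
      using multiplier[OF assms \<sigma>L \<sigma>0 k, of "transversal L"] transversal[OF assms] by (simp add: H_def)
    finally show ?thesis by simp
  qed
  have f': "poly (pderiv f) x = multiplier M (\<sigma> x)" if x: "poly f x = 0" and M: "M \<in> through (\<sigma> x)" "M \<noteq> L" for x M
  proof -
    obtain \<kappa> where k: "Z (\<sigma> x) = \<kappa> *s \<sigma> x" using iffD1[OF root x] by blast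
    have MS: "M \<in> S" "\<sigma> x \<in> M" using M by (auto simp: through_def)
    obtain c where c: "DZ (\<sigma> x) u = (\<kappa> + multiplier M (\<sigma> x)) *s u + c *s \<sigma> x"
      by (rule multiplier_other[OF assms MS(1) M(2)[symmetric] \<sigma>L MS(2) \<sigma>0 k u(1)])
    obtain Q where Q: "\<And>i. polyfn (\<lambda>t. Q t $ i)" "\<And>t. Z (\<sigma> x + t *s u) = Z (\<sigma> x) + t *s DZ (\<sigma> x) u + t ^ 2 *s Q t"
      by (rule Z_expansion[of "\<sigma> x" u]) blast
    have "polyfn (\<lambda>t. det3 r (DZ (\<sigma> x) u) u + det3 r (Q t) (\<sigma> x) + t * det3 r (Q t) u)"
      by (intro polyfn_intros Q)
    then obtain q where q: "\<And>t. det3 r (DZ (\<sigma> x) u) u + det3 r (Q t) (\<sigma> x) + t * det3 r (Q t) u = poly q t"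
      unfolding polyfn_def by blast
    have "along F (\<sigma> x) u = pCons (F (\<sigma> x)) (pCons (det3 r (DZ (\<sigma> x) u) (\<sigma> x) + det3 r (Z (\<sigma> x)) u) q)"
      by (rule along_eqI) (simp add: F_def Q(2) q[symmetric] algebra_simps power2_eq_square)
    then have "poly (pderiv f) x = det3 r (DZ (\<sigma> x) u) (\<sigma> x) + det3 r (Z (\<sigma> x)) u"
      unfolding f_def poly_pderiv_along[OF hF] \<sigma>_def[symmetric] by (simp add: dderiv_def \<sigma>_def)
    also have "\<dots> = multiplier M (\<sigma> x)"
      using r\<sigma>[of x] det3_swap(2)[of r "\<sigma> x" u] unfolding c k by (simp add: algebra_simps)
    finally show ?thesis .
  qed
  have T: "\<exists>M. M \<in> through (\<sigma> x) \<and> M \<noteq> L" if x0: "poly f x = 0" for x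
  proof -
    obtain \<kappa> where k: "Z (\<sigma> x) = \<kappa> *s \<sigma> x" using iffD1[OF root x0] by blast
    show ?thesis by (rule other_line_through[OF k, of L]) blast
  qed
  have simple: "poly (pderiv f) x \<noteq> 0" if x0: "poly f x = 0" for x
  proof -
    obtain M where M: "M \<in> through (\<sigma> x)" "M \<noteq> L" using T[OF x0] by blast
    obtain \<kappa> where k: "Z (\<sigma> x) = \<kappa> *s \<sigma> x" using iffD1[OF root x0] by blast
    show ?thesis using f'[OF x0 M] multiplier_nonzero[OF M(1) \<sigma>0 k] by simp
  qed
  define R where "R = {x. poly f x = 0}"
  have sums: "card R = 5" "(\<Sum>x\<in>R. poly g x / poly (pderiv f) x) = 1"
    using sum_over_simple_roots[OF df simple dg] cf cg df by (simp_all add: R_def)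
  have ind: "index L (ray (\<sigma> x)) = poly g x / poly (pderiv f) x" if "x \<in> R" for x
  proof -
    have x: "poly f x = 0" using that by (simp add: R_def)
    obtain M where M: "M \<in> through (\<sigma> x)" "M \<noteq> L" using T[OF x] by blast
    obtain \<kappa> where k: "Z (\<sigma> x) = \<kappa> *s \<sigma> x" using iffD1[OF root x] by blast
    have "L \<in> through (\<sigma> x)" using assms \<sigma>L by (simp add: through_def)
    then show ?thesis using index_ray[OF _ M \<sigma>0 k] g[OF x] f'[OF x M] by simp
  qed
  have bij: "bij_betw (\<lambda>x. ray (\<sigma> x)) R (points L)"
  proof (rule bij_betw_imageI)
    show "inj_on (\<lambda>x. ray (\<sigma> x)) R"
    proof (rule inj_onI)
      fix x y assume "ray (\<sigma> x) = ray (\<sigma> y)"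
      then obtain c where c: "\<sigma> x = c *s \<sigma> y" using in_ray[of "\<sigma> x"] by (auto simp: ray_def)
      have "c = 1" using r\<sigma>[of x] r\<sigma>[of y] by (simp add: c)
      then have "det3 r w (\<sigma> x) = det3 r w (\<sigma> y)" using c by simp
      then show "x = y" using r det3_swap(2)[of r w u] by (simp add: \<sigma>_def)
    qed
    show "(\<lambda>x. ray (\<sigma> x)) ` R = points L"
    proof (intro equalityI subsetI)
      fix q assume "q \<in> (\<lambda>x. ray (\<sigma> x)) ` R"
      then obtain x where x: "poly f x = 0" "q = ray (\<sigma> x)" by (auto simp: R_def)
      obtain M where M: "M \<in> through (\<sigma> x)" "M \<noteq> L" using T[OF x(1)] by blast
      then show "q \<in> points L"
        unfolding x(2) using ray_in_points[OF assms _ _ \<sigma>0 \<sigma>L, of M] by (auto simp: through_def)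
    next
      fix q assume q: "q \<in> points L"
      obtain s \<kappa> M where s: "s \<noteq> 0" "s \<in> L" "Z s = \<kappa> *s s" "q = ray s" "M \<in> S" "M \<noteq> L" "s \<in> M"
        by (rule points_ray[OF assms q])
      have uw: "cross u w \<noteq> 0" using u(2) by (simp add: w_def)
      have "det3 u w s = 0" using det3_in_plane[OF n] u(1) wL s(2) by (simp add: pl)
      then obtain a b where ab: "s = a *s u + b *s w" using combination_if_det3_0[OF uw] by blast
      have "b \<noteq> 0"
      proof
        assume "b = 0"
        then have au: "s = a *s u" "a \<noteq> 0" using ab s(1) by auto
        have sc: "cross u (c *s v) = c *s cross u v" "cross u u = 0" for c v
          by (simp_all add: vec3_eq_iff algebra_simps)
        have "a ^ 4 *s cross u (Z u) = cross u (Z s)" unfolding au(1) Z_scale sc(1) ..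
        also have "\<dots> = 0" unfolding s(3) unfolding au(1) by (simp only: sc vector_smult_assoc vector_smult_rzero)
        finally have "cross u (Z u) = 0" using au(2) by simp
        then show False using u(2) by simp
      qed
      have s\<sigma>: "s = b *s \<sigma> (a / b)" using ab \<open>b \<noteq> 0\<close> by (simp add: \<sigma>_def vec_eq_iff field_simps)
      have "ray s = ray (\<sigma> (a / b))"
      proof -
        have "\<sigma> (a / b) \<in> L \<inter> M"
        proof -
          have "dot (normal M) (\<sigma> (a / b)) = 0" using s(7) s\<sigma> \<open>b \<noteq> 0\<close> in_S_iff[OF s(5), of s] by simp
          then show ?thesis using \<sigma>L in_S_iff[OF s(5)] by simp
        qed
        then have in_both: "\<sigma> (a / b) \<in> L" "\<sigma> (a / b) \<in> M" by blast+
        show ?thesis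
          by (rule trans[OF inter_eq_ray[OF assms s(5) s(6)[symmetric] s(1,2,7), symmetric]
            inter_eq_ray[OF assms s(5) s(6)[symmetric] \<sigma>0 in_both]])
      qed
      moreover have "poly f (a / b) = 0"
      proof -
        have "b ^ 4 *s Z (\<sigma> (a / b)) = (\<kappa> * b) *s \<sigma> (a / b)"
          using s(3) s\<sigma> by (metis Z_scale vector_smult_assoc)
        then have "b ^ 4 * det3 r (Z (\<sigma> (a / b))) (\<sigma> (a / b)) = 0"
          by (metis det3_linear(4,12) mult_zero_right)
        then show ?thesis using \<open>b \<noteq> 0\<close> by (simp add: f)
      qed
      ultimately show "q \<in> (\<lambda>x. ray (\<sigma> x)) ` R" unfolding R_def s(4) by blast
    qed
  qed
  show "card (points L) = 5" using bij_betw_same_card[OF bij] sums(1) by simp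
  have "(\<Sum>q\<in>points L. index L q) = (\<Sum>x\<in>R. index L (ray (\<sigma> x)))"
    using sum.reindex_bij_betw[OF bij, of "index L"] by simp
  also have "\<dots> = 1" using ind sums(2) by simp
  finally show "(\<Sum>p\<in>points L. index L p) = 1" .
qed

lemma lines_through_bounds:
  assumes "L \<in> S" "p \<in> points L"
  shows "2 \<le> card (lines_through p)" "card (lines_through p) \<le> 5" "L \<in> lines_through p"
proof -
  obtain s \<kappa> M where s: "s \<noteq> 0" "s \<in> L" "Z s = \<kappa> *s s" "p = ray s" "M \<in> S" "M \<noteq> L" "s \<in> M"
    by (rule points_ray[OF assms])
  show "2 \<le> card (lines_through p)" "card (lines_through p) \<le> 5" "L \<in> lines_through p"
    using through_ge_2[OF s(3)] through_le_5[OF s(1,3)] assms(1) s(2) unfolding s(4) lines_through_ray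
    by (auto simp: through_def)
qed

lemma points_inter:
  assumes "L \<in> S" "p \<in> points L" "M \<in> lines_through p" "M \<noteq> L"
  shows "L \<inter> M = p"
proof -
  obtain s \<kappa> N where s: "s \<noteq> 0" "s \<in> L" "Z s = \<kappa> *s s" "p = ray s" "N \<in> S" "N \<noteq> L" "s \<in> N"
    by (rule points_ray[OF assms(1,2)])
  have "M \<in> S" "s \<in> M" using assms(3) unfolding s(4) lines_through_ray by (auto simp: through_def)
  then show ?thesis using inter_eq_ray[OF assms(1) _ _ s(1,2)] assms(4) s(4) by simp
qed

lemma finite_points: "finite (points L)"
  using finite_S by (simp add: points_def)

text \<open>
  Each of the other eleven lines meets \<open>L\<close> in one point.
\<close>

lemma sum_multiplicities:
  assumes "L \<in> S"
  shows "(\<Sum>p\<in>points L. card (lines_through p) - 1) = 11"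
proof -
  have "card (S - {L}) = (\<Sum>p\<in>points L. card {M \<in> S - {L}. L \<inter> M = p})"
    using sum.image_gen[of "S - {L}" "\<lambda>_. 1::nat" "\<lambda>M. L \<inter> M"] finite_S by (simp add: points_def)
  also have "\<dots> = (\<Sum>p\<in>points L. card (lines_through p) - 1)"
  proof (rule sum.cong[OF refl])
    fix p assume p: "p \<in> points L"
    have "{M \<in> S - {L}. L \<inter> M = p} = lines_through p - {L}"
      using points_inter[OF assms p] by (auto simp: lines_through_def)
    then show "card {M \<in> S - {L}. L \<inter> M = p} = card (lines_through p) - 1"
      using lines_through_bounds(3)[OF assms p] by simp
  qed
  finally show ?thesis using card_S assms finite_S by simp
qed

end

section \<open>Multiplicities of the intersection points\<close>

context convex4
begin

abbreviation num_lines :: "(complex ^ 3) set \<Rightarrow> nat" where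
  "num_lines p \<equiv> card (lines_through p)"

definition points_of_mult :: "nat \<Rightarrow> (complex ^ 3) set \<Rightarrow> (complex ^ 3) set set" where
  "points_of_mult k L = {p \<in> points L. num_lines p = k}"

lemma finite_points_of_mult: "finite (points_of_mult k L)"
  by (simp add: points_of_mult_def finite_points)

lemma points_through:
  assumes "L \<in> S" "p \<in> points L" "M \<in> lines_through p"
  shows "M \<in> S" "p \<in> points M"
proof -
  show M: "M \<in> S" using assms(3) by (simp add: lines_through_def)
  show "p \<in> points M"
  proof (cases "M = L")
    case False
    then have "L \<inter> M = p" by (rule points_inter[OF assms])
    then show ?thesis using assms(1) False by (auto simp: points_def)
  qed (use assms in simp)
qed

lemma mult_cases:
  assumes "L \<in> S" "p \<in> points L"
  shows "num_lines p = 2 \<or> num_lines p = 3 \<or> num_lines p = 4 \<or> num_lines p = 5"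
  using lines_through_bounds(1,2)[OF assms] by linarith

lemma sum_points_by_mult:
  fixes g :: "nat \<Rightarrow> nat"
  assumes "L \<in> S"
  shows "(\<Sum>p\<in>points L. g (num_lines p)) = g 2 * card (points_of_mult 2 L) + g 3 * card (points_of_mult 3 L) +
    g 4 * card (points_of_mult 4 L) + g 5 * card (points_of_mult 5 L)"
proof -
  have "num_lines ` points L \<subseteq> {2, 3, 4, 5}"
    using mult_cases[OF assms] by blast
  then have "(\<Sum>p\<in>points L. g (num_lines p)) = (\<Sum>k\<in>{2,3,4,5}. \<Sum>p | p \<in> points L \<and> num_lines p = k. g (num_lines p))"
    by (intro sum.group[symmetric] finite_points) auto
  also have "\<dots> = (\<Sum>k\<in>{2,3,4,5}. g k * card (points_of_mult k L))"
    by (intro sum.cong refl) (simp add: points_of_mult_def)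
  finally show ?thesis by simp
qed

lemma mult_counts:
  assumes "L \<in> S"
  shows "card (points_of_mult 2 L) + card (points_of_mult 3 L) + card (points_of_mult 4 L) + card (points_of_mult 5 L) = 5"
    "card (points_of_mult 2 L) + 2 * card (points_of_mult 3 L) + 3 * card (points_of_mult 4 L) + 4 * card (points_of_mult 5 L) = 11"
  using sum_points_by_mult[OF assms, of "\<lambda>_. 1"] sum_points_by_mult[OF assms, of "\<lambda>k. k - 1"]
    camacho_sad(1)[OF assms] sum_multiplicities[OF assms] by simp_all

text \<open>
  The points on at least three lines contribute 1 each to the total index 1 of the five points.
\<close>

lemma sum_index_double:
  assumes "L \<in> S"
  shows "(\<Sum>p\<in>points_of_mult 2 L. index L p) = of_nat (card (points_of_mult 2 L)) - 4"
proof -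
  let ?D = "points_of_mult 2 L"
  have D: "?D \<subseteq> points L" by (auto simp: points_of_mult_def)
  have "(\<Sum>p\<in>points L. index L p) = (\<Sum>p\<in>?D. index L p) + (\<Sum>p\<in>points L - ?D. index L p)"
    using sum.subset_diff[OF D finite_points] by (simp add: add.commute)
  also have "(\<Sum>p\<in>points L - ?D. index L p) = (\<Sum>p\<in>points L - ?D. 1)"
  proof (rule sum.cong[OF refl])
    fix p assume "p \<in> points L - ?D"
    then have p: "p \<in> points L" "num_lines p \<noteq> 2" by (auto simp: points_of_mult_def)
    then have "num_lines p \<ge> 3" using lines_through_bounds(1)[OF assms p(1)] by simp
    then show "index L p = 1" by (rule index_radial[OF assms p(1)])
  qed
  also have "\<dots> = of_nat (card (points L - ?D))" by simp
  also have "card (points L - ?D) = 5 - card ?D"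
    using camacho_sad(1)[OF assms] card_Diff_subset[OF finite_points_of_mult D] by simp
  finally show ?thesis
    using camacho_sad[OF assms] card_mono[OF finite_points D] by (simp add: of_nat_diff algebra_simps)
qed

text \<open>
  The counts leave one or two double points, with total index \<open>- 3\<close> or \<open>- 2\<close>. Suppose some index at a double point
  is real and less than \<open>- 1\<close>, and take the largest such index \<open>x\<close>. The other line through the point has index
  \<open>1 / x > - 1\<close> there, so it has a second double point, of index \<open>- 2 - 1 / x\<close>, which lies strictly between
  \<open>x\<close> and \<open>- 1\<close>: a contradiction. But a line with a single double point has the index \<open>- 3\<close>.
\<close>

lemma two_doubles:
  assumes no_A: "\<And>L. L \<in> S \<Longrightarrow> card (points_of_mult 5 L) \<le> 1" and "L \<in> S"
  shows "card (points_of_mult 2 L) = 2"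
proof -
  let ?d = "\<lambda>L. card (points_of_mult 2 L)"
  have d: "?d L = 1 \<or> ?d L = 2" if L: "L \<in> S" for L
  proof -
    have "?d L \<noteq> 0"
    proof
      assume 0: "?d L = 0"
      then have "points_of_mult 2 L = {}" using finite_points_of_mult by simp
      then show False using sum_index_double[OF L] by simp
    qed
    then show ?thesis using mult_counts[OF L] no_A[OF L] by linarith
  qed
  define A where "A = {(L, p). L \<in> S \<and> p \<in> points_of_mult 2 L \<and> (\<exists>x::real. index L p = of_real x \<and> x < -1)}"
  have "A = {}"
  proof (rule ccontr)
    assume "A \<noteq> {}"
    have "A \<subseteq> Sigma S (points_of_mult 2)" by (auto simp: A_def)
    then have finA: "finite A" using finite_S finite_points_of_mult by (meson finite_SigmaI finite_subset)
    define h where "h = (\<lambda>(L, p). Re (index L p))"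
    obtain a where a: "a \<in> A" "\<And>b. b \<in> A \<Longrightarrow> h b \<le> h a"
    proof -
      have "Max (h ` A) \<in> h ` A" using finA \<open>A \<noteq> {}\<close> by (intro Max_in) auto
      then obtain a where a: "a \<in> A" "h a = Max (h ` A)" by auto
      show ?thesis by (rule that[OF a(1)]) (simp add: a(2) finA)
    qed
    obtain L p where Lp: "a = (L, p)" by (cases a)
    obtain x where x: "L \<in> S" "p \<in> points_of_mult 2 L" "index L p = of_real x" "x < -1"
      using a(1) by (auto simp: A_def Lp)
    have p: "p \<in> points L" "card (lines_through p) = 2" using x(2) by (auto simp: points_of_mult_def)
    have "lines_through p \<noteq> {L}" using p(2) by auto
    then obtain M where M: "M \<in> lines_through p" "M \<noteq> L" using lines_through_bounds(3)[OF x(1) p(1)] by blast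
    have MS: "M \<in> S" "p \<in> points M" using points_through[OF x(1) p(1) M(1)] by auto
    have pM: "p \<in> points_of_mult 2 M" using MS p by (simp add: points_of_mult_def)
    have "index L p * index M p = 1"
      using index_double[OF x(1) MS(1) M(2)[symmetric]] points_inter[OF x(1) p(1) M] by simp
    then have iM: "index M p = of_real (1 / x)" using x(3,4) by (simp add: field_simps)
    have x1: "1 / x > -1" using x(4) by (simp add: field_simps)
    have "?d M \<noteq> 1"
    proof
      assume "?d M = 1"
      then obtain q where "points_of_mult 2 M = {q}" by (auto simp: card_1_singleton_iff)
      then have "index M p = -3" using sum_index_double[OF MS(1)] pM by simp
      then have "complex_of_real (1 / x) = complex_of_real (-3)" unfolding iM by simp
      then have "1 / x = -3" by (simp only: of_real_eq_iff)
      then show False using x1 by simp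
    qed
    then have d2: "?d M = 2" using d[OF MS(1)] by simp
    then have "card (points_of_mult 2 M - {p}) = 1" using pM finite_points_of_mult by simp
    then obtain q where q: "points_of_mult 2 M - {p} = {q}" by (auto simp: card_1_singleton_iff)
    have "(\<Sum>p\<in>points_of_mult 2 M. index M p) = index M p + index M q"
      using sum.remove[OF finite_points_of_mult pM, of "index M"] q by simp
    then have iq: "index M q = of_real (-2 - 1 / x)"
      using sum_index_double[OF MS(1)] d2 iM by (simp add: algebra_simps)
    have "-2 - 1 / x < -1" using x1 by simp
    moreover have "q \<in> points_of_mult 2 M" using q by blast
    ultimately have "(M, q) \<in> A" unfolding A_def mem_Collect_eq prod.case using MS(1) iq by blast
    then have "h (M, q) \<le> h (L, p)" using a(2) Lp by simp
    then have "-2 - 1 / x \<le> x" by (simp add: h_def iq x(3))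
    then have "x * x \<le> x * (-2 - 1 / x)" by (rule mult_left_mono_neg) (use x(4) in simp)
    also have "\<dots> = -2 * x - 1" using x(4) by (simp add: field_simps)
    finally have "(x + 1) * (x + 1) \<le> 0" by (simp add: algebra_simps)
    moreover have "(x + 1) * (x + 1) > 0" using x(4) by (intro mult_neg_neg) auto
    ultimately show False by simp
  qed
  have "?d L \<noteq> 1"
  proof
    assume "?d L = 1"
    then obtain q where q: "points_of_mult 2 L = {q}" by (auto simp: card_1_singleton_iff)
    then have "index L q = of_real (-3)" using sum_index_double[OF assms(2)] by simp
    moreover have "q \<in> points_of_mult 2 L" "(-3::real) < -1" using q by simp_all
    ultimately have "(L, q) \<in> A" unfolding A_def mem_Collect_eq prod.case using assms(2) by blast
    then show False using \<open>A = {}\<close> by simp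
  qed
  then show ?thesis using d[OF assms(2)] by simp
qed

text \<open>
  The lines of \<open>B\<close> are partitioned into classes of size \<open>k\<close> by their unique point of multiplicity \<open>k\<close>.
\<close>

lemma dvd_card_by_points:
  assumes "B \<subseteq> S" "\<And>L. L \<in> B \<Longrightarrow> card (points_of_mult k L) = 1"
    "\<And>L p. L \<in> B \<Longrightarrow> p \<in> points_of_mult k L \<Longrightarrow> lines_through p \<subseteq> B"
  shows "k dvd card B"
proof -
  define g where "g = (\<lambda>L. the_elem (points_of_mult k L))"
  have g: "points_of_mult k L = {g L}" if "L \<in> B" for L
    using assms(2)[OF that] by (auto simp: g_def card_1_singleton_iff)
  have "card B = (\<Sum>p\<in>g ` B. card {L \<in> B. g L = p})"
    using sum.image_gen[of B "\<lambda>_. 1::nat" g] finite_subset[OF assms(1) finite_S] by simp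
  also have "\<dots> = (\<Sum>p\<in>g ` B. k)"
  proof (rule sum.cong[OF refl])
    fix p assume "p \<in> g ` B"
    then obtain L where L: "L \<in> B" "p = g L" by blast
    then have p: "p \<in> points_of_mult k L" using g by simp
    then have pL: "p \<in> points L" "card (lines_through p) = k" by (auto simp: points_of_mult_def)
    have "{L \<in> B. g L = p} = lines_through p"
    proof
      show "{L \<in> B. g L = p} \<subseteq> lines_through p"
      proof
        fix M assume M: "M \<in> {L \<in> B. g L = p}"
        then have "p \<in> points M" "M \<in> S" using g[of M] assms(1) by (auto simp: points_of_mult_def)
        then show "M \<in> lines_through p" using lines_through_bounds(3) by blast
      qed
      show "lines_through p \<subseteq> {L \<in> B. g L = p}"
      proof
        fix M assume M: "M \<in> lines_through p"
        then have MB: "M \<in> B" using assms(3)[OF L(1) p] by blast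
        have "p \<in> points_of_mult k M"
          using points_through(2)[OF _ pL(1) M] L(1) assms(1) pL(2) by (auto simp: points_of_mult_def)
        then show "M \<in> {L \<in> B. g L = p}" using g[OF MB] MB by simp
      qed
    qed
    then show "card {L \<in> B. g L = p} = k" using pL(2) by simp
  qed
  finally show ?thesis by simp
qed

text \<open>
  With two double points, the other three points of a line have multiplicities \<open>4, 4, 4\<close> or \<open>3, 4, 5\<close>. The
  number of lines of the second kind is divisible by 3 and by 5 and at most 12, so it is 0.
\<close>

lemma hesse_type:
  assumes no_A: "\<And>L. L \<in> S \<Longrightarrow> card (points_of_mult 5 L) \<le> 1" and "L \<in> S"
  shows "card (points_of_mult 2 L) = 2" "card (points_of_mult 4 L) = 3" "points L = points_of_mult 2 L \<union> points_of_mult 4 L"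
proof -
  have d: "card (points_of_mult 2 L) = 2" if "L \<in> S" for L using two_doubles[OF no_A that] .
  define B where "B = {L \<in> S. card (points_of_mult 5 L) = 1}"
  have BS: "B \<subseteq> S" by (auto simp: B_def)
  have same: "card (points_of_mult 3 L) = card (points_of_mult 5 L)" if "L \<in> S" for L
    using mult_counts[OF that] d[OF that] by linarith
  have inB: "M \<in> B" if "L \<in> S" "p \<in> points L" "num_lines p = 3 \<or> num_lines p = 5" "M \<in> lines_through p" for L p M
  proof -
    have M: "M \<in> S" "p \<in> points M" using points_through[OF that(1,2,4)] by auto
    have "p \<in> points_of_mult 3 M \<or> p \<in> points_of_mult 5 M" using M(2) that(3) by (auto simp: points_of_mult_def)
    then have "card (points_of_mult 3 M) > 0 \<or> card (points_of_mult 5 M) > 0"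
      by (auto simp: card_gt_0_iff finite_points_of_mult)
    then have "card (points_of_mult 5 M) > 0" using same[OF M(1)] by simp
    then show ?thesis using no_A[OF M(1)] M(1) by (simp add: B_def)
  qed
  have "5 dvd card B"
    by (rule dvd_card_by_points[OF BS]) (use inB in \<open>auto simp: B_def points_of_mult_def\<close>)
  moreover have "3 dvd card B"
    by (rule dvd_card_by_points[OF BS]) (use inB same in \<open>auto simp: B_def points_of_mult_def\<close>)
  moreover have "card B \<le> 12" using card_mono[OF finite_S BS] card_S by simp
  ultimately have "card B = 0" by presburger
  then have "B = {}" using finite_subset[OF BS finite_S] by simp
  then have n: "card (points_of_mult 5 L) = 0" using no_A[OF assms(2)] assms(2) by (auto simp: B_def le_Suc_eq)
  show "card (points_of_mult 2 L) = 2" using d assms(2) by blast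
  show "card (points_of_mult 4 L) = 3" using mult_counts[OF assms(2)] d[OF assms(2)] n same[OF assms(2)] by linarith
  have "points_of_mult 5 L = {}" "points_of_mult 3 L = {}"
    using n same[OF assms(2)] finite_points_of_mult by simp_all
  then show "points L = points_of_mult 2 L \<union> points_of_mult 4 L"
    unfolding points_of_mult_def using mult_cases[OF assms(2)] by blast
qed

end

section \<open>The Fermat arrangement\<close>

definition cube_roots :: "complex set" where "cube_roots = {z. z ^ 3 = 1}"

lemma card_cube_roots: "card cube_roots = 3"
  unfolding cube_roots_def by (rule card_roots_unity_eq) simp

lemma finite_cube_roots: "finite cube_roots"
  using card_cube_roots card.infinite by fastforce

lemma eq_cube_rootsI: "card A = 3 \<Longrightarrow> (\<And>z. z \<in> A \<Longrightarrow> z ^ 3 = 1) \<Longrightarrow> A = cube_roots"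
  using card_cube_roots by (intro card_subset_eq[OF finite_cube_roots]) (auto simp: cube_roots_def)

lemma cube_roots_nonzero: "z \<in> cube_roots \<Longrightarrow> z \<noteq> 0"
  by (auto simp: cube_roots_def)

lemma finite_if_card_Suc: "card A = Suc n \<Longrightarrow> finite A"
  using card.infinite by fastforce

text \<open>
  Comparing the products of all elements before and after a multiplication by \<open>c\<close> determines a power of \<open>c\<close>.
\<close>

lemma scaled_set:
  fixes G H :: "complex set"
  assumes "finite G" "finite H" "card G = card H" "c \<noteq> 0" "\<And>z. z \<in> G \<Longrightarrow> c * z \<in> H"
  shows "(\<lambda>z. c * z) ` G = H" "c ^ card G * \<Prod>G = \<Prod>H"
proof -
  have inj: "inj_on (\<lambda>z. c * z) G" using assms(4) by (auto simp: inj_on_def)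
  show eq: "(\<lambda>z. c * z) ` G = H"
    by (rule card_subset_eq[OF assms(2)]) (use assms(5) inj in \<open>auto simp: card_image assms(3)\<close>)
  have "\<Prod>H = (\<Prod>z\<in>G. c * z)" unfolding eq[symmetric] prod.reindex[OF inj] by (simp add: o_def)
  then show "c ^ card G * \<Prod>G = \<Prod>H" by (simp add: prod.distrib)
qed

text \<open>
  Each map \<open>x \<mapsto> s x + t\<close> is a bijection from \<open>X\<close> to \<open>Y\<close>, so it maps the centroid \<open>c\<close> to the centroid \<open>d\<close>, and
  the maps are determined by their slopes. Two of them agree only at \<open>c\<close>, so \<open>c \<in> X\<close>. Centred at \<open>c\<close> and \<open>d\<close>
  three elements remain in each set, and the products of these show that all slopes have the same
  cube.
\<close>

lemma cube_root_grid:
  fixes X Y :: "complex set" and P :: "(complex \<times> complex) set"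
  assumes "card X = 4" "card Y = 4" "card P = 3"
    and into: "\<And>s t x. (s, t) \<in> P \<Longrightarrow> x \<in> X \<Longrightarrow> s * x + t \<in> Y"
    and nz: "\<And>s t. (s, t) \<in> P \<Longrightarrow> s \<noteq> 0"
    and meet: "\<And>s t s' t'. (s, t) \<in> P \<Longrightarrow> (s', t') \<in> P \<Longrightarrow> (s, t) \<noteq> (s', t') \<Longrightarrow>
       s = s' \<or> (\<exists>x\<in>X. s * x + t = s' * x + t')"
  obtains a b c d where "a \<noteq> 0" "b \<noteq> 0" "c \<in> X" "d \<in> Y"
    "\<forall>\<zeta>\<in>cube_roots. c + a * \<zeta> \<in> X" "\<forall>\<zeta>\<in>cube_roots. d + b * \<zeta> \<in> Y"
    "\<forall>\<zeta>\<in>cube_roots. (\<zeta> * b / a, d - \<zeta> * b / a * c) \<in> P"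
proof -
  have fin: "finite X" "finite Y" "finite P" using finite_if_card_Suc assms(1-3) by (auto simp: numeral_eq_Suc)
  define c where "c = \<Sum>X / 4"
  define d where "d = \<Sum>Y / 4"
  have centre: "t = d - s * c" if "(s, t) \<in> P" for s t
  proof -
    have inj: "inj_on (\<lambda>x. s * x + t) X" using nz[OF that] by (auto simp: inj_on_def)
    have eq: "(\<lambda>x. s * x + t) ` X = Y"
      by (rule card_subset_eq[OF fin(2)]) (use into[OF that] inj assms in \<open>auto simp: card_image\<close>)
    have "\<Sum>Y = (\<Sum>x\<in>X. s * x + t)" unfolding eq[symmetric] sum.reindex[OF inj] by (simp add: o_def)
    also have "\<dots> = s * \<Sum>X + 4 * t" by (simp add: sum.distrib sum_distrib_left assms(1))
    finally show ?thesis by (simp add: c_def d_def)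
  qed
  define A where "A = fst ` P"
  have P: "P = (\<lambda>s. (s, d - s * c)) ` A"
  proof (intro equalityI subsetI)
    fix p assume "p \<in> P"
    then have "p = (fst p, d - fst p * c)" "fst p \<in> A"
      using centre[of "fst p" "snd p"] by (simp_all add: prod_eq_iff A_def)
    then show "p \<in> (\<lambda>s. (s, d - s * c)) ` A" by (rule image_eqI)
  next
    fix p assume "p \<in> (\<lambda>s. (s, d - s * c)) ` A"
    then obtain s t where "(s, t) \<in> P" "p = (s, d - s * c)" by (auto simp: A_def)
    then show "p \<in> P" using centre by simp
  qed
  have "inj_on fst P"
  proof (rule inj_onI)
    fix p p' assume "p \<in> P" "p' \<in> P" "fst p = fst p'"
    then show "p = p'" using centre[of "fst p" "snd p"] centre[of "fst p'" "snd p'"]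
      by (metis prod.collapse)
  qed
  then have cA: "card A = 3" unfolding A_def using assms(3) by (simp add: card_image)
  then obtain s1 where s1: "s1 \<in> A" by fastforce
  have "card (A - {s1}) = 2" using cA s1 by simp
  then have "A - {s1} \<noteq> {}" by force
  then obtain s2 where s2: "s2 \<in> A" "s2 \<noteq> s1" by blast
  have PA: "(s, d - s * c) \<in> P" if "s \<in> A" for s using that P by blast
  have nzA: "s \<noteq> 0" if "s \<in> A" for s using nz[OF PA[OF that]] .
  obtain x where x: "x \<in> X" "s1 * x + (d - s1 * c) = s2 * x + (d - s2 * c)"
    using meet[OF PA[OF s1] PA[OF s2(1)]] s2(2) by auto
  then have "(s1 - s2) * (x - c) = 0" by (simp add: algebra_simps)
  then have cX: "c \<in> X" using x(1) s2(2) by auto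
  have dY: "d \<in> Y" using into[OF PA[OF s1] cX] by simp
  define X' where "X' = (\<lambda>x. x - c) ` (X - {c})"
  define Y' where "Y' = (\<lambda>y. y - d) ` (Y - {d})"
  have X': "card X' = 3" "0 \<notin> X'" unfolding X'_def
    using cX assms(1) by (subst card_image) (auto simp: inj_on_def)
  have Y': "card Y' = 3" "0 \<notin> Y'" unfolding Y'_def
    using dY assms(2) by (subst card_image) (auto simp: inj_on_def)
  have fin': "finite X'" "finite Y'" using fin by (simp_all add: X'_def Y'_def)
  have map: "s * z \<in> Y'" if sA: "s \<in> A" and zX: "z \<in> X'" for s z
  proof -
    obtain x where x: "x \<in> X" "x \<noteq> c" "z = x - c" using zX by (auto simp: X'_def)
    have "s * x + (d - s * c) \<in> Y" using into[OF PA[OF sA] x(1)] .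
    moreover have "s * x + (d - s * c) \<noteq> d" using x(2) nzA[OF sA] by (simp add: right_diff_distrib[symmetric])
    moreover have "s * z = s * x + (d - s * c) - d" unfolding x(3) by (simp add: algebra_simps)
    ultimately show ?thesis unfolding Y'_def by blast
  qed
  have prod: "s ^ 3 * \<Prod>X' = \<Prod>Y'" if "s \<in> A" for s
    using scaled_set(2)[OF fin' _ nzA[OF that] map[OF that]] X' Y' by simp
  have pX: "\<Prod>X' \<noteq> 0" using X'(2) fin' by simp
  have roots: "(\<lambda>s. s / s1) ` A = cube_roots"
  proof (rule eq_cube_rootsI)
    show "card ((\<lambda>s. s / s1) ` A) = 3"
      using cA nzA[OF s1] by (subst card_image) (auto simp: inj_on_def)
    fix z assume "z \<in> (\<lambda>s. s / s1) ` A"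
    then obtain s where s: "s \<in> A" "z = s / s1" by blast
    have "s ^ 3 * \<Prod>X' = s1 ^ 3 * \<Prod>X'" using prod[OF s(1)] prod[OF s1] by simp
    then show "z ^ 3 = 1" using pX nzA[OF s1] by (simp add: s(2) power_divide)
  qed
  have A: "s1 * \<zeta> \<in> A" if "\<zeta> \<in> cube_roots" for \<zeta>
    using that nzA[OF s1] unfolding roots[symmetric] by auto
  obtain a where a: "a \<in> X'" using X'(1) by fastforce
  then have a0: "a \<noteq> 0" using X'(2) by blast
  define b where "b = s1 * a"
  have b0: "b \<noteq> 0" using a0 nzA[OF s1] by (simp add: b_def)
  have bY: "b * \<zeta> \<in> Y'" if "\<zeta> \<in> cube_roots" for \<zeta>
    using map[OF A[OF that] a] by (simp add: b_def mult_ac)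
  have aX: "a * \<zeta> \<in> X'" if "\<zeta> \<in> cube_roots" for \<zeta>
  proof -
    have "b * \<zeta> \<in> (\<lambda>z. s1 * z) ` X'"
      using bY[OF that] scaled_set(1)[OF fin' _ nzA[OF s1] map[OF s1]] X' Y' by simp
    then obtain z where "z \<in> X'" "b * \<zeta> = s1 * z" by blast
    then show ?thesis using nzA[OF s1] by (simp add: b_def)
  qed
  show ?thesis
  proof (rule that[OF a0 b0 cX dY]; rule ballI)
    fix \<zeta> assume z: "\<zeta> \<in> cube_roots"
    show "c + a * \<zeta> \<in> X" using aX[OF z] by (auto simp: X'_def)
    show "d + b * \<zeta> \<in> Y" using bY[OF z] by (auto simp: Y'_def)
    have "\<zeta> * b / a = s1 * \<zeta>" using a0 by (simp add: b_def)
    then show "(\<zeta> * b / a, d - \<zeta> * b / a * c) \<in> P" using PA[OF A[OF z]] by simp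
  qed
qed

text \<open>
  Dividing \<open>U\<close> by any \<open>v \<in> V\<close> already gives three elements, hence all of \<open>W\<close>. So \<open>W\<close> is stable under
  multiplication by the three numbers \<open>b / v\<close>, and these are cube roots of unity by \<open>scaled_set\<close>.
\<close>

lemma small_quotient_set:
  fixes U V :: "complex set"
  assumes "card U = 3" "card V = 3" "0 \<notin> U" "0 \<notin> V" "finite W" "card W \<le> 3"
    and quot: "\<And>u v. u \<in> U \<Longrightarrow> v \<in> V \<Longrightarrow> u / v \<in> W"
  obtains a b where "a \<noteq> 0" "b \<noteq> 0" "\<forall>\<zeta>\<in>cube_roots. a * \<zeta> \<in> U" "\<forall>\<zeta>\<in>cube_roots. b * \<zeta> \<in> V"
proof -
  have fin: "finite U" "finite V" using finite_if_card_Suc assms(1,2) by (auto simp: numeral_eq_Suc)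
  obtain b where b: "b \<in> V" using assms(2) by fastforce
  have b0: "b \<noteq> 0" using b assms(4) by blast
  have V0: "v \<noteq> 0" if "v \<in> V" for v using that assms(4) by blast
  have sub: "(\<lambda>u. u / v) ` U = W" if "v \<in> V" for v
  proof (rule card_seteq[OF assms(5)])
    have "card ((\<lambda>u. u / v) ` U) = 3"
      using V0[OF that] assms(1) by (subst card_image) (auto simp: inj_on_def)
    then show "card W \<le> card ((\<lambda>u. u / v) ` U)" using assms(6) by simp
  qed (use quot that in auto)
  have cW: "card W = 3"
    unfolding sub[OF b, symmetric] using b0 assms(1) by (subst card_image) (auto simp: inj_on_def)
  have W0: "0 \<notin> W" using sub[OF b] assms(3) b0 by auto
  have step: "b / v * w \<in> W" if v: "v \<in> V" and w: "w \<in> W" for v w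
  proof -
    obtain u where "u \<in> U" "w = u / b" using sub[OF b] w by blast
    then show ?thesis using quot[OF _ v] b0 by simp
  qed
  have pW: "\<Prod>W \<noteq> 0" using W0 assms(5) by simp
  have "(\<lambda>v. b / v) ` V = cube_roots"
  proof (rule eq_cube_rootsI)
    show "card ((\<lambda>v. b / v) ` V) = 3"
      using assms(2) b0 V0 by (subst card_image) (auto simp: inj_on_def field_simps)
    fix z assume "z \<in> (\<lambda>v. b / v) ` V"
    then obtain v where v: "v \<in> V" "z = b / v" by blast
    have "z ^ card W * \<Prod>W = \<Prod>W"
      by (rule scaled_set(2)) (use step[OF v(1)] v b0 V0[OF v(1)] assms(5) in auto)
    then show "z ^ 3 = 1" using pW cW by simp
  qed
  then have Vr: "\<exists>v\<in>V. \<zeta> = b / v" if "\<zeta> \<in> cube_roots" for \<zeta> using that by blast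
  have inv: "1 / \<zeta> \<in> cube_roots" if "\<zeta> \<in> cube_roots" for \<zeta>
    using that by (simp add: cube_roots_def power_divide)
  have bV: "b * \<zeta> \<in> V" if z: "\<zeta> \<in> cube_roots" for \<zeta>
  proof -
    obtain v where v: "v \<in> V" "1 / \<zeta> = b / v" using Vr[OF inv[OF z]] by blast
    then have "v = b * \<zeta>" using V0[OF v(1)] cube_roots_nonzero[OF z] by (simp add: field_simps)
    then show ?thesis using v by simp
  qed
  obtain a where a: "a \<in> U" using assms(1) by fastforce
  have a0: "a \<noteq> 0" using a assms(3) by blast
  have aU: "a * \<zeta> \<in> U" if z: "\<zeta> \<in> cube_roots" for \<zeta>
  proof -
    obtain v where v: "v \<in> V" "\<zeta> = b / v" using Vr[OF z] by blast
    have "a / v \<in> W" using quot[OF a v(1)] .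
    then obtain u where u: "u \<in> U" "a / v = u / b" using sub[OF b] by blast
    have "b = \<zeta> * v" using V0[OF v(1)] v(2) by simp
    then have "u * v = a * \<zeta> * v" using u(2) b0 V0[OF v(1)] by (simp add: field_simps)
    then have "u = a * \<zeta>" using V0[OF v(1)] by simp
    then show ?thesis using u by simp
  qed
  show ?thesis by (rule that[OF a0 b0]) (simp_all add: aU bV)
qed

lemma basis_expansion:
  assumes "det3 a b c \<noteq> 0"
  obtains x y z where "v = x *s a + y *s b + z *s c"
proof -
  have "det3 a b c *s v = det3 b c v *s a - det3 a c v *s b + det3 a b v *s c"
    using vectors4_relation[of b c v a] by (simp add: algebra_simps)
  then have "v = (det3 b c v / det3 a b c) *s a + (- det3 a c v / det3 a b c) *s b + (det3 a b v / det3 a b c) *s c"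
    using assms by (simp add: vec3_eq_iff field_simps)
  then show ?thesis by (rule that)
qed

lemma plane_scale: "c \<noteq> 0 \<Longrightarrow> plane (c *s n) = plane n"
  by (simp add: plane_def)

context convex4
begin

lemma plane_eq_S: "N \<in> S \<Longrightarrow> normal N = c *s n \<Longrightarrow> N = plane n"
  using plane_normal[OF S_line, of N] normal_S[of N] plane_scale[of c n] by auto

text \<open>
  In the affine chart complementary to \<open>L\<close>, the other lines through \<open>q\<close> and \<open>p\<close> are four verticals \<open>V x\<close> and four
  horizontals \<open>H y\<close>, and three lines \<open>D (s, t)\<close> of equation \<open>y = s x + t\<close> with \<open>s \<noteq> 0\<close> remain. A vertical carries only
  five points: \<open>q\<close> and its four intersections with the horizontals, so the remaining lines meet it
  in grid points. Likewise a remaining line meets the other two in grid points, or at infinity.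
\<close>

lemma fermat_type:
  assumes L: "L \<in> S" and pq: "p \<in> points_of_mult 5 L" "q \<in> points_of_mult 5 L" "p \<noteq> q"
  obtains m1 m2 m3 where "det3 m1 m2 m3 \<noteq> 0" "plane m1 \<in> S" "plane m2 \<in> S" "plane m3 \<in> S"
    "\<And>\<zeta>. \<zeta> \<in> cube_roots \<Longrightarrow> plane (m1 - \<zeta> *s m3) \<in> S"
    "\<And>\<zeta>. \<zeta> \<in> cube_roots \<Longrightarrow> plane (m2 - \<zeta> *s m3) \<in> S"
    "\<And>\<zeta>. \<zeta> \<in> cube_roots \<Longrightarrow> plane (m2 - \<zeta> *s m1) \<in> S"
proof -
  have P5: "p \<in> points L" "num_lines p = 5" "q \<in> points L" "num_lines q = 5" using pq by (auto simp: points_of_mult_def)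
  define TP where "TP = lines_through p - {L}"
  define TQ where "TQ = lines_through q - {L}"
  have sub: "TP \<subseteq> S" "TQ \<subseteq> S" by (auto simp: TP_def TQ_def lines_through_def)
  have fin: "finite TP" "finite TQ" using sub finite_S finite_subset by blast+
  have cards: "card TP = 4" "card TQ = 4"
    using lines_through_bounds(3)[OF L P5(1)] lines_through_bounds(3)[OF L P5(3)] P5 by (simp_all add: TP_def TQ_def)
  have disj: "TP \<inter> TQ = {}"
    using points_inter[OF L P5(1)] points_inter[OF L P5(3)] pq(3) by (auto simp: TP_def TQ_def)
  obtain H0 where H0: "H0 \<in> TP" using cards(1) by fastforce
  obtain V0 where V0: "V0 \<in> TQ" using cards(2) by fastforce
  have HV: "H0 \<in> S" "H0 \<in> lines_through p" "H0 \<noteq> L" "H0 \<notin> lines_through q"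
     "V0 \<in> S" "V0 \<in> lines_through q" "V0 \<noteq> L" "V0 \<notin> lines_through p"
    using H0 V0 disj sub by (auto simp: TP_def TQ_def)
  define \<theta> where "\<theta> = normal L"
  define \<mu> where "\<mu> = normal V0"
  define \<nu> where "\<nu> = normal H0"
  obtain sp \<kappa> M where sp: "sp \<noteq> 0" "sp \<in> L" "Z sp = \<kappa> *s sp" "p = ray sp" "M \<in> S" "M \<noteq> L" "sp \<in> M"
    by (rule points_ray[OF L P5(1)])
  obtain sq \<kappa>' M' where sq: "sq \<noteq> 0" "sq \<in> L" "Z sq = \<kappa>' *s sq" "q = ray sq" "M' \<in> S" "M' \<noteq> L" "sq \<in> M'"
    by (rule points_ray[OF L P5(3)])
  have thp: "N \<in> lines_through p \<longleftrightarrow> dot (normal N) sp = 0" if "N \<in> S" for N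
    using that in_S_iff[OF that] unfolding sp(4) lines_through_ray through_def by simp
  have thq: "N \<in> lines_through q \<longleftrightarrow> dot (normal N) sq = 0" if "N \<in> S" for N
    using that in_S_iff[OF that] unfolding sq(4) lines_through_ray through_def by simp
  have dots: "dot \<theta> sp = 0" "dot \<theta> sq = 0" "dot \<mu> sq = 0" "dot \<nu> sp = 0" "dot \<mu> sp \<noteq> 0" "dot \<nu> sq \<noteq> 0"
    using sp(2) sq(2) in_S_iff[OF L] HV thp[OF HV(1)] thq[OF HV(1)] thp[OF HV(5)] thq[OF HV(5)]
    by (simp_all add: \<theta>_def \<mu>_def \<nu>_def)
  have cr: "cross \<theta> \<mu> \<noteq> 0"
  proof
    assume "cross \<theta> \<mu> = 0"
    then obtain c where "\<theta> = c *s \<mu>" using proportional_if_cross_0 normal_S[OF HV(5)] unfolding \<mu>_def by blast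
    then have "L = V0" using plane_eq_S[OF L] plane_normal[OF S_line[OF HV(5)]] by (simp add: \<theta>_def \<mu>_def)
    then show False using HV by simp
  qed
  have det: "det3 \<theta> \<mu> \<nu> \<noteq> 0"
  proof
    assume "det3 \<theta> \<mu> \<nu> = 0"
    then obtain x y where "\<nu> = x *s \<theta> + y *s \<mu>" using combination_if_det3_0[OF cr] by blast
    then show False using dots by simp
  qed
  \<comment> \<open>the basis dual to \<open>\<theta>\<close>, \<open>\<mu>\<close>, \<open>\<nu>\<close>; \<open>p\<close> and \<open>q\<close> are the directions \<open>eb\<close> and \<open>ec\<close>\<close>
  define ea where "ea = (1 / det3 \<theta> \<mu> \<nu>) *s cross \<mu> \<nu>"
  define eb where "eb = (1 / dot \<mu> sp) *s sp"
  define ec where "ec = (1 / dot \<nu> sq) *s sq"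
  have e: "dot \<theta> ea = 1" "dot \<mu> ea = 0" "dot \<nu> ea = 0" "dot \<theta> eb = 0" "dot \<mu> eb = 1" "dot \<nu> eb = 0"
      "dot \<theta> ec = 0" "dot \<mu> ec = 0" "dot \<nu> ec = 1"
    using dots det det3_rotate[of \<mu> \<nu> \<theta>] dot_commute[of \<theta> "cross \<mu> \<nu>"]
    by (simp_all add: ea_def eb_def ec_def det3_def)
  have Lpl: "L = plane \<theta>" using plane_normal[OF S_line[OF L]] by (simp add: \<theta>_def)
  have q_sub: "q \<subseteq> L" using ray_subset_iff[OF L, of sq] sq by simp
  have ecq: "ec \<in> q" unfolding sq(4) ec_def ray_def by blast
  define V where "V = (\<lambda>x. plane (\<mu> - x *s \<theta>))"
  define H where "H = (\<lambda>y. plane (\<nu> - y *s \<theta>))"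
  define D where "D = (\<lambda>(s, t). plane (\<nu> - s *s \<mu> - t *s \<theta>))"
  define X where "X = {x. V x \<in> S}"
  define Y where "Y = {y. H y \<in> S}"
  define P where "P = {(s, t). D (s, t) \<in> S \<and> s \<noteq> 0}"
  define pt where "pt = (\<lambda>x y z. x *s ea + y *s eb + z *s ec)"
  have mem: "pt x y z \<in> V a \<longleftrightarrow> y = a * x" "pt x y z \<in> H a \<longleftrightarrow> z = a * x"
    "pt x y z \<in> D (s, t) \<longleftrightarrow> z = s * y + t * x" "pt x y z \<in> L \<longleftrightarrow> x = 0" for x y z a s t
    by (simp_all add: pt_def V_def H_def D_def Lpl plane_def e diff_diff_eq)
  have ptq: "pt 0 0 1 \<in> q" using ecq by (simp add: pt_def)
  have TQ: "TQ = V ` X"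
  proof (intro equalityI subsetI)
    fix N assume N: "N \<in> TQ"
    then have NS: "N \<in> S" "N \<noteq> L" "N \<in> lines_through q" by (auto simp: TQ_def lines_through_def)
    obtain x y z where n: "normal N = x *s \<theta> + y *s \<mu> + z *s \<nu>" using basis_expansion[OF det] by blast
    have "z = 0" using thq[OF NS(1)] NS(3) dots by (simp add: n)
    have "y \<noteq> 0" using plane_eq_S[OF NS(1), of x \<theta>] NS(2) n \<open>z = 0\<close> Lpl by auto
    then have "normal N = y *s (\<mu> - (- x / y) *s \<theta>)" using n \<open>z = 0\<close> by (simp add: vec3_eq_iff field_simps)
    then have "N = V (- x / y)" unfolding V_def by (rule plane_eq_S[OF NS(1)])
    then show "N \<in> V ` X" using NS(1) by (auto simp: X_def)
  next
    fix N assume "N \<in> V ` X"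
    then obtain x where x: "N = V x" "V x \<in> S" by (auto simp: X_def)
    have "sq \<in> V x" using dots by (simp add: V_def plane_def)
    then have "N \<in> lines_through q" using x unfolding sq(4) lines_through_ray through_def by simp
    moreover have "pt 1 x 0 \<in> V x" "pt 1 x 0 \<notin> L" by (simp_all add: mem)
    ultimately show "N \<in> TQ" using x(1) by (auto simp: TQ_def)
  qed
  have TP: "TP = H ` Y"
  proof (intro equalityI subsetI)
    fix N assume N: "N \<in> TP"
    then have NS: "N \<in> S" "N \<noteq> L" "N \<in> lines_through p" by (auto simp: TP_def lines_through_def)
    obtain x y z where n: "normal N = x *s \<theta> + y *s \<mu> + z *s \<nu>" using basis_expansion[OF det] by blast
    have "y = 0" using thp[OF NS(1)] NS(3) dots by (simp add: n)
    have "z \<noteq> 0" using plane_eq_S[OF NS(1), of x \<theta>] NS(2) n \<open>y = 0\<close> Lpl by auto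
    then have "normal N = z *s (\<nu> - (- x / z) *s \<theta>)" using n \<open>y = 0\<close> by (simp add: vec3_eq_iff field_simps)
    then have "N = H (- x / z)" unfolding H_def by (rule plane_eq_S[OF NS(1)])
    then show "N \<in> H ` Y" using NS(1) by (auto simp: Y_def)
  next
    fix N assume "N \<in> H ` Y"
    then obtain x where x: "N = H x" "H x \<in> S" by (auto simp: Y_def)
    have "sp \<in> H x" using dots by (simp add: H_def plane_def)
    then have "N \<in> lines_through p" using x unfolding sp(4) lines_through_ray through_def by simp
    moreover have "pt 1 0 x \<in> H x" "pt 1 0 x \<notin> L" by (simp_all add: mem)
    ultimately show "N \<in> TP" using x(1) by (auto simp: TP_def)
  qed
  have T: "S - insert L (TP \<union> TQ) = D ` P"
  proof (intro equalityI subsetI)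
    fix N assume N: "N \<in> S - insert L (TP \<union> TQ)"
    then have NS: "N \<in> S" "N \<notin> lines_through p" "N \<notin> lines_through q" by (auto simp: TP_def TQ_def)
    obtain x y z where n: "normal N = x *s \<theta> + y *s \<mu> + z *s \<nu>" using basis_expansion[OF det] by blast
    have "z \<noteq> 0" using thq[OF NS(1)] NS(3) dots by (simp add: n)
    have "y \<noteq> 0" using thp[OF NS(1)] NS(2) dots by (simp add: n)
    have "normal N = z *s (\<nu> - (- y / z) *s \<mu> - (- x / z) *s \<theta>)"
      using n \<open>z \<noteq> 0\<close> by (simp add: vec3_eq_iff field_simps)
    then have "N = D (- y / z, - x / z)" unfolding D_def prod.case by (rule plane_eq_S[OF NS(1)])
    then show "N \<in> D ` P" using NS(1) \<open>y \<noteq> 0\<close> \<open>z \<noteq> 0\<close> by (auto simp: P_def)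
  next
    fix N assume "N \<in> D ` P"
    then obtain s t where st: "N = D (s, t)" "D (s, t) \<in> S" "s \<noteq> 0" by (auto simp: P_def)
    have "pt 0 0 1 \<notin> N" using st by (simp add: mem)
    then have 1: "N \<notin> lines_through q" using ptq by (auto simp: lines_through_def)
    have "eb \<in> p" unfolding sp(4) eb_def ray_def by blast
    then have "pt 0 1 0 \<in> p" by (simp add: pt_def)
    moreover have "pt 0 1 0 \<notin> N" using st by (simp add: mem)
    ultimately have 2: "N \<notin> lines_through p" by (auto simp: lines_through_def)
    have "L \<in> lines_through p" using lines_through_bounds(3)[OF L P5(1)] .
    then show "N \<in> S - insert L (TP \<union> TQ)" using 1 2 st by (auto simp: TP_def TQ_def)
  qed
  have injV: "inj V"
  proof
    fix x x' assume "V x = V x'"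
    moreover have "pt 1 x 0 \<in> V x" by (simp add: mem)
    ultimately have "pt 1 x 0 \<in> V x'" by simp
    then show "x = x'" by (simp add: mem)
  qed
  have injH: "inj H"
  proof
    fix x x' assume "H x = H x'"
    moreover have "pt 1 0 x \<in> H x" by (simp add: mem)
    ultimately have "pt 1 0 x \<in> H x'" by simp
    then show "x = x'" by (simp add: mem)
  qed
  have injD: "inj D"
  proof
    fix a b assume ab: "D a = D b"
    obtain s t s' t' where st: "a = (s, t)" "b = (s', t')" by (cases a; cases b)
    have "pt 1 0 t \<in> D a" "pt 0 1 s \<in> D a" by (simp_all add: mem st)
    then have "pt 1 0 t \<in> D b" "pt 0 1 s \<in> D b" using ab by simp_all
    then show "a = b" by (simp add: mem st)
  qed
  have cX: "card X = 4" using cards(2) unfolding TQ by (simp add: card_image inj_on_subset[OF injV])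
  have cY: "card Y = 4" using cards(1) unfolding TP by (simp add: card_image inj_on_subset[OF injH])
  have cP: "card P = 3"
  proof -
    have "card (insert L (TP \<union> TQ)) = 9"
      using fin cards disj by (subst card_insert_disjoint) (auto simp: card_Un_disjoint TP_def TQ_def)
    then have "card (D ` P) = 3"
      unfolding T[symmetric] using L sub finite_S card_S by (subst card_Diff_subset) (auto intro: finite_subset)
    then show ?thesis by (simp add: card_image inj_on_subset[OF injD])
  qed
  have into: "s * x + t \<in> Y" if st: "(s, t) \<in> P" and x: "x \<in> X" for s t x
  proof -
    have N: "D (s, t) \<in> S" "s \<noteq> 0" using st by (auto simp: P_def)
    have VS: "V x \<in> S" "V x \<in> lines_through q" using x TQ by (auto simp: X_def TQ_def)
    have fX: "finite (points (V x))" by (rule finite_points)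
    define Q where "Q = insert q ((\<lambda>y. V x \<inter> H y) ` Y)"
    have "Q \<subseteq> points (V x)"
    proof -
      have "q \<in> points (V x)" using points_through(2)[OF L P5(3) VS(2)] .
      moreover have "V x \<inter> H y \<in> points (V x)" if y: "y \<in> Y" for y
      proof -
        have "pt 0 0 1 \<in> V x" "pt 0 0 1 \<notin> H y" by (simp_all add: mem)
        then have "V x \<noteq> H y" by blast
        then show ?thesis using y by (auto simp: points_def Y_def)
      qed
      ultimately show ?thesis by (auto simp: Q_def)
    qed
    moreover have "card Q = 5"
    proof -
      have "inj_on (\<lambda>y. V x \<inter> H y) Y"
      proof
        fix y y' assume "V x \<inter> H y = V x \<inter> H y'"
        moreover have "pt 1 x y \<in> V x \<inter> H y" by (simp add: mem)
        ultimately have "pt 1 x y \<in> H y'" by blast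
        then show "y = y'" by (simp add: mem)
      qed
      moreover have "q \<notin> (\<lambda>y. V x \<inter> H y) ` Y"
      proof
        assume "q \<in> (\<lambda>y. V x \<inter> H y) ` Y"
        then obtain y where "q = V x \<inter> H y" by blast
        then have "pt 0 0 1 \<in> H y" using ptq by blast
        then show False by (simp add: mem)
      qed
      moreover have "finite Y" using cY finite_if_card_Suc[of Y 3] by simp
      ultimately show ?thesis unfolding Q_def using cY by (simp add: card_image)
    qed
    ultimately have Q: "Q = points (V x)"
      using card_subset_eq[OF fX] camacho_sad(1)[OF VS(1)] by simp
    let ?v = "pt 1 x (s * x + t)"
    have v: "?v \<in> V x" "?v \<in> D (s, t)" "?v \<notin> L" by (simp_all add: mem)
    have "pt 0 0 1 \<in> V x" "pt 0 0 1 \<notin> D (s, t)" by (simp_all add: mem)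
    then have "V x \<noteq> D (s, t)" by blast
    then have "V x \<inter> D (s, t) \<in> Q" unfolding Q using N by (auto simp: points_def)
    moreover have "V x \<inter> D (s, t) \<noteq> q" using v q_sub by blast
    ultimately obtain y where y: "y \<in> Y" "V x \<inter> D (s, t) = V x \<inter> H y" by (auto simp: Q_def)
    then have "?v \<in> H y" using v by blast
    then show ?thesis using y(1) by (simp add: mem)
  qed
  have meet: "s = s' \<or> (\<exists>x\<in>X. s * x + t = s' * x + t')"
    if st: "(s, t) \<in> P" "(s', t') \<in> P" "(s, t) \<noteq> (s', t')" for s t s' t'
  proof -
    let ?N = "D (s, t)" and ?N' = "D (s', t')"
    have N: "?N \<in> S" "?N' \<in> S" "s \<noteq> 0" using st by (auto simp: P_def)
    have neq: "?N \<noteq> ?N'" using inj_eq[OF injD] st(3) by simp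
    define Q where "Q = insert (?N \<inter> L) ((\<lambda>x. ?N \<inter> V x) ` X)"
    have "Q \<subseteq> points ?N"
    proof -
      have "pt 1 0 t \<in> ?N" "pt 1 0 t \<notin> L" by (simp_all add: mem)
      then have "?N \<inter> L \<in> points ?N" using L by (auto simp: points_def)
      moreover have "?N \<inter> V x \<in> points ?N" if x: "x \<in> X" for x
      proof -
        have "pt 0 0 1 \<in> V x" "pt 0 0 1 \<notin> ?N" by (simp_all add: mem)
        then show ?thesis using x by (auto simp: points_def X_def)
      qed
      ultimately show ?thesis by (auto simp: Q_def)
    qed
    moreover have "card Q = 5"
    proof -
      have v: "pt 1 x (s * x + t) \<in> ?N \<inter> V x" for x by (simp add: mem)
      have "inj_on (\<lambda>x. ?N \<inter> V x) X"
      proof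
        fix x x' assume "?N \<inter> V x = ?N \<inter> V x'"
        then have "pt 1 x (s * x + t) \<in> V x'" using v[of x] by blast
        then show "x = x'" by (simp add: mem)
      qed
      moreover have "?N \<inter> L \<notin> (\<lambda>x. ?N \<inter> V x) ` X"
      proof
        assume "?N \<inter> L \<in> (\<lambda>x. ?N \<inter> V x) ` X"
        then obtain x where "?N \<inter> L = ?N \<inter> V x" by blast
        then have "pt 1 x (s * x + t) \<in> L" using v[of x] by blast
        then show False by (simp add: mem)
      qed
      moreover have "finite X" using cX finite_if_card_Suc[of X 3] by simp
      ultimately show ?thesis unfolding Q_def using cX by (simp add: card_image)
    qed
    ultimately have Q: "Q = points ?N"
      using card_subset_eq[OF finite_points] camacho_sad(1)[OF N(1)] by simp
    have "?N \<inter> ?N' \<in> Q" unfolding Q using N neq by (auto simp: points_def)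
    then consider "?N \<inter> ?N' = ?N \<inter> L" | x where "x \<in> X" "?N \<inter> ?N' = ?N \<inter> V x" by (auto simp: Q_def)
    then show ?thesis
    proof cases
      case 1
      have "pt 0 1 s \<in> ?N \<inter> L" by (simp add: mem)
      then have "pt 0 1 s \<in> ?N'" using 1 by blast
      then show ?thesis by (simp add: mem)
    next
      case 2
      have "pt 1 x (s * x + t) \<in> ?N \<inter> V x" by (simp add: mem)
      then have "pt 1 x (s * x + t) \<in> ?N'" using 2 by blast
      then show ?thesis using 2(1) by (auto simp: mem)
    qed
  qed
  have nz: "s \<noteq> 0" if "(s, t) \<in> P" for s t using that by (simp add: P_def)
  obtain a b c d where abcd: "a \<noteq> 0" "b \<noteq> 0" "c \<in> X" "d \<in> Y"
    "\<forall>\<zeta>\<in>cube_roots. c + a * \<zeta> \<in> X" "\<forall>\<zeta>\<in>cube_roots. d + b * \<zeta> \<in> Y"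
    "\<forall>\<zeta>\<in>cube_roots. (\<zeta> * b / a, d - \<zeta> * b / a * c) \<in> P"
    by (rule cube_root_grid[OF cX cY cP into nz meet]) blast
  \<comment> \<open>coordinates in which the common point of the three lines is the origin, and the grid is given by 0 and
    the cube roots of unity\<close>
  define m1 where "m1 = (1 / a) *s (\<mu> - c *s \<theta>)"
  define m2 where "m2 = (1 / b) *s (\<nu> - d *s \<theta>)"
  show ?thesis
  proof (rule that[of m1 m2 \<theta>])
    have "det3 m1 m2 \<theta> = (1 / a) * (1 / b) * det3 \<mu> \<nu> \<theta>" by (simp add: m1_def m2_def)
    then show "det3 m1 m2 \<theta> \<noteq> 0" using det abcd det3_rotate[of \<theta> \<mu> \<nu>] by (simp add: det3_rotate)
    show "plane m1 \<in> S" unfolding m1_def using abcd(1,3) by (subst plane_scale) (auto simp: X_def V_def)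
    show "plane m2 \<in> S" unfolding m2_def using abcd(2,4) by (subst plane_scale) (auto simp: Y_def H_def)
    show "plane \<theta> \<in> S" using L Lpl by simp
    fix \<zeta> assume z: "\<zeta> \<in> cube_roots"
    have 1: "m1 - \<zeta> *s \<theta> = (1 / a) *s (\<mu> - (c + a * \<zeta>) *s \<theta>)"
      using abcd(1) by (simp add: m1_def vec3_eq_iff field_simps)
    have "plane (m1 - \<zeta> *s \<theta>) = V (c + a * \<zeta>)"
      unfolding 1 V_def by (rule plane_scale) (use abcd(1) in simp)
    moreover have "V (c + a * \<zeta>) \<in> S" using bspec[OF abcd(5) z] unfolding X_def by (rule CollectD)
    ultimately show "plane (m1 - \<zeta> *s \<theta>) \<in> S" by (simp only:)
    have 2: "m2 - \<zeta> *s \<theta> = (1 / b) *s (\<nu> - (d + b * \<zeta>) *s \<theta>)"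
      using abcd(2) by (simp add: m2_def vec3_eq_iff field_simps)
    have "plane (m2 - \<zeta> *s \<theta>) = H (d + b * \<zeta>)"
      unfolding 2 H_def by (rule plane_scale) (use abcd(2) in simp)
    moreover have "H (d + b * \<zeta>) \<in> S" using bspec[OF abcd(6) z] unfolding Y_def by (rule CollectD)
    ultimately show "plane (m2 - \<zeta> *s \<theta>) \<in> S" by (simp only:)
    have 3: "m2 - \<zeta> *s m1 = (1 / b) *s (\<nu> - (\<zeta> * b / a) *s \<mu> - (d - \<zeta> * b / a * c) *s \<theta>)"
    proof -
      have "1 / b * (n - d * l) - \<zeta> * (1 / a * (m - c * l)) = 1 / b * (n - \<zeta> * b / a * m - (d - \<zeta> * b / a * c) * l)"
        for n m l :: complex
      proof -
        have "1 / b * (n - \<zeta> * b / a * m - (d - \<zeta> * b / a * c) * l) =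
            1 / b * (n - d * l) - \<zeta> * (b / b) * (1 / a * (m - c * l))"
          by (simp add: algebra_simps)
        then show ?thesis using abcd(2) by simp
      qed
      then show ?thesis by (simp only: m1_def m2_def vec_eq_iff vector_minus_component vector_smult_component simp_thms)
    qed
    have "plane (m2 - \<zeta> *s m1) = D (\<zeta> * b / a, d - \<zeta> * b / a * c)"
      unfolding 3 D_def prod.case by (rule plane_scale) (use abcd(2) in simp)
    moreover have "D (\<zeta> * b / a, d - \<zeta> * b / a * c) \<in> S" using bspec[OF abcd(7) z] unfolding P_def by blast
    ultimately show "plane (m2 - \<zeta> *s m1) \<in> S" by (simp only:)
  qed
qed

end

section \<open>The Hesse arrangement\<close>

context convex4
begin

lemma points_eq_inter: "A \<in> S \<Longrightarrow> B \<in> S \<Longrightarrow> A \<noteq> B \<Longrightarrow> A \<inter> B \<in> points A"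
  by (auto simp: points_def)

lemma inter_lines_through: "A \<in> S \<Longrightarrow> B \<in> S \<Longrightarrow> A \<in> lines_through (A \<inter> B) \<and> B \<in> lines_through (A \<inter> B)"
  by (auto simp: lines_through_def)

lemma double_point_lines:
  assumes "A \<in> S" "B \<in> S" "A \<noteq> B" "num_lines (A \<inter> B) = 2"
  shows "lines_through (A \<inter> B) = {A, B}"
proof (rule card_subset_eq[symmetric])
  show "finite (lines_through (A \<inter> B))" using finite_S by (simp add: lines_through_def)
qed (use assms inter_lines_through in auto)

context
  assumes no_A: "\<And>L. L \<in> S \<Longrightarrow> card (points_of_mult 5 L) \<le> 1"
begin

lemma all_hesse_type:
  assumes "L \<in> S"
  shows "card (points_of_mult 2 L) = 2" "card (points_of_mult 4 L) = 3" "points L = points_of_mult 2 L \<union> points_of_mult 4 L"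
  using hesse_type[OF no_A assms] by blast+

text \<open>
  Counting incidences gives \<open>12 \<cdot> 3 / 4 = 9\<close> quadruple points. The four lines through one of them contain
  \<open>4 \<cdot> 2 = 8\<close> further ones, which are therefore all the others.
\<close>

lemma joined:
  assumes "A \<in> S" "p \<in> points_of_mult 4 A" "B \<in> S" "q \<in> points_of_mult 4 B" "p \<noteq> q"
  obtains N where "N \<in> S" "p \<in> points_of_mult 4 N" "q \<in> points_of_mult 4 N"
proof -
  let ?quads = "points_of_mult 4"
  define Q where "Q = (\<Union>L\<in>S. ?quads L)"
  have finQ: "finite Q" using finite_S finite_points_of_mult by (simp add: Q_def)
  have lines: "{L \<in> S. q \<in> ?quads L} = lines_through q" if qQ: "q \<in> Q" for q
  proof -
    obtain L where L: "L \<in> S" "q \<in> points L" "num_lines q = 4" using qQ by (auto simp: Q_def points_of_mult_def)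
    show ?thesis
      using points_through[OF L(1,2)] lines_through_bounds(3) L(3) by (auto simp: points_of_mult_def)
  qed
  have "(\<Sum>L\<in>S. card {q \<in> Q. q \<in> ?quads L}) = (\<Sum>q\<in>Q. 4)"
    by (rule sum_multicount_gen[OF finite_S finQ]) (use lines in \<open>auto simp: Q_def points_of_mult_def\<close>)
  moreover have "{q \<in> Q. q \<in> ?quads L} = ?quads L" if "L \<in> S" for L using that by (auto simp: Q_def)
  ultimately have cQ: "card Q = 9" using all_hesse_type(2) card_S by simp
  have pQ: "p \<in> Q" "q \<in> Q" using assms by (auto simp: Q_def)
  have cp: "num_lines p = 4" using assms(2) by (simp add: points_of_mult_def)
  define U where "U = (\<Union>N\<in>lines_through p. ?quads N - {p})"
  have through: "N \<in> S \<and> p \<in> ?quads N" if "N \<in> lines_through p" for N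
    using that unfolding lines[OF pQ(1), symmetric] by simp
  have "card U = (\<Sum>N\<in>lines_through p. card (?quads N - {p}))"
    unfolding U_def
  proof (rule card_UN_disjoint)
    show "finite (lines_through p)" using finite_S by (simp add: lines_through_def)
    show "\<forall>i\<in>lines_through p. finite (?quads i - {p})" using finite_points_of_mult by simp
    show "\<forall>i\<in>lines_through p. \<forall>j\<in>lines_through p. i \<noteq> j \<longrightarrow> (?quads i - {p}) \<inter> (?quads j - {p}) = {}"
    proof (intro ballI impI)
      fix i j assume ij: "i \<in> lines_through p" "j \<in> lines_through p" "i \<noteq> j"
      have i: "i \<in> S" "p \<in> points i" using through[OF ij(1)] by (auto simp: points_of_mult_def)
      have "i \<inter> j = p" using points_inter[OF i ij(2)] ij(3) by simp
      moreover have "i \<inter> j = r" if "r \<in> ?quads i" "r \<in> ?quads j" for r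
      proof -
        have "j \<in> lines_through r" using that(2) through[OF ij(2)] lines_through_bounds(3) by (simp add: points_of_mult_def)
        then show ?thesis using points_inter[OF i(1) _ _ ij(3)[symmetric]] that(1) by (simp add: points_of_mult_def)
      qed
      ultimately show "(?quads i - {p}) \<inter> (?quads j - {p}) = {}" by blast
    qed
  qed
  also have "\<dots> = (\<Sum>N\<in>lines_through p. 2)"
    by (rule sum.cong) (use through all_hesse_type(2) in auto)
  finally have cU: "card U = 8" using cp by simp
  have finU: "finite U" using cU finite_if_card_Suc[of U 7] by simp
  have "insert p U = Q"
  proof (rule card_subset_eq[OF finQ])
    show "insert p U \<subseteq> Q" using pQ through by (auto simp: U_def Q_def)
    have "p \<notin> U" by (auto simp: U_def)
    then show "card (insert p U) = card Q" using finU cU cQ by simp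
  qed
  then have "q \<in> U" using pQ(2) assms(5) by blast
  then obtain N where "N \<in> lines_through p" "q \<in> ?quads N" by (auto simp: U_def)
  then show ?thesis using through that by blast
qed

lemma quad_on_side:
  assumes "A \<in> S" "B \<in> S" "C \<in> S" "A \<noteq> B" "A \<noteq> C" "B \<noteq> C" "num_lines (A \<inter> B) = 2" "num_lines (A \<inter> C) = 2"
    "N \<in> S" "N \<noteq> A" "N \<noteq> B" "N \<noteq> C"
  shows "A \<inter> N \<in> points_of_mult 4 A"
proof -
  have B: "lines_through (A \<inter> B) = {A, B}" by (rule double_point_lines[OF assms(1,2,4,7)])
  have C: "lines_through (A \<inter> C) = {A, C}" by (rule double_point_lines[OF assms(1,3,5,8)])
  have "A \<inter> B \<noteq> A \<inter> C"
  proof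
    assume "A \<inter> B = A \<inter> C"
    then have "{A, B} = {A, C}" using B C by simp
    then show False using assms(4-6) by (simp add: doubleton_eq_iff)
  qed
  then have "card {A \<inter> B, A \<inter> C} = 2" by simp
  moreover have "{A \<inter> B, A \<inter> C} \<subseteq> points_of_mult 2 A"
    using points_eq_inter assms by (auto simp: points_of_mult_def)
  ultimately have D: "{A \<inter> B, A \<inter> C} = points_of_mult 2 A"
    using card_subset_eq[OF finite_points_of_mult] all_hesse_type(1)[OF assms(1)] by simp
  have N: "A \<inter> N \<in> points A" using points_eq_inter assms(1,9,10) by auto
  have NN: "N \<in> lines_through (A \<inter> N)" using inter_lines_through[OF assms(1,9)] by simp
  have e1: "A \<inter> N \<noteq> A \<inter> B"
  proof
    assume "A \<inter> N = A \<inter> B"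
    then have "N \<in> {A, B}" using NN B by simp
    then show False using assms(10,11) by simp
  qed
  have e2: "A \<inter> N \<noteq> A \<inter> C"
  proof
    assume "A \<inter> N = A \<inter> C"
    then have "N \<in> {A, C}" using NN C by simp
    then show False using assms(10,12) by simp
  qed
  have "A \<inter> N \<notin> points_of_mult 2 A" unfolding D[symmetric] by (simp only: insert_iff empty_iff e1 e2 simp_thms)
  then show ?thesis using N unfolding all_hesse_type(3)[OF assms(1)] Un_iff by simp
qed

text \<open>
  Let \<open>B\<close> and \<open>C\<close> be the lines through the two double points of \<open>A\<close>. If \<open>B\<close> and \<open>C\<close> met in a quadruple point \<open>q\<close>,
  the lines joining \<open>q\<close> to the three quadruple points of \<open>A\<close> would be three lines through \<open>q\<close> besides \<open>B\<close> and
  \<open>C\<close>, so five in total.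
\<close>

lemma double_triangle:
  obtains A B C where "A \<in> S" "B \<in> S" "C \<in> S" "A \<noteq> B" "A \<noteq> C" "B \<noteq> C"
    "num_lines (A \<inter> B) = 2" "num_lines (A \<inter> C) = 2" "num_lines (B \<inter> C) = 2"
proof -
  obtain A where A: "A \<in> S" using card_S by fastforce
  have other: "\<exists>B. B \<in> S \<and> B \<noteq> A \<and> A \<inter> B = p \<and> num_lines (A \<inter> B) = 2" if p: "p \<in> points_of_mult 2 A" for p
  proof -
    have p': "p \<in> points A" "num_lines p = 2" using p by (auto simp: points_of_mult_def)
    have "lines_through p \<noteq> {A}" using p'(2) by auto
    then obtain B where B: "B \<in> lines_through p" "B \<noteq> A" using lines_through_bounds(3)[OF A p'(1)] by blast
    then show ?thesis using points_inter[OF A p'(1) B] p' by (auto simp: lines_through_def)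
  qed
  obtain p2 p3 where p23: "points_of_mult 2 A = {p2, p3}" "p2 \<noteq> p3" using all_hesse_type(1)[OF A] by (auto simp: card_2_iff)
  obtain B where B: "B \<in> S" "B \<noteq> A" "A \<inter> B = p2" "num_lines (A \<inter> B) = 2" using other[of p2] p23 by auto
  obtain C where C: "C \<in> S" "C \<noteq> A" "A \<inter> C = p3" "num_lines (A \<inter> C) = 2" using other[of p3] p23 by auto
  have BC: "B \<noteq> C" using B(3) C(3) p23(2) by blast
  define q where "q = B \<inter> C"
  have qB: "q \<in> points B" unfolding q_def by (rule points_eq_inter[OF B(1) C(1) BC])
  have qBC: "B \<in> lines_through q" "C \<in> lines_through q" using inter_lines_through[OF B(1) C(1)] by (auto simp: q_def)
  have qC: "q \<in> points C" using points_through[OF B(1) qB qBC(2)] by simp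
  have qA: "q \<notin> points A"
  proof
    assume *: "q \<in> points A"
    have "A \<inter> B = q" by (rule points_inter[OF A * qBC(1) B(2)])
    moreover have "A \<inter> C = q" by (rule points_inter[OF A * qBC(2) C(2)])
    ultimately show False using B(3) C(3) p23(2) by simp
  qed
  have "num_lines q = 2"
  proof (rule ccontr)
    assume "num_lines q \<noteq> 2"
    then have "q \<notin> points_of_mult 2 B" by (simp add: points_of_mult_def)
    then have q4: "q \<in> points_of_mult 4 B" using qB unfolding all_hesse_type(3)[OF B(1)] by simp
    have "\<exists>N. N \<in> S \<and> p \<in> points_of_mult 4 N \<and> q \<in> points_of_mult 4 N" if "p \<in> points_of_mult 4 A" for p
    proof -
      have "p \<noteq> q" using that qA by (auto simp: points_of_mult_def)
      then show ?thesis using joined[OF A that B(1) q4] by metis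
    qed
    then obtain f where f: "\<And>p. p \<in> points_of_mult 4 A \<Longrightarrow> f p \<in> S \<and> p \<in> points_of_mult 4 (f p) \<and> q \<in> points_of_mult 4 (f p)"
      by metis
    have pf: "p \<in> points A" "p \<in> points (f p)" "num_lines p = 4" "f p \<in> S" "q \<in> points (f p)" if "p \<in> points_of_mult 4 A" for p
      using f[OF that] that by (auto simp: points_of_mult_def)
    have fA: "f p \<noteq> A" if "p \<in> points_of_mult 4 A" for p using pf[OF that] qA by auto
    have meet: "A \<inter> f p = p" if "p \<in> points_of_mult 4 A" for p
      using points_inter[OF A pf(1)[OF that] _ fA[OF that]] lines_through_bounds(3)[OF pf(4,2)] that by blast
    have inj: "inj_on f (points_of_mult 4 A)" using meet by (metis inj_onI)
    have fBC: "f p \<noteq> B" "f p \<noteq> C" if "p \<in> points_of_mult 4 A" for p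
      using meet[OF that] pf(3)[OF that] B(4) C(4) by auto
    have "insert B (insert C (f ` points_of_mult 4 A)) \<subseteq> lines_through q"
      using qBC lines_through_bounds(3)[OF pf(4) pf(5)] by auto
    moreover have "finite (lines_through q)" using finite_S by (simp add: lines_through_def)
    ultimately have "card (insert B (insert C (f ` points_of_mult 4 A))) \<le> num_lines q" by (rule card_mono[rotated])
    moreover have "card (insert B (insert C (f ` points_of_mult 4 A))) = 5"
    proof -
      have "B \<notin> insert C (f ` points_of_mult 4 A)" "C \<notin> f ` points_of_mult 4 A" using fBC BC by auto
      moreover have "card (f ` points_of_mult 4 A) = 3" using inj all_hesse_type(2)[OF A] by (simp add: card_image)
      ultimately show ?thesis using finite_points_of_mult by simp
    qed
    moreover have "num_lines q = 4" using q4 by (simp add: points_of_mult_def)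
    ultimately show False by simp
  qed
  then show ?thesis using that[of A B C] A B C BC by (auto simp: q_def)
qed

text \<open>
  The sides of the triangle become the coordinate lines. The other nine lines avoid its vertices, so they are
  \<open>D (u, v)\<close> with \<open>u, v \<noteq> 0\<close>, and they meet each side in its three quadruple points. On the three sides these points
  are determined by \<open>v\<close>, \<open>u\<close> and \<open>u / v\<close>, so each of these takes at most three values. As there are nine
  pairs, all combinations of \<open>u\<close> and \<open>v\<close> occur.
\<close>

lemma hesse_coordinates:
  obtains m1 m2 m3 where "det3 m1 m2 m3 \<noteq> 0" "plane m1 \<in> S" "plane m2 \<in> S" "plane m3 \<in> S"
    "\<forall>\<zeta>\<in>cube_roots. \<forall>\<xi>\<in>cube_roots. plane (\<zeta> *s m1 + \<xi> *s m2 + m3) \<in> S"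
proof -
  obtain L1 L2 L3 where L: "L1 \<in> S" "L2 \<in> S" "L3 \<in> S" "L1 \<noteq> L2" "L1 \<noteq> L3" "L2 \<noteq> L3"
    "num_lines (L1 \<inter> L2) = 2" "num_lines (L1 \<inter> L3) = 2" "num_lines (L2 \<inter> L3) = 2"
    by (rule double_triangle)
  note th12 = double_point_lines[OF L(1,2,4,7)] and th13 = double_point_lines[OF L(1,3,5,8)]
    and th23 = double_point_lines[OF L(2,3,6,9)]
  define n1 where "n1 = normal L1"
  define n2 where "n2 = normal L2"
  define n3 where "n3 = normal L3"
  have pl: "L1 = plane n1" "L2 = plane n2" "L3 = plane n3"
    using plane_normal[OF S_line] L by (simp_all add: n1_def n2_def n3_def)
  have n0: "n1 \<noteq> 0" "n2 \<noteq> 0" using normal_S L by (simp_all add: n1_def n2_def)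
  have cr: "cross n1 n2 \<noteq> 0"
  proof
    assume "cross n1 n2 = 0"
    then obtain c where "n1 = c *s n2" using proportional_if_cross_0 n0 by blast
    then have "L1 = L2" using plane_eq_S[OF L(1), of c n2] pl(2) by (simp add: n1_def)
    then show False using L(4) by simp
  qed
  have det: "det3 n1 n2 n3 \<noteq> 0"
  proof
    assume "det3 n1 n2 n3 = 0"
    then obtain x y where "n3 = x *s n1 + y *s n2" using combination_if_det3_0[OF cr] by blast
    then have "L1 \<inter> L2 \<subseteq> L3" unfolding pl by (auto simp: plane_def)
    then have "L3 \<in> lines_through (L1 \<inter> L2)" using L(3) by (simp add: lines_through_def)
    then show False using th12 L by simp
  qed
  define e1 where "e1 = (1 / det3 n1 n2 n3) *s cross n2 n3"
  define e2 where "e2 = (1 / det3 n1 n2 n3) *s cross n3 n1"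
  define e3 where "e3 = (1 / det3 n1 n2 n3) *s cross n1 n2"
  have e: "dot n1 e1 = 1" "dot n2 e1 = 0" "dot n3 e1 = 0" "dot n1 e2 = 0" "dot n2 e2 = 1" "dot n3 e2 = 0"
      "dot n1 e3 = 0" "dot n2 e3 = 0" "dot n3 e3 = 1"
  proof -
    have "dot n1 (cross n2 n3) = det3 n1 n2 n3" "dot n2 (cross n3 n1) = det3 n1 n2 n3" "dot n3 (cross n1 n2) = det3 n1 n2 n3"
      by (simp_all add: det3_def dot_def algebra_simps)
    then show "dot n1 e1 = 1" "dot n2 e1 = 0" "dot n3 e1 = 0" "dot n1 e2 = 0" "dot n2 e2 = 1" "dot n3 e2 = 0"
      "dot n1 e3 = 0" "dot n2 e3 = 0" "dot n3 e3 = 1" using det by (simp_all add: e1_def e2_def e3_def)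
  qed
  define pt where "pt = (\<lambda>x y z. x *s e1 + y *s e2 + z *s e3)"
  define T where "T = S - {L1, L2, L3}"
  have cT: "card T = 9" using card_S L finite_S by (simp add: T_def card_Diff_subset)
  define D where "D = (\<lambda>(u, v). plane (u *s n1 + v *s n2 + n3))"
  have mem: "pt x y z \<in> D (u, v) \<longleftrightarrow> u * x + v * y + z = 0" for x y z u v
    by (simp add: pt_def D_def plane_def e)
  define P where "P = {(u, v). D (u, v) \<in> S \<and> u \<noteq> 0 \<and> v \<noteq> 0}"
  have T: "T = D ` P"
  proof (intro equalityI subsetI)
    fix N assume "N \<in> T"
    then have N: "N \<in> S" "N \<noteq> L1" "N \<noteq> L2" "N \<noteq> L3" by (auto simp: T_def)
    obtain a b c where n: "normal N = a *s n1 + b *s n2 + c *s n3" using basis_expansion[OF det] by blast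
    have inN: "(v \<in> N) = (a * dot n1 v + b * dot n2 v + c * dot n3 v = 0)" for v using in_S_iff[OF N(1)] n by simp
    have "a \<noteq> 0"
    proof
      assume "a = 0"
      then have "v \<in> N" if "dot n2 v = 0" "dot n3 v = 0" for v using inN[of v] that by simp
      then have "L2 \<inter> L3 \<subseteq> N" unfolding pl plane_def by blast
      then have "N \<in> lines_through (L2 \<inter> L3)" using N(1) by (simp add: lines_through_def)
      then show False using th23 N by simp
    qed
    have "b \<noteq> 0"
    proof
      assume "b = 0"
      then have "v \<in> N" if "dot n1 v = 0" "dot n3 v = 0" for v using inN[of v] that by simp
      then have "L1 \<inter> L3 \<subseteq> N" unfolding pl plane_def by blast
      then have "N \<in> lines_through (L1 \<inter> L3)" using N(1) by (simp add: lines_through_def)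
      then show False using th13 N by simp
    qed
    have "c \<noteq> 0"
    proof
      assume "c = 0"
      then have "v \<in> N" if "dot n1 v = 0" "dot n2 v = 0" for v using inN[of v] that by simp
      then have "L1 \<inter> L2 \<subseteq> N" unfolding pl plane_def by blast
      then have "N \<in> lines_through (L1 \<inter> L2)" using N(1) by (simp add: lines_through_def)
      then show False using th12 N by simp
    qed
    have "normal N = c *s ((a / c) *s n1 + (b / c) *s n2 + n3)"
      using n \<open>c \<noteq> 0\<close> by (simp add: vec3_eq_iff algebra_simps)
    then have "N = D (a / c, b / c)" unfolding D_def prod.case by (rule plane_eq_S[OF N(1)])
    then show "N \<in> D ` P" using N(1) \<open>a \<noteq> 0\<close> \<open>b \<noteq> 0\<close> \<open>c \<noteq> 0\<close> by (auto simp: P_def)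
  next
    fix N assume "N \<in> D ` P"
    then obtain u v where N: "N = D (u, v)" "D (u, v) \<in> S" "u \<noteq> 0" "v \<noteq> 0" by (auto simp: P_def)
    have "pt 1 0 0 \<notin> N" "pt 1 0 0 \<in> L2" "pt 1 0 0 \<in> L3" "pt 0 1 0 \<notin> N" "pt 0 1 0 \<in> L1"
      using N by (simp_all add: mem) (simp_all add: pl plane_def pt_def e)
    then show "N \<in> T" using N by (auto simp: T_def)
  qed
  have injD: "inj D"
  proof
    fix a b assume ab: "D a = D b"
    obtain u v u' v' where st: "a = (u, v)" "b = (u', v')" by (cases a; cases b)
    have "pt 1 0 (- u) \<in> D a" "pt 0 1 (- v) \<in> D a" by (simp_all add: mem st)
    then have "pt 1 0 (- u) \<in> D b" "pt 0 1 (- v) \<in> D b" using ab by simp_all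
    then show "a = b" by (simp add: mem st)
  qed
  have cP: "card P = 9" using cT unfolding T by (simp add: card_image inj_on_subset[OF injD])
  have finP: "finite P" using cP finite_if_card_Suc[of P 8] by simp
  define U where "U = fst ` P"
  define V where "V = snd ` P"
  define W where "W = (\<lambda>(u, v). u / v) ` P"
  have side: "A \<inter> D w \<in> points_of_mult 4 A" if "w \<in> P" "A = L1 \<or> A = L2 \<or> A = L3" for A w
  proof -
    have "D w \<in> T" unfolding T using that(1) by (rule imageI)
    then have N: "D w \<in> S" "D w \<noteq> L1" "D w \<noteq> L2" "D w \<noteq> L3" by (simp_all add: T_def)
    have sw: "num_lines (L2 \<inter> L1) = 2" "num_lines (L3 \<inter> L1) = 2" "num_lines (L3 \<inter> L2) = 2"
      using L(7-9) by (simp_all only: Int_commute[of L2 L1] Int_commute[of L3 L1] Int_commute[of L3 L2])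
    from that(2) consider "A = L1" | "A = L2" | "A = L3" by blast
    then show ?thesis
    proof cases
      case 1
      show ?thesis unfolding 1 by (rule quad_on_side[OF L(1,2,3,4,5,6,7,8) N])
    next
      case 2
      show ?thesis unfolding 2 by (rule quad_on_side[OF L(2,1,3) L(4)[symmetric] L(6,5) sw(1) L(9) N(1,3,2,4)])
    next
      case 3
      show ?thesis unfolding 3 by (rule quad_on_side[OF L(3,1,2) L(5)[symmetric] L(6)[symmetric] L(4) sw(2,3) N(1,4,2,3)])
    qed
  qed
  have three: "card X \<le> 3" if "A \<in> S" "inj_on h X" "h ` X \<subseteq> points_of_mult 4 A" for A X and h :: "complex \<Rightarrow> (complex ^ 3) set"
    using card_inj_on_le[OF that(2,3) finite_points_of_mult] all_hesse_type(2)[OF that(1)] by simp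
  have cV: "card V \<le> 3"
  proof (rule three[OF L(1)])
    let ?h = "\<lambda>v. L1 \<inter> plane (v *s n2 + n3)"
    show "inj_on ?h V"
    proof
      fix v v' assume "?h v = ?h v'"
      moreover have "pt 0 1 (- v) \<in> ?h v" by (simp add: pl plane_def pt_def e)
      ultimately have "pt 0 1 (- v) \<in> ?h v'" by simp
      then show "v = v'" by (simp add: plane_def pt_def e)
    qed
    have "L1 \<inter> D (u, v) = ?h v" for u v by (auto simp: pl D_def plane_def)
    then show "?h ` V \<subseteq> points_of_mult 4 L1" using side by (force simp: V_def)
  qed
  have cU: "card U \<le> 3"
  proof (rule three[OF L(2)])
    let ?h = "\<lambda>u. L2 \<inter> plane (u *s n1 + n3)"
    show "inj_on ?h U"
    proof
      fix v v' assume "?h v = ?h v'"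
      moreover have "pt 1 0 (- v) \<in> ?h v" by (simp add: pl plane_def pt_def e)
      ultimately have "pt 1 0 (- v) \<in> ?h v'" by simp
      then show "v = v'" by (simp add: plane_def pt_def e)
    qed
    have "L2 \<inter> D (u, v) = ?h u" for u v by (auto simp: pl D_def plane_def)
    then show "?h ` U \<subseteq> points_of_mult 4 L2" using side by (force simp: U_def)
  qed
  have cW: "card W \<le> 3"
  proof (rule three[OF L(3)])
    let ?h = "\<lambda>w. L3 \<inter> plane (w *s n1 + n2)"
    show "inj_on ?h W"
    proof
      fix v v' assume "?h v = ?h v'"
      moreover have "pt 1 (- v) 0 \<in> ?h v" by (simp add: pl plane_def pt_def e)
      ultimately have "pt 1 (- v) 0 \<in> ?h v'" by simp
      then show "v = v'" by (simp add: plane_def pt_def e)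
    qed
    have h: "L3 \<inter> D (u, v) = ?h (u / v)" if v: "v \<noteq> 0" for u v
    proof -
      have "y \<in> D (u, v) \<longleftrightarrow> y \<in> plane ((u / v) *s n1 + n2)" if "y \<in> L3" for y
      proof -
        have "u * dot n1 y + v * dot n2 y = v * (u / v * dot n1 y + dot n2 y)"
          using v by (simp add: distrib_left)
        moreover have "dot n3 y = 0" using that by (simp add: pl plane_def)
        ultimately have "dot (u *s n1 + v *s n2 + n3) y = v * dot ((u / v) *s n1 + n2) y" by simp
        then show ?thesis unfolding D_def plane_def prod.case mem_Collect_eq using v by (simp only: mult_eq_0_iff simp_thms)
      qed
      then show ?thesis by blast
    qed
    show "?h ` W \<subseteq> points_of_mult 4 L3"
    proof
      fix r assume "r \<in> ?h ` W"
      then obtain u v where "(u, v) \<in> P" "r = ?h (u / v)" by (auto simp: W_def)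
      moreover from this have "v \<noteq> 0" by (simp add: P_def)
      ultimately show "r \<in> points_of_mult 4 L3" using side[of "(u, v)" L3] h by simp
    qed
  qed
  have fin: "finite U" "finite V" "finite W" using finP by (simp_all add: U_def V_def W_def)
  have sub: "P \<subseteq> U \<times> V" by (force simp: U_def V_def)
  have le: "9 \<le> card U * card V"
    using card_mono[OF _ sub] fin cP by (simp add: card_cartesian_product)
  have "card U * card V \<le> 3 * card V" "card U * card V \<le> card U * 3" using cU cV by simp_all
  then have c3: "card U = 3" "card V = 3" using le cU cV by linarith+
  have PUV: "P = U \<times> V"
    using card_subset_eq[OF _ sub] fin cP c3 by (simp add: card_cartesian_product)
  have nz: "0 \<notin> U" "0 \<notin> V" by (auto simp: U_def V_def P_def)
  have quot: "u / v \<in> W" if "u \<in> U" "v \<in> V" for u v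
  proof -
    have "(u, v) \<in> P" using that PUV by simp
    then show ?thesis by (force simp: W_def)
  qed
  obtain a b where ab: "a \<noteq> 0" "b \<noteq> 0" "\<forall>\<zeta>\<in>cube_roots. a * \<zeta> \<in> U" "\<forall>\<zeta>\<in>cube_roots. b * \<zeta> \<in> V"
    by (rule small_quotient_set[OF c3 nz fin(3) cW quot]) blast
  show ?thesis
  proof (rule that[of "a *s n1" "b *s n2" n3])
    show "det3 (a *s n1) (b *s n2) n3 \<noteq> 0" using ab(1,2) det by simp
    show "plane (a *s n1) \<in> S" "plane (b *s n2) \<in> S" "plane n3 \<in> S" using ab(1,2) L pl by (simp_all add: plane_scale)
    show "\<forall>\<zeta>\<in>cube_roots. \<forall>\<xi>\<in>cube_roots. plane (\<zeta> *s (a *s n1) + \<xi> *s (b *s n2) + n3) \<in> S"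
    proof (intro ballI)
      fix \<zeta> \<xi> assume "\<zeta> \<in> cube_roots" "\<xi> \<in> cube_roots"
      then have "(a * \<zeta>, b * \<xi>) \<in> P" using ab PUV by simp
      then have "D (a * \<zeta>, b * \<xi>) \<in> S" by (simp add: P_def)
      then show "plane (\<zeta> *s (a *s n1) + \<xi> *s (b *s n2) + n3) \<in> S" by (simp add: D_def mult.commute)
    qed
  qed
qed

end

theorem classification_of_lines:
  obtains (fermat) m1 m2 m3 where "det3 m1 m2 m3 \<noteq> 0" "plane m1 \<in> S" "plane m2 \<in> S" "plane m3 \<in> S"
    "\<And>\<zeta>. \<zeta> \<in> cube_roots \<Longrightarrow> plane (m1 - \<zeta> *s m3) \<in> S"
    "\<And>\<zeta>. \<zeta> \<in> cube_roots \<Longrightarrow> plane (m2 - \<zeta> *s m3) \<in> S"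
    "\<And>\<zeta>. \<zeta> \<in> cube_roots \<Longrightarrow> plane (m2 - \<zeta> *s m1) \<in> S"
  | (hesse) m1 m2 m3 where "det3 m1 m2 m3 \<noteq> 0" "plane m1 \<in> S" "plane m2 \<in> S" "plane m3 \<in> S"
    "\<And>\<zeta> \<xi>. \<zeta> \<in> cube_roots \<Longrightarrow> \<xi> \<in> cube_roots \<Longrightarrow> plane (\<zeta> *s m1 + \<xi> *s m2 + m3) \<in> S"
proof (cases "\<exists>L\<in>S. \<not> card (points_of_mult 5 L) \<le> 1")
  case True
  then obtain L where L: "L \<in> S" "\<not> card (points_of_mult 5 L) \<le> 1" by blast
  then obtain p q where "p \<in> points_of_mult 5 L" "q \<in> points_of_mult 5 L" "p \<noteq> q"
    using card_le_Suc0_iff_eq[OF finite_points_of_mult[of 5 L]] by auto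
  then show ?thesis by (rule fermat_type[OF L(1)]) (rule fermat)
next
  case False
  then have few: "card (points_of_mult 5 L) \<le> 1" if "L \<in> S" for L using that by blast
  show ?thesis
  proof (rule hesse_coordinates)
    show "card (points_of_mult 5 L) \<le> 1" if "L \<in> S" for L using few[OF that] .
  next
    fix m1 m2 m3
    assume m: "det3 m1 m2 m3 \<noteq> 0" "plane m1 \<in> S" "plane m2 \<in> S" "plane m3 \<in> S"
      "\<forall>\<zeta>\<in>cube_roots. \<forall>\<xi>\<in>cube_roots. plane (\<zeta> *s m1 + \<xi> *s m2 + m3) \<in> S"
    show ?thesis by (rule hesse[OF m(1-4)]) (use m(5) in blast)
  qed
qed

end

section \<open>Vector fields representing a foliation\<close>

definition coeff_form :: "form3 \<Rightarrow> complex ^ 3 \<Rightarrow> complex ^ 3" where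
  "coeff_form \<omega> v = (case \<omega> of (a, b, c) \<Rightarrow> vector [eval3 a v, eval3 b v, eval3 c v])"

lemma form_at_eq_dot: "form_at \<omega> v w = dot (coeff_form \<omega> v) w"
  by (cases \<omega>) (simp add: form_at_def coeff_form_def dot_def)

definition represents :: "(complex ^ 3 \<Rightarrow> complex ^ 3) \<Rightarrow> form3 \<Rightarrow> bool" where
  "represents Z \<omega> \<longleftrightarrow> (\<forall>i. hompoly 4 (\<lambda>v. Z v $ i)) \<and> (\<forall>v. coeff_form \<omega> v = cross v (Z v))"

lemma represents_vfield: "represents Z \<omega> \<Longrightarrow> vfield Z"
  by unfold_locales (simp add: represents_def)

lemma represents_form_at: "represents Z \<omega> \<Longrightarrow> form_at \<omega> v w = det3 v (Z v) w"
  by (simp add: represents_def form_at_eq_dot det3_def)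

text \<open>
  \<open>Z = - curl \<omega> / 6\<close>, where 6 is the degree of \<open>\<omega>\<close> as a differential form. Each component of \<open>\<omega> = v \<times> Z\<close> follows
  from Euler's identity for that coefficient and one partial derivative of \<open>x a + y b + z c = 0\<close>.
\<close>

lemma vector_field_exists:
  assumes "foliation 4 \<omega>"
  obtains Z where "represents Z \<omega>"
proof -
  obtain a b c where \<omega>: "\<omega> = (a, b, c)" by (cases \<omega>)
  have h: "hompoly 5 (eval3 a)" "hompoly 5 (eval3 b)" "hompoly 5 (eval3 c)"
    and rel: "varX * a + varY * b + varZ * c = 0"
    using assms homogeneous_imp_hompoly[of 5] by (auto simp: foliation_def \<omega>)
  have h': "hompoly (Suc 4) (eval3 a)" "hompoly (Suc 4) (eval3 b)" "hompoly (Suc 4) (eval3 c)"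
    using h by (simp_all add: eval_nat_numeral)
  let ?D = "\<lambda>p v (i::3). dderiv (eval3 p) v (axis i 1)"
  have hD: "hompoly 4 (\<lambda>v. dderiv (eval3 p) v (axis i 1))" if "hompoly (Suc 4) (eval3 p)" for p i
    by (rule hompoly_dderiv[OF that hompoly.const]) simp
  define Z where "Z = (\<lambda>v. vector [(?D b v 3 - ?D c v 2) / 6, (?D c v 1 - ?D a v 3) / 6, (?D a v 2 - ?D b v 1) / 6] :: complex ^ 3)"
  have eu: "5 * eval3 p v = v $ 1 * ?D p v 1 + v $ 2 * ?D p v 2 + v $ 3 * ?D p v 3" if "hompoly 5 (eval3 p)" for p v
  proof -
    have "of_nat 5 * eval3 p v = (\<Sum>i\<in>UNIV. v $ i * ?D p v i)"
      by (rule trans[OF euler_identity[OF that, symmetric] dderiv_axis[OF that]])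
    then show ?thesis unfolding sum_3 by simp
  qed
  have R: "w $ 1 * eval3 a v + v $ 1 * dderiv (eval3 a) v w + (w $ 2 * eval3 b v + v $ 2 * dderiv (eval3 b) v w)
       + (w $ 3 * eval3 c v + v $ 3 * dderiv (eval3 c) v w) = 0" for v w
  proof -
    have z: "(\<lambda>v. (v $ 1 * eval3 a v + v $ 2 * eval3 b v) + v $ 3 * eval3 c v) = (\<lambda>v. 0)"
    proof
      fix v show "(v $ 1 * eval3 a v + v $ 2 * eval3 b v) + v $ 3 * eval3 c v = 0"
        using arg_cong[OF rel, of "\<lambda>p. eval3 p v"] by simp
    qed
    have m: "hompoly 6 (\<lambda>v. v $ i * eval3 p v)" if "hompoly 5 (eval3 p)" for i p
      by (rule hompoly_mult[OF hompoly_coord[OF refl] that]) simp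
    have d: "dderiv (\<lambda>v. v $ i * eval3 p v) v w = v $ i * dderiv (eval3 p) v w + w $ i * eval3 p v" if "hompoly 5 (eval3 p)" for i p
      using dderiv_mult[OF hompoly_coord[OF refl] that, of i] by (simp add: dderiv_coord)
    have "dderiv (\<lambda>v. (v $ 1 * eval3 a v + v $ 2 * eval3 b v) + v $ 3 * eval3 c v) v w = 0"
      unfolding z by (rule dderiv_const)
    then show ?thesis
      unfolding dderiv_plus[OF hompoly.add[OF m[OF h(1)] m[OF h(2)]] m[OF h(3)]] dderiv_plus[OF m[OF h(1)] m[OF h(2)]]
        d[OF h(1)] d[OF h(2)] d[OF h(3)] by (simp only: ac_simps)
  qed
  have "hompoly 4 (\<lambda>v. Z v $ i)" for i
  proof -
    have "hompoly 4 (\<lambda>v. (1 / 6) * (?D b v 3 - ?D c v 2))" "hompoly 4 (\<lambda>v. (1 / 6) * (?D c v 1 - ?D a v 3))"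
      "hompoly 4 (\<lambda>v. (1 / 6) * (?D a v 2 - ?D b v 1))"
      by (intro hompoly_cmult hompoly_diff hD h')+
    then show ?thesis using exhaust_3[of i] by (auto simp: Z_def)
  qed
  moreover have "coeff_form \<omega> v = cross v (Z v)" for v
  proof -
    have ax: "(axis i 1 :: complex ^ 3) $ j = (if j = i then 1 else 0)" for i j by (simp add: axis_def)
    have key: "A = q * ((aq - br) / 6) - r * ((cr - ar) / 6)"
      if "5 * A = p * ap + q * aq + r * ar" "A + p * ap + (q * br) + (r * cr) = 0"
      for A p q r ap aq ar br cr :: complex
    proof -
      have "6 * A = 5 * A - (- A)" by simp
      also have "- A = p * ap + q * br + r * cr" using that(2) by (simp add: minus_unique add.assoc)
      finally have "6 * A = q * (aq - br) - r * (cr - ar)" unfolding that(1) by (simp add: algebra_simps)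
      then show ?thesis by (simp add: field_simps)
    qed
    have "eval3 a v = v $ 2 * ((?D a v 2 - ?D b v 1) / 6) - v $ 3 * ((?D c v 1 - ?D a v 3) / 6)"
      by (rule key[OF eu[OF h(1)]]) (use R[of "axis 1 1" v] in \<open>simp add: ax algebra_simps\<close>)
    moreover have "eval3 b v = v $ 3 * ((?D b v 3 - ?D c v 2) / 6) - v $ 1 * ((?D a v 2 - ?D b v 1) / 6)"
      by (rule key[where p = "v $ 2" and ap = "?D b v 2"])
        (use R[of "axis 2 1" v] eu[OF h(2), of v] in \<open>simp_all add: ax algebra_simps\<close>)
    moreover have "eval3 c v = v $ 1 * ((?D c v 1 - ?D a v 3) / 6) - v $ 2 * ((?D b v 3 - ?D c v 2) / 6)"
      by (rule key[where p = "v $ 3" and ap = "?D c v 3"])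
        (use R[of "axis 3 1" v] eu[OF h(3), of v] in \<open>simp_all add: ax algebra_simps\<close>)
    ultimately show ?thesis by (simp add: vec3_eq_iff coeff_form_def \<omega> Z_def)
  qed
  ultimately show ?thesis using that[of Z] by (simp add: represents_def)
qed

lemma invariant_line_iff:
  assumes "represents Z \<omega>"
  shows "invariant_line \<omega> L \<longleftrightarrow> vfield.inv_line Z L"
proof -
  interpret vfield Z by (rule represents_vfield[OF assms])
  show ?thesis
  proof
    assume "inv_line L"
    then have p: "proj_line L" "\<And>v. v \<in> L \<Longrightarrow> Z v \<in> L" by (auto simp: inv_line_def)
    then show "invariant_line \<omega> L"
      using det3_in_plane[OF normal_nonzero[OF p(1)]]
      by (simp add: invariant_line_def represents_form_at[OF assms] plane_normal)
  next
    assume i: "invariant_line \<omega> L"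
    then have p: "proj_line L" by (simp add: invariant_line_def)
    have "Z v \<in> L" if v: "v \<in> L" for v
    proof (cases "v = 0")
      case True
      have "Z 0 = 0" using Z_scale[of 0 0] by simp
      then show ?thesis using True v by simp
    next
      case False
      obtain w where w: "w \<in> L" "cross v w \<noteq> 0"
        using plane_complete[OF normal_nonzero[OF p], of v] v False unfolding plane_normal[OF p] by auto
      have "det3 v (Z v) w = 0" using i v w(1) by (simp add: invariant_line_def represents_form_at[OF assms])
      then have "det3 v w (Z v) = 0" using det3_swap(2)[of v w "Z v"] by simp
      then show ?thesis using plane_eq_span(2)[OF normal_nonzero[OF p] _ _ w(2)] v w(1) unfolding plane_normal[OF p] by simp
    qed
    then show "inv_line L" using p by (simp add: inv_line_def)
  qed
qed

section \<open>Linear factors\<close>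

definition linear_poly :: "complex ^ 3 \<Rightarrow> poly3" where
  "linear_poly n = [:[:[:0, n $ 1:], [:n $ 2:]:], [:[:n $ 3:]:]:]"

lemma eval3_linear_poly: "eval3 (linear_poly n) v = dot n v"
  by (simp add: eval3_def linear_poly_def dot_def algebra_simps)

lemma eval3_pCons: "eval3 (pCons c p) v = poly (poly c [:v $ 2:]) (v $ 1) + v $ 3 * eval3 p v"
  by (simp add: eval3_def)

lemma eval3_subst_z:
  "poly (poly (poly p r) [:y:]) x = eval3 p (vector [x, y, poly (poly r [:y:]) x])"
  by (induction p) (simp_all add: eval3_pCons)

lemma eval3_zero_in_z:
  assumes "\<And>z. eval3 p (vector [x, y, z]) = 0"
  shows "poly (poly (coeff p k) [:y:]) x = 0"
proof -
  have e: "eval3 p (vector [x, y, z]) = poly (map_poly (\<lambda>c. poly (poly c [:y:]) x) p) z" for z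
    by (induction p) (simp_all add: eval3_pCons map_poly_pCons)
  have "\<forall>z. poly (map_poly (\<lambda>c. poly (poly c [:y:]) x) p) z = 0" unfolding e[symmetric] using assms by blast
  then have "map_poly (\<lambda>c. poly (poly c [:y:]) x) p = 0" using poly_all_0_iff_0 by blast
  then have "coeff (map_poly (\<lambda>c. poly (poly c [:y:]) x) p) k = 0" by simp
  then show ?thesis by (simp add: coeff_map_poly)
qed

lemma poly2_zero_in_y:
  fixes c :: poly2
  assumes "\<And>y. poly (poly c [:y:]) x = 0"
  shows "poly (coeff c j) x = 0"
proof -
  have e: "poly (poly c [:y:]) x = poly (map_poly (\<lambda>a. poly a x) c) y" for y
    by (induction c) (simp_all add: map_poly_pCons)
  have "\<forall>y. poly (map_poly (\<lambda>a. poly a x) c) y = 0" unfolding e[symmetric] using assms by blast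
  then have "map_poly (\<lambda>a. poly a x) c = 0" using poly_all_0_iff_0 by blast
  then have "coeff (map_poly (\<lambda>a. poly a x) c) j = 0" by simp
  then show ?thesis by (simp add: coeff_map_poly)
qed

lemma dvd_constant_multiple: "[:c:] * q dvd p \<Longrightarrow> q dvd p" for p :: "'a::comm_semiring_1 poly"
  by (metis dvd_mult_right)

text \<open>
  Eliminate the last variable that occurs in the linear form and apply the factor theorem with respect to that
  variable, coefficientwise in the variables after it.
\<close>

lemma linear_factor:
  assumes "n \<noteq> 0" "\<And>v. v \<in> plane n \<Longrightarrow> eval3 p v = 0"
  shows "linear_poly n dvd p"
proof -
  consider "n $ 3 \<noteq> 0" | "n $ 3 = 0" "n $ 2 \<noteq> 0" | "n $ 3 = 0" "n $ 2 = 0" "n $ 1 \<noteq> 0"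
    using assms(1) by (auto simp: vec3_eq_iff)
  then show ?thesis
  proof cases
    case 1
    define r :: poly2 where "r = [:[:0, - n $ 1 / n $ 3:], [:- n $ 2 / n $ 3:]:]"
    have "poly (poly (poly p r) [:y:]) x = 0" for x y
      unfolding eval3_subst_z by (rule assms(2)) (use 1 in \<open>simp add: plane_def dot_def r_def field_simps\<close>)
    then have "poly (poly p r) [:y:] = 0" for y using poly_all_0_iff_0 by blast
    then have "poly (coeff (poly p r) j) x = 0" for j x by (intro poly2_zero_in_y) simp
    then have "coeff (poly p r) j = 0" for j using poly_all_0_iff_0 by blast
    then have "poly p r = 0" by (simp add: poly_eq_iff)
    then have "[:- r, 1:] dvd p" by (simp add: poly_eq_0_iff_dvd)
    moreover have "[:- r, 1:] = [:[:[:1 / n $ 3:]:]:] * linear_poly n"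
      using 1 by (simp add: r_def linear_poly_def one_pCons)
    ultimately have "[:[:[:1 / n $ 3:]:]:] * linear_poly n dvd p" by simp
    then show ?thesis by (rule dvd_constant_multiple)
  next
    case 2
    define r :: "complex poly" where "r = [:0, - n $ 1 / n $ 2:]"
    have dvd: "[:[:0, n $ 1:], [:n $ 2:]:] dvd coeff p k" for k
    proof -
      have sub: "poly (poly c r) x = poly (poly c [:poly r x:]) x" for c :: poly2 and x
        by (induction c) simp_all
      have "poly (poly (coeff p k) [:poly r x:]) x = 0" for x
        by (rule eval3_zero_in_z, rule assms(2)) (use 2 in \<open>simp add: plane_def dot_def r_def field_simps\<close>)
      then have "poly (coeff p k) r = 0" unfolding sub[symmetric] using poly_all_0_iff_0 by blast
      then have "[:- r, 1:] dvd coeff p k" by (simp add: poly_eq_0_iff_dvd)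
      moreover have "[:- r, 1:] = [:[:1 / n $ 2:]:] * [:[:0, n $ 1:], [:n $ 2:]:]"
        using 2 by (simp add: r_def one_pCons)
      ultimately have "[:[:1 / n $ 2:]:] * [:[:0, n $ 1:], [:n $ 2:]:] dvd coeff p k" by simp
      then show ?thesis by (rule dvd_constant_multiple)
    qed
    then show ?thesis using 2 by (simp add: linear_poly_def const_poly_dvd_iff)
  next
    case 3
    have dvd: "[:0, n $ 1:] dvd coeff (coeff p k) j" for k j
    proof -
      have "poly (coeff (coeff p k) j) 0 = 0"
        by (rule poly2_zero_in_y, rule eval3_zero_in_z, rule assms(2)) (use 3 in \<open>simp add: plane_def dot_def\<close>)
      then have "[:0, 1:] dvd coeff (coeff p k) j" using poly_eq_0_iff_dvd[of "coeff (coeff p k) j" 0] by simp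
      moreover have "[:0, 1:] = [:1 / n $ 1:] * [:0, n $ 1:]" using 3 by simp
      ultimately have "[:1 / n $ 1:] * [:0, n $ 1:] dvd coeff (coeff p k) j" by simp
      then show ?thesis by (rule dvd_constant_multiple)
    qed
    then show ?thesis using 3 by (simp add: linear_poly_def const_poly_dvd_iff)
  qed
qed

text \<open>
  Otherwise the equation of the line would be a common factor of the coefficients.
\<close>

lemma foliation_nonvanishing:
  assumes "foliation d \<omega>" "proj_line L"
  shows "\<exists>v\<in>L. coeff_form \<omega> v \<noteq> 0"
proof (rule ccontr)
  assume *: "\<not> ?thesis"
  obtain a b c where \<omega>: "\<omega> = (a, b, c)" by (cases \<omega>)
  let ?q = "linear_poly (normal L)"
  have "eval3 a v = 0 \<and> eval3 b v = 0 \<and> eval3 c v = 0" if "v \<in> plane (normal L)" for v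
    using * that unfolding plane_normal[OF assms(2)] by (auto simp: coeff_form_def \<omega> vec3_eq_iff)
  then have "?q dvd a \<and> ?q dvd b \<and> ?q dvd c"
    using linear_factor[OF normal_nonzero[OF assms(2)]] by blast
  then have "is_unit ?q" using assms(1) by (auto simp: foliation_def \<omega>)
  then obtain r where "1 = ?q * r" by (auto elim: dvdE)
  then have "eval3 1 0 = eval3 ?q 0 * eval3 r 0" by (metis eval3_simps(4))
  then show False by (simp add: eval3_linear_poly)
qed

lemma reduced_convex_convex4:
  assumes "reduced_convex 4 \<omega>" "represents Z \<omega>"
  shows "convex4 Z"
proof -
  interpret vfield Z by (rule represents_vfield[OF assms(2)])
  show ?thesis
  proof
    show "card {L. inv_line L} = 12"
      using assms(1) by (simp add: reduced_convex_def invariant_line_iff[OF assms(2)])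
    show "\<exists>v\<in>L. cross v (Z v) \<noteq> 0" if "proj_line L" for L
      using foliation_nonvanishing[of 4 \<omega>] assms that by (simp add: reduced_convex_def represents_def)
  qed
qed

section \<open>A foliation is determined by its invariant lines\<close>

lemma dvd_if_proportional:
  fixes a b c a' b' c' :: poly3
  assumes "a * b' = b * a'" "a * c' = c * a'" "\<forall>g. g dvd a \<and> g dvd b \<and> g dvd c \<longrightarrow> is_unit g"
  shows "a dvd a'"
proof -
  have "is_unit (gcd a (gcd b c))" using assms(3) by (meson dvd_trans gcd_dvd1 gcd_dvd2)
  have "a dvd gcd (a' * a) (gcd (a' * b) (a' * c))"
    using assms(1,2) by (metis dvd_triv_left gcd_greatest mult.commute)
  also have "gcd (a' * a) (gcd (a' * b) (a' * c)) = normalize (a' * gcd a (gcd b c))"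
    by (simp add: gcd_mult_left)
  finally have "a dvd a' * gcd a (gcd b c)" by simp
  then show ?thesis using \<open>is_unit (gcd a (gcd b c))\<close> by (simp only: dvd_mult_unit_iff)
qed

lemma polyfn_eval3: "(\<And>i. polyfn (\<lambda>t. v t $ i)) \<Longrightarrow> polyfn (\<lambda>t. eval3 p (v t))"
proof (induction p)
  case 0
  show ?case by (simp add: polyfn_const)
next
  case (pCons c p)
  note v = pCons.prems
  have 1: "polyfn (\<lambda>t. poly a (v t $ 1))" for a
    by (induction a) (simp_all only: poly_0 poly_pCons polyfn_const polyfn_add polyfn_mult v)
  have 2: "polyfn (\<lambda>t. poly (poly c [:v t $ 2:]) (v t $ 1))"
    by (induction c) (simp_all add: polyfn_const polyfn_add polyfn_mult v 1)
  show ?case unfolding eval3_pCons using pCons by (intro polyfn_add polyfn_mult 2) auto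
qed

text \<open>
  The values of \<open>g\<close> are constant along the rays on which \<open>a\<close> does not vanish, hence equal to the value at
  the origin.
\<close>

lemma quotient_constant:
  assumes "hompoly n (eval3 a)" "hompoly n (eval3 (a * g))" "a \<noteq> 0"
  obtains k where "g = [:[:[:k:]:]:]"
proof -
  define k where "k = eval3 g 0"
  have "eval3 ((g - [:[:[:k:]:]:]) * a) v = 0" for v
  proof (cases "eval3 a v = 0")
    case False
    have "polyfn (\<lambda>t. eval3 g (t *s v))" by (rule polyfn_eval3) (simp add: polyfn_intros)
    then have "t * eval3 g (t *s v) = t * eval3 g v" for t
      using hompoly_scale[OF assms(1), of t v] hompoly_scale[OF assms(2), of t v] False
      by (cases "t = 0") auto
    then have "eval3 g (0 *s v) = eval3 g v"
      using polyfn_cancel_power[of "\<lambda>t. eval3 g (t *s v)" "\<lambda>t. eval3 g v" 1 0]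
        \<open>polyfn (\<lambda>t. eval3 g (t *s v))\<close> polyfn_const by simp
    then show ?thesis by (simp add: k_def)
  qed simp
  then have "(g - [:[:[:k:]:]:]) * a = 0" by (rule eval3_eq_0_imp)
  then have "g = [:[:[:k:]:]:]" using assms(3) by simp
  then show ?thesis by (rule that)
qed

text \<open>
  Pull \<open>\<omega>\<close> back by the inverse \<open>A\<close> of the matrix with rows \<open>m1, m2, m3\<close>. On each of the 12 common invariant lines
  both forms are multiples of the equation of the line, so the components of their cross product are
  forms of degree 10 that vanish on 12 lines. Thus the forms are proportional over the field of rational
  functions, and since \<open>\<omega>0\<close> has no common factor, the proportionality factor is a polynomial, of degree 0.
\<close>

lemma foliation_unique:
  assumes fol: "foliation 4 \<omega>0" and nz: "fst \<omega>0 \<noteq> 0" and rep: "represents Z0 \<omega>0"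
    and con: "reduced_convex 4 \<omega>" and repw: "represents Z \<omega>"
    and det: "det3 m1 m2 m3 \<noteq> 0"
    and N: "finite N" "card N = 12" "inj_on plane N" "\<And>n. n \<in> N \<Longrightarrow> n \<noteq> 0"
      "\<And>n. n \<in> N \<Longrightarrow> vfield.inv_line Z0 (plane n)"
      "\<And>n. n \<in> N \<Longrightarrow> vfield.inv_line Z (plane (n $ 1 *s m1 + n $ 2 *s m2 + n $ 3 *s m3))"
  shows "foliation_iso \<omega> \<omega>0"
proof -
  obtain a b c where \<omega>0: "\<omega>0 = (a, b, c)" by (cases \<omega>0)
  define B :: "complex ^ 3 ^ 3" where "B = vector [m1, m2, m3]"
  have Bv: "B *v v = vector [dot m1 v, dot m2 v, dot m3 v]" for v
    by (simp add: vec3_eq_iff B_def matrix_vector_mult_def dot_def sum_3)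
  have "det B = det3 m1 m2 m3"
    by (simp add: det_3 B_def det3_def dot_def algebra_simps)
  then have invB: "invertible B" using det invertible_det_nz by metis
  then obtain A where A: "B ** A = mat 1" "A ** B = mat 1" unfolding invertible_def by blast
  have invA: "invertible A" using A unfolding invertible_def by blast
  have BA: "B *v (A *v v) = v" for v by (simp add: matrix_vector_mul_assoc A)
  have AB: "A *v (B *v v) = v" for v by (simp add: matrix_vector_mul_assoc A)
  have mA: "dot m1 (A *v v) = v $ 1" "dot m2 (A *v v) = v $ 2" "dot m3 (A *v v) = v $ 3" for v
    using BA[of v] unfolding Bv by (simp_all add: vec3_eq_iff)
  interpret W: convex4 Z by (rule reduced_convex_convex4[OF con repw])
  interpret W0: vfield Z0 by (rule represents_vfield[OF rep])
  define F where "F = (\<lambda>v. cross v (Z v))"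
  define F0 where "F0 = (\<lambda>v. cross v (Z0 v))"
  have F: "form_at \<omega> v w = dot (F v) w" "form_at \<omega>0 v w = dot (F0 v) w" for v w
    using rep repw by (simp_all add: form_at_eq_dot represents_def F_def F0_def)
  have F0e: "F0 v = vector [eval3 a v, eval3 b v, eval3 c v]" for v
    using rep by (simp add: represents_def F0_def coeff_form_def \<omega>0)
  define G where "G = (\<lambda>v. transpose A *v F (A *v v))"
  have G: "dot (G v) w = form_at \<omega> (A *v v) (A *v w)" for v w
    by (simp add: F G_def dot_def matrix_vector_mult_def transpose_def sum_3 algebra_simps)
  have hF: "hompoly 5 (\<lambda>v. F v $ i)" for i
    using exhaust_3[of i] unfolding F_def
    by (auto intro!: hompoly_diff hompoly_mult[where n=1 and m=4] hompoly_coord W.hpZ)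
  have hF0: "hompoly 5 (\<lambda>v. F0 v $ i)" for i
    using exhaust_3[of i] unfolding F0_def
    by (auto intro!: hompoly_diff hompoly_mult[where n=1 and m=4] hompoly_coord W0.hpZ)
  have hG: "hompoly 5 (\<lambda>v. G v $ i)" for i
    unfolding G_def matrix_vector_mult_def[of "transpose A"] vec_lambda_beta
    by (intro hompoly_sum hompoly_cmult hompoly_linear_comp[OF hF])
  have "cross (F0 v) (G v) $ i = 0" for v i
  proof (rule zero_if_many_lines[where S = "plane ` N" and n = 10 and f = "\<lambda>v. cross (F0 v) (G v) $ i"])
    show "finite (plane ` N)" using N(1) by simp
    show "10 < card (plane ` N)" using N(2,3) by (simp add: card_image)
    show "proj_line L" if "L \<in> plane ` N" for L using that N(4) proj_line_plane by blast
    show "hompoly 10 (\<lambda>v. cross (F0 v) (G v) $ i)"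
      using exhaust_3[of i] by (auto intro!: hompoly_diff hompoly_mult[where n=5 and m=5] hF0 hG)
    fix L v assume "L \<in> plane ` N" "v \<in> L"
    then obtain n where n: "n \<in> N" "v \<in> plane n" by blast
    have 0: "dot (F0 v) w = 0" if "w \<in> plane n" for w
    proof -
      have "invariant_line \<omega>0 (plane n)" using N(5)[OF n(1)] invariant_line_iff[OF rep] by simp
      then show ?thesis using n(2) that F(2) by (simp add: invariant_line_def)
    qed
    let ?M = "plane (n $ 1 *s m1 + n $ 2 *s m2 + n $ 3 *s m3)"
    have AM: "A *v w \<in> ?M" if "w \<in> plane n" for w
      using that by (simp add: plane_def mA) (simp add: dot_def)
    have 1: "dot (G v) w = 0" if "w \<in> plane n" for w
    proof -
      have "invariant_line \<omega> ?M" using N(6)[OF n(1)] invariant_line_iff[OF repw] by simp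
      then show ?thesis using AM[OF n(2)] AM[OF that] by (simp add: invariant_line_def G)
    qed
    obtain x where x: "F0 v = x *s n" using plane_subset_imp[OF N(4)[OF n(1)], of "F0 v"] 0 by (auto simp: plane_def)
    obtain y where y: "G v = y *s n" using plane_subset_imp[OF N(4)[OF n(1)], of "G v"] 1 by (auto simp: plane_def)
    have "cross (F0 v) (G v) = 0" unfolding x y by (simp add: vec3_eq_iff)
    then show "cross (F0 v) (G v) $ i = 0" by simp
  qed
  then have cr: "cross (F0 v) (G v) = 0" for v by (simp add: vec_eq_iff)
  have ex: "\<exists>p. (\<lambda>v. G v $ i) = eval3 p" for i by (rule hompoly_imp_eval3[OF hG])
  obtain a' where a': "(\<lambda>v. G v $ 1) = eval3 a'" using ex by blast
  obtain b' where b': "(\<lambda>v. G v $ 2) = eval3 b'" using ex by blast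
  obtain c' where c': "(\<lambda>v. G v $ 3) = eval3 c'" using ex by blast
  have Ge: "G v $ 1 = eval3 a' v" "G v $ 2 = eval3 b' v" "G v $ 3 = eval3 c' v" for v
    using fun_cong[OF a', of v] fun_cong[OF b', of v] fun_cong[OF c', of v] by simp_all
  have ab: "a * b' = b * a'" "a * c' = c * a'"
    using cr by (auto intro!: eval3_inject simp: vec3_eq_iff F0e Ge)
  have "a dvd a'"
    by (rule dvd_if_proportional[OF ab]) (use fol in \<open>simp add: foliation_def \<omega>0\<close>)
  then obtain g where g: "a' = a * g" by (auto elim: dvdE)
  have a0: "a \<noteq> 0" using nz by (simp add: \<omega>0)
  have "hompoly 5 (eval3 a)" using hF0[of 1] by (simp add: F0e)
  moreover have "hompoly 5 (eval3 (a * g))" using hG[of 1] unfolding g[symmetric] a' .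
  ultimately obtain k where k: "g = [:[:[:k:]:]:]" using quotient_constant a0 by blast
  have "a * b' = a * (b * g)" "a * c' = a * (c * g)" using ab by (simp_all add: g mult_ac)
  then have bc: "b' = b * g" "c' = c * g" using a0 by simp_all
  have GF: "G v = k *s F0 v" for v
    by (simp add: vec3_eq_iff F0e Ge g bc k del: mult_pCons_right)
  have "k \<noteq> 0"
  proof
    assume "k = 0"
    then have G0: "G v = 0" for v using GF by simp
    have "F u = 0" for u
    proof (rule dot_eq_0_all)
      fix w
      show "dot (F u) w = 0" using G[of "B *v u" "B *v w"] by (simp add: AB G0 F(1))
    qed
    moreover have "proj_line (plane (vector [1, 0, 0]))" by (rule proj_line_plane) (simp add: vec3_eq_iff)
    ultimately show False using W.nonvanishing unfolding F_def by blast
  qed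
  have "form_at \<omega>0 v w = (1 / k) * form_at \<omega> (A *v v) (A *v w)" for v w
    using \<open>k \<noteq> 0\<close> by (simp add: G[symmetric] GF F(2))
  then show ?thesis unfolding foliation_iso_def using invA \<open>k \<noteq> 0\<close> by (intro exI[of _ A] exI[of _ "1 / k"]) auto
qed

section \<open>The invariant lines of the two models\<close>

text \<open>
  The upper bound comes from the degree of the extactic polynomial, once it is known to be nonzero at a single point.
\<close>
lemma vfield_invariant_lines_card:
  assumes "vfield Z" "vfield.extactic Z u \<noteq> 0" "finite N" "card N = 12" "inj_on plane N"
    "\<And>n. n \<in> N \<Longrightarrow> n \<noteq> 0" "\<And>n v. n \<in> N \<Longrightarrow> v \<in> plane n \<Longrightarrow> Z v \<in> plane n"
  shows "card {L. vfield.inv_line Z L} = 12" "\<And>n. n \<in> N \<Longrightarrow> vfield.inv_line Z (plane n)"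
proof -
  interpret vfield Z by fact
  have le: "card T \<le> 12" if T: "finite T" "T \<subseteq> {L. inv_line L}" for T
  proof (rule ccontr)
    assume "\<not> card T \<le> 12"
    then have "12 < card T" by simp
    have "extactic u = 0"
    proof (rule zero_if_many_lines[OF T(1) _ hompoly_extactic \<open>12 < card T\<close>])
      show "proj_line L" if "L \<in> T" for L using that T(2) inv_line_proj by blast
      show "extactic v = 0" if "L \<in> T" "v \<in> L" for L v using that T(2) extactic_invariant by blast
    qed
    then show False using assms(2) by simp
  qed
  have fin: "finite {L. inv_line L}"
  proof (rule ccontr)
    assume "infinite {L. inv_line L}"
    then obtain T where "T \<subseteq> {L. inv_line L}" "finite T" "card T = 13" using infinite_arbitrarily_large by blast
    then show False using le[of T] by simp
  qed
  show inv: "inv_line (plane n)" if "n \<in> N" for n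
    using assms(6,7)[OF that] by (simp add: inv_line_def proj_line_plane)
  have "card (plane ` N) \<le> card {L. inv_line L}" by (rule card_mono[OF fin]) (use inv in auto)
  then have "12 \<le> card {L. inv_line L}" using assms(4,5) by (simp add: card_image)
  then show "card {L. inv_line L} = 12" using le[OF fin] by simp
qed

text \<open>
  The first nonzero coordinate, in the order \<open>i, j, k\<close>, is 1. It picks one normal vector for each plane.
\<close>

definition normalized :: "3 \<Rightarrow> 3 \<Rightarrow> 3 \<Rightarrow> complex ^ 3 \<Rightarrow> bool" where
  "normalized i j k n \<longleftrightarrow> n $ i = 1 \<or> n $ i = 0 \<and> (n $ j = 1 \<or> n $ j = 0 \<and> n $ k = 1)"

lemma inj_on_plane_normalized:
  assumes "\<And>n. n \<in> N \<Longrightarrow> normalized i j k n"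
  shows "inj_on plane N"
proof
  fix n m assume nm: "n \<in> N" "m \<in> N" "plane n = plane m"
  have "n \<noteq> 0" using assms[OF nm(1)] by (auto simp: normalized_def)
  then obtain c where c: "m = c *s n" using plane_subset_imp[of n m] nm(3) by blast
  have "c = 1" using assms[OF nm(1)] assms[OF nm(2)] unfolding c normalized_def by auto
  then show "n = m" using c by simp
qed

text \<open>
  The lines \<open>x y z (x\<^sup>3 - z\<^sup>3) (y\<^sup>3 - z\<^sup>3) (y\<^sup>3 - x\<^sup>3) = 0\<close>.
\<close>

definition fermat_normals :: "(complex ^ 3) set" where
  "fermat_normals = {vector [1, 0, 0], vector [0, 1, 0], vector [0, 0, 1]} \<union>
     ((\<lambda>\<zeta>. vector [1, 0, - \<zeta>]) ` cube_roots \<union> ((\<lambda>\<zeta>. vector [0, 1, - \<zeta>]) ` cube_roots \<union>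
      (\<lambda>\<zeta>. vector [- \<zeta>, 1, 0]) ` cube_roots))"

text \<open>
  The four triangles of the Hesse pencil: the coordinate triangle, and the nine lines \<open>\<zeta> x + \<xi> y + z = 0\<close>.
\<close>

definition hesse_normals :: "(complex ^ 3) set" where
  "hesse_normals = {vector [1, 0, 0], vector [0, 1, 0], vector [0, 0, 1]} \<union>
     (\<lambda>(\<zeta>, \<xi>). vector [\<zeta>, \<xi>, 1]) ` (cube_roots \<times> cube_roots)"

lemma card_coordinate_normals: "card {vector [1, 0, 0], vector [0, 1, 0], vector [0, 0, 1] :: complex ^ 3} = 3"
  by (simp add: vec3_eq_iff)

lemma fermat_normals:
  "finite fermat_normals" "card fermat_normals = 12" "inj_on plane fermat_normals" "n \<in> fermat_normals \<Longrightarrow> n \<noteq> 0"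
proof -
  note fin = finite_cube_roots
  show "finite fermat_normals" using fin by (simp add: fermat_normals_def)
  have i: "card ((\<lambda>\<zeta>. vector [1, 0, - \<zeta>] :: complex ^ 3) ` cube_roots) = 3"
    "card ((\<lambda>\<zeta>. vector [0, 1, - \<zeta>] :: complex ^ 3) ` cube_roots) = 3"
    "card ((\<lambda>\<zeta>. vector [- \<zeta>, 1, 0] :: complex ^ 3) ` cube_roots) = 3"
    by (subst card_image; simp add: inj_on_def vec3_eq_iff card_cube_roots)+
  show "card fermat_normals = 12"
    unfolding fermat_normals_def
    by (subst card_Un_disjoint, simp_all add: fin,
        use cube_roots_nonzero in \<open>fastforce simp: vec3_eq_iff\<close>,
        subst card_Un_disjoint, simp_all add: fin,
        use cube_roots_nonzero in \<open>fastforce simp: vec3_eq_iff\<close>,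
        subst card_Un_disjoint, simp_all add: fin i card_coordinate_normals,
        use cube_roots_nonzero in \<open>fastforce simp: vec3_eq_iff\<close>)
  show "inj_on plane fermat_normals"
    by (rule inj_on_plane_normalized[of _ 2 1 3]) (auto simp: fermat_normals_def normalized_def)
  show "n \<noteq> 0" if "n \<in> fermat_normals" using that by (auto simp: fermat_normals_def vec3_eq_iff)
qed

lemma hesse_normals:
  "finite hesse_normals" "card hesse_normals = 12" "inj_on plane hesse_normals" "n \<in> hesse_normals \<Longrightarrow> n \<noteq> 0"
proof -
  note fin = finite_cube_roots
  show "finite hesse_normals" using fin by (simp add: hesse_normals_def)
  have i: "card ((\<lambda>(\<zeta>, \<xi>). vector [\<zeta>, \<xi>, 1] :: complex ^ 3) ` (cube_roots \<times> cube_roots)) = 9"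
    by (subst card_image) (auto simp: inj_on_def vec3_eq_iff card_cube_roots card_cartesian_product)
  show "card hesse_normals = 12"
    unfolding hesse_normals_def
    by (subst card_Un_disjoint, simp_all add: fin i card_coordinate_normals,
        use cube_roots_nonzero in \<open>fastforce simp: vec3_eq_iff\<close>)
  show "inj_on plane hesse_normals"
    by (rule inj_on_plane_normalized[of _ 3 1 2]) (auto simp: hesse_normals_def normalized_def)
  show "n \<noteq> 0" if "n \<in> hesse_normals" using that by (auto simp: hesse_normals_def vec3_eq_iff)
qed

definition fermat_field :: "complex ^ 3 \<Rightarrow> complex ^ 3" where
  "fermat_field v = vector [(v $ 1) ^ 4, (v $ 2) ^ 4, (v $ 3) ^ 4]"

definition hesse_field :: "complex ^ 3 \<Rightarrow> complex ^ 3" where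
  "hesse_field v = vector [v $ 1 * ((v $ 2) ^ 3 - (v $ 3) ^ 3), v $ 2 * ((v $ 3) ^ 3 - (v $ 1) ^ 3),
     v $ 3 * ((v $ 1) ^ 3 - (v $ 2) ^ 3)]"

lemma hompoly_fermat_field: "hompoly 4 (\<lambda>v. fermat_field v $ i)"
  using exhaust_3[of i] by (auto simp: fermat_field_def intro!: hompoly_power[OF hompoly_coord[OF refl]])

lemma hompoly_hesse_field: "hompoly 4 (\<lambda>v. hesse_field v $ i)"
  using exhaust_3[of i]
  by (auto simp: hesse_field_def intro!: hompoly_mult[where n=1 and m=3] hompoly_coord hompoly_diff hompoly_power[OF hompoly_coord[OF refl]])

interpretation fermat: vfield fermat_field by unfold_locales (rule hompoly_fermat_field)
interpretation hesse: vfield hesse_field by unfold_locales (rule hompoly_hesse_field)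

lemma dderiv_coord_power:
  "dderiv (\<lambda>v. v $ i ^ 4) v w = 4 * v $ i ^ 3 * w $ i" "dderiv (\<lambda>v. v $ i ^ 3) v w = 3 * v $ i ^ 2 * w $ i"
  using dderiv_power[OF hompoly_coord[OF refl], of i 3 v w] dderiv_power[OF hompoly_coord[OF refl], of i 2 v w]
  by (simp_all add: dderiv_coord eval_nat_numeral)

lemma fermat_extactic: "fermat.extactic (vector [1, 2, 3]) \<noteq> 0"
proof -
  have D: "fermat.DZ v w = vector [4 * v $ 1 ^ 3 * w $ 1, 4 * v $ 2 ^ 3 * w $ 2, 4 * v $ 3 ^ 3 * w $ 3]" for v w
    by (simp add: vec3_eq_iff fermat.DZ_def fermat_field_def dderiv_coord_power)
  show ?thesis unfolding fermat.extactic_def D by (simp add: det3_def dot_def fermat_field_def)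
qed

lemma hesse_extactic: "hesse.extactic (vector [1, 2, 3]) \<noteq> 0"
proof -
  have p: "hompoly 3 (\<lambda>v. v $ i ^ 3)" for i by (rule hompoly_power[OF hompoly_coord[OF refl]]) simp
  have d: "dderiv (\<lambda>v. v $ i * (v $ j ^ 3 - v $ k ^ 3)) v w =
      v $ i * (3 * v $ j ^ 2 * w $ j - 3 * v $ k ^ 2 * w $ k) + w $ i * (v $ j ^ 3 - v $ k ^ 3)" for i j k v w
    using dderiv_mult[OF hompoly_coord[OF refl] hompoly_diff[OF p p], of i j k v w]
    by (simp add: dderiv_coord dderiv_diff[OF p p] dderiv_coord_power)
  have D: "hesse.DZ v w = vector [v $ 1 * (3 * v $ 2 ^ 2 * w $ 2 - 3 * v $ 3 ^ 2 * w $ 3) + w $ 1 * (v $ 2 ^ 3 - v $ 3 ^ 3),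
     v $ 2 * (3 * v $ 3 ^ 2 * w $ 3 - 3 * v $ 1 ^ 2 * w $ 1) + w $ 2 * (v $ 3 ^ 3 - v $ 1 ^ 3),
     v $ 3 * (3 * v $ 1 ^ 2 * w $ 1 - 3 * v $ 2 ^ 2 * w $ 2) + w $ 3 * (v $ 1 ^ 3 - v $ 2 ^ 3)]" for v w
    by (simp add: vec3_eq_iff hesse.DZ_def hesse_field_def d)
  show ?thesis unfolding hesse.extactic_def D by (simp add: det3_def dot_def hesse_field_def)
qed

lemma cube_root_power4: "\<zeta> \<in> cube_roots \<Longrightarrow> \<zeta> ^ 4 = \<zeta>"
  by (simp add: cube_roots_def eval_nat_numeral)

lemma fermat_field_invariant:
  assumes "n \<in> fermat_normals" "v \<in> plane n"
  shows "fermat_field v \<in> plane n"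
proof -
  have root: "x ^ 4 - \<zeta> * z ^ 4 = 0" if "\<zeta> \<in> cube_roots" "x - \<zeta> * z = 0" for \<zeta> x z :: complex
    using that cube_root_power4[OF that(1)] by (simp add: power_mult_distrib)
  show ?thesis
    using assms root by (auto simp: fermat_normals_def plane_def dot_def fermat_field_def algebra_simps)
qed

lemma hesse_field_invariant:
  assumes "n \<in> hesse_normals" "v \<in> plane n"
  shows "hesse_field v \<in> plane n"
proof -
  have root: "\<zeta> * (x * (y ^ 3 - z ^ 3)) + \<xi> * (y * (z ^ 3 - x ^ 3)) + z * (x ^ 3 - y ^ 3) = 0"
    if "\<zeta> \<in> cube_roots" "\<xi> \<in> cube_roots" "\<zeta> * x + \<xi> * y + z = 0" for \<zeta> \<xi> x y z :: complex
  proof -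
    have cubes: "x ^ 3 = (\<zeta> * x) ^ 3" "y ^ 3 = (\<xi> * y) ^ 3"
      using that(1,2) by (simp_all add: cube_roots_def power_mult_distrib)
    have factors: "X * (Y ^ 3 - z ^ 3) + Y * (z ^ 3 - X ^ 3) + z * (X ^ 3 - Y ^ 3) =
       (X + Y + z) * (- ((X - Y) * (Y - z) * (X - z)))" for X Y z :: complex
      by algebra
    have "\<zeta> * (x * (y ^ 3 - z ^ 3)) + \<xi> * (y * (z ^ 3 - x ^ 3)) + z * (x ^ 3 - y ^ 3) =
      (\<zeta> * x) * ((\<xi> * y) ^ 3 - z ^ 3) + (\<xi> * y) * (z ^ 3 - (\<zeta> * x) ^ 3) + z * ((\<zeta> * x) ^ 3 - (\<xi> * y) ^ 3)"
      by (simp only: cubes[symmetric] mult.assoc)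
    also have "\<dots> = 0" unfolding factors that(3) by simp
    finally show ?thesis .
  qed
  show ?thesis
    using assms by (auto simp: hesse_normals_def plane_def dot_def hesse_field_def intro!: root)
qed

lemmas fermat_lines = vfield_invariant_lines_card[OF fermat.vfield_axioms fermat_extactic fermat_normals(1-3)
    fermat_normals(4) fermat_field_invariant]
lemmas hesse_lines = vfield_invariant_lines_card[OF hesse.vfield_axioms hesse_extactic hesse_normals(1-3)
    hesse_normals(4) hesse_field_invariant]

section \<open>The two foliations\<close>

lemma homogeneous_diff: "homogeneous n p \<Longrightarrow> homogeneous n q \<Longrightarrow> homogeneous n (p - q)"
  unfolding homogeneous_def by (metis coeff_diff diff_self)

lemma homogeneous_uminus: "homogeneous n p \<Longrightarrow> homogeneous n (- p)"
  by (simp add: homogeneous_def)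

lemma homogeneous_mult:
  assumes "homogeneous m p" "homogeneous n q"
  shows "homogeneous (m + n) (p * q)"
  unfolding homogeneous_def
proof (intro allI impI)
  fix i j k assume "coeff (coeff (coeff (p * q) k) j) i \<noteq> 0"
  then have "(\<Sum>k'\<le>k. \<Sum>j'\<le>j. \<Sum>i'\<le>i. coeff (coeff (coeff p k') j') i' * coeff (coeff (coeff q (k - k')) (j - j')) (i - i')) \<noteq> 0"
    by (simp add: coeff_mult coeff_sum)
  then obtain k' where k': "k' \<in> {..k}" "(\<Sum>j'\<le>j. \<Sum>i'\<le>i.
      coeff (coeff (coeff p k') j') i' * coeff (coeff (coeff q (k - k')) (j - j')) (i - i')) \<noteq> 0"
    by (rule sum.not_neutral_contains_not_neutral)
  from k'(2) obtain j' where j': "j' \<in> {..j}" "(\<Sum>i'\<le>i.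
      coeff (coeff (coeff p k') j') i' * coeff (coeff (coeff q (k - k')) (j - j')) (i - i')) \<noteq> 0"
    by (rule sum.not_neutral_contains_not_neutral)
  from j'(2) obtain i' where i': "i' \<in> {..i}"
      "coeff (coeff (coeff p k') j') i' * coeff (coeff (coeff q (k - k')) (j - j')) (i - i') \<noteq> 0"
    by (rule sum.not_neutral_contains_not_neutral)
  have *: "k' \<le> k" "j' \<le> j" "i' \<le> i"
    "coeff (coeff (coeff p k') j') i' \<noteq> 0" "coeff (coeff (coeff q (k - k')) (j - j')) (i - i') \<noteq> 0"
    using k'(1) j'(1) i' by auto
  then have "i' + j' + k' = m" "(i - i') + (j - j') + (k - k') = n"
    using assms unfolding homogeneous_def by blast+
  then show "i + j + k = m + n" using *(1-3) by linarith
qed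

lemma homogeneous_var: "homogeneous 1 varX" "homogeneous 1 varY" "homogeneous 1 varZ"
  unfolding homogeneous_def varX_def varY_def varZ_def affX_def affY_def
  by (auto simp: coeff_pCons split: nat.splits if_splits)

lemma homogeneous_one: "homogeneous 0 1"
  by (auto simp: homogeneous_def one_pCons coeff_pCons split: nat.splits if_splits)

lemma homogeneous_power: "homogeneous n p \<Longrightarrow> homogeneous (k * n) (p ^ k)"
  by (induction k) (auto intro: homogeneous_mult homogeneous_one)

lemma homogeneous_mult': "homogeneous m p \<Longrightarrow> homogeneous n q \<Longrightarrow> k = m + n \<Longrightarrow> homogeneous k (p * q)"
  using homogeneous_mult by simp

lemma homogeneous_power': "homogeneous 1 p \<Longrightarrow> homogeneous k (p ^ k)"
  using homogeneous_power[of 1 p k] by simp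

lemma homogeneous_numeral: "homogeneous 0 (numeral n)"
  by (auto simp: homogeneous_def numeral_poly coeff_pCons split: nat.splits if_splits)

text \<open>
  A common divisor of the coefficients that does not involve \<open>z\<close> divides the coefficients of \<open>z\<^sup>4\<close>, which are \<open>x\<close>
  and \<open>y\<close> up to sign in both models.
\<close>

lemma unit_if_dvd_affX_affY:
  assumes "[:g0:] dvd a" "[:g0:] dvd b" "coeff a i = affX \<or> coeff a i = - affX" "coeff b j = affY \<or> coeff b j = - affY"
  shows "is_unit [:g0:]"
proof -
  have "g0 dvd affX" "g0 dvd affY"
    using assms unfolding const_poly_dvd_iff by (metis dvd_minus_iff)+
  obtain h where h: "affX = g0 * h" using \<open>g0 dvd affX\<close> by (auto elim: dvdE)
  have "degree affX = 0" "affX \<noteq> 0" by (simp_all add: affX_def)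
  moreover from this have "g0 \<noteq> 0" "h \<noteq> 0" using h by auto
  then have "degree affX = degree g0 + degree h" unfolding h by (intro degree_mult_eq)
  ultimately have "degree g0 = 0" by simp
  then obtain g1 where g1: "g0 = [:g1:]" by (auto elim: degree_eq_zeroE)
  then have "g1 dvd coeff affY 1" using \<open>g0 dvd affY\<close> by (simp add: const_poly_dvd_iff)
  then have "is_unit g1" by (simp add: affY_def)
  then show ?thesis by (simp add: g1 is_unit_const_poly_iff)
qed

lemma dvd_constant_imp_constant:
  fixes g :: poly3
  assumes "g dvd [:e:]" "e \<noteq> 0"
  obtains g0 where "g = [:g0:]"
proof -
  obtain h where h: "[:e:] = g * h" using assms(1) by (auto elim: dvdE)
  then have "g \<noteq> 0" "h \<noteq> 0" using assms(2) by auto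
  then have "degree g = 0" using arg_cong[OF h, of degree] by (simp add: degree_mult_eq)
  then show ?thesis using that by (auto elim: degree_eq_zeroE)
qed

lemma foliation_fermat:
  defines "a \<equiv> varY * varZ ^ 4 - varZ * varY ^ 4" and "b \<equiv> varZ * varX ^ 4 - varX * varZ ^ 4"
    and "c \<equiv> varX * varY ^ 4 - varY * varX ^ 4"
  shows "foliation 4 (a, b, c)"
proof -
  have hom: "homogeneous (4 + 1) (p * q ^ 4)" if "homogeneous 1 p" "homogeneous 1 q" for p q
    by (rule homogeneous_mult'[OF that(1) homogeneous_power'[OF that(2)]]) simp
  have 1: "homogeneous (4 + 1) a" "homogeneous (4 + 1) b" "homogeneous (4 + 1) c"
    unfolding a_def b_def c_def by (intro homogeneous_diff hom homogeneous_var)+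
  have 2: "is_unit g" if g: "g dvd a" "g dvd b" "g dvd c" for g
  proof -
    have "c = [:affX * affY ^ 4 - affY * affX ^ 4:]" by (simp add: c_def varX_def varY_def poly_const_pow)
    moreover have "affX * affY ^ 4 - affY * affX ^ 4 \<noteq> 0"
      by (simp add: affX_def affY_def eval_nat_numeral)
    ultimately obtain g0 where g0: "g = [:g0:]" using dvd_constant_imp_constant g(3) by metis
    have "coeff b 4 = - affX" "coeff a 4 = affY"
      by (simp_all add: a_def b_def varX_def varY_def varZ_def poly_const_pow eval_nat_numeral)
    then show ?thesis unfolding g0 using unit_if_dvd_affX_affY[of g0 b a 4 4] g unfolding g0 by simp
  qed
  show ?thesis using 1 2 by (simp add: foliation_def) (simp add: a_def b_def c_def algebra_simps)
qed

text \<open>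
  For coprimality, eliminating \<open>z\<close> from \<open>a\<close> and \<open>c\<close> gives the polynomial
  \<open>3 x\<^sup>2 y\<^sup>2 (x\<^sup>3 - y\<^sup>3) (x\<^sup>3 + y\<^sup>3)\<close>, so that a common divisor does not involve \<open>z\<close>.
\<close>

lemma foliation_hesse:
  defines "a \<equiv> varZ * varY * (2 * varX ^ 3 - varY ^ 3 - varZ ^ 3)"
    and "b \<equiv> varZ * varX * (2 * varY ^ 3 - varX ^ 3 - varZ ^ 3)"
    and "c \<equiv> - (varX * varY * (varX ^ 3 + varY ^ 3 - 2 * varZ ^ 3))"
  shows "foliation 4 (a, b, c)"
proof -
  have 1: "homogeneous (4 + 1) a" "homogeneous (4 + 1) b" "homogeneous (4 + 1) c"
  proof -
    have two: "homogeneous 3 (2 * p ^ 3)" if "homogeneous 1 p" for p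
      by (rule homogeneous_mult'[OF homogeneous_numeral homogeneous_power'[OF that]]) simp
    have xy: "homogeneous 2 (p * q)" if "homogeneous 1 p" "homogeneous 1 q" for p q
      by (rule homogeneous_mult'[OF that]) simp
    have plus: "homogeneous 3 (p ^ 3 + q ^ 3 - 2 * r ^ 3)" if "homogeneous 1 p" "homogeneous 1 q" "homogeneous 1 r" for p q r
      using homogeneous_diff[OF homogeneous_diff[OF homogeneous_power'[OF that(1)] homogeneous_uminus[OF homogeneous_power'[OF that(2)]]] two[OF that(3)]]
      by simp
    show "homogeneous (4 + 1) a" "homogeneous (4 + 1) b" "homogeneous (4 + 1) c"
      unfolding a_def b_def c_def
      by (intro homogeneous_uminus homogeneous_mult'[where m=2 and n=3] homogeneous_diff two xy plus homogeneous_power' homogeneous_var; simp)+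
  qed
  have 2: "is_unit g" if g: "g dvd a" "g dvd b" "g dvd c" for g
  proof -
    have elim: "[:3 * affX ^ 2 * affY ^ 2 * (affX ^ 3 - affY ^ 3) * (affX ^ 3 + affY ^ 3):] =
       a * (4 * varX ^ 2 * varY * varZ ^ 2) + c * (2 * varX * varY * varZ ^ 3 - 3 * varX * varY * (varX ^ 3 - varY ^ 3))"
    proof (rule eval3_inject)
      fix v
      have e: "eval3 2 v = 2" "eval3 3 v = 3" "eval3 4 v = 4" 
        by (simp_all add: eval3_def)
      have l: "eval3 [:q:] v = poly (poly q [:v $ 2:]) (v $ 1)" for q by (simp add: eval3_def)
      show "eval3 [:3 * affX ^ 2 * affY ^ 2 * (affX ^ 3 - affY ^ 3) * (affX ^ 3 + affY ^ 3):] v = eval3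
       (a * (4 * varX ^ 2 * varY * varZ ^ 2) + c * (2 * varX * varY * varZ ^ 3 - 3 * varX * varY * (varX ^ 3 - varY ^ 3))) v"
        unfolding l a_def c_def eval3_simps e
        by (simp add: affX_def affY_def poly_power) algebra
    qed
    have "g dvd [:3 * affX ^ 2 * affY ^ 2 * (affX ^ 3 - affY ^ 3) * (affX ^ 3 + affY ^ 3):]"
      unfolding elim using g by (intro dvd_add dvd_mult2)
    moreover have "affX \<noteq> 0" "affY \<noteq> 0" "affX ^ 3 - affY ^ 3 \<noteq> 0" "affX ^ 3 + affY ^ 3 \<noteq> 0"
      by (simp_all add: affX_def affY_def eval_nat_numeral)
    then have "3 * affX ^ 2 * affY ^ 2 * (affX ^ 3 - affY ^ 3) * (affX ^ 3 + affY ^ 3) \<noteq> 0" by simp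
    ultimately obtain g0 where g0: "g = [:g0:]" using dvd_constant_imp_constant by metis
    have "coeff b 4 = - affX" "coeff a 4 = - affY"
      by (simp_all add: a_def b_def varX_def varY_def varZ_def poly_const_pow eval_nat_numeral numeral_poly)
    then show ?thesis unfolding g0 using unit_if_dvd_affX_affY[of g0 b a 4 4] g unfolding g0 by simp
  qed
  show ?thesis using 1 2 by (simp add: foliation_def) (simp add: a_def b_def c_def algebra_simps)
qed

lemma eval3_monom: "eval3 (monom (monom (monom c i) j) k) v = c * (v $ 1) ^ i * (v $ 2) ^ j * (v $ 3) ^ k"
  by (simp add: eval3_def poly_monom)

lemma eval3_homogenize_poly:
  "eval3 (homogenize_poly n p) v =
     (\<Sum>j\<le>n. \<Sum>i\<le>n - j. coeff (coeff p j) i * (v $ 1) ^ i * (v $ 2) ^ j * (v $ 3) ^ (n - i - j))"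
  by (simp add: homogenize_poly_def eval3_sum eval3_monom)

lemma homogenize_form_eq:
  assumes "form_degree (p, q) = n" "homogenize_poly n p = P" "homogenize_poly n q = Q"
    "eval3 (varX * P + varY * Q) (vector [1, 2, 0]) \<noteq> 0"
  shows "homogenize_form (p, q) = (varZ * P, varZ * Q, - (varX * P + varY * Q))"
proof -
  have "\<not> varZ dvd varX * P + varY * Q"
  proof
    assume "varZ dvd varX * P + varY * Q"
    then obtain r where "varX * P + varY * Q = varZ * r" by (auto elim: dvdE)
    then have "eval3 (varX * P + varY * Q) (vector [1, 2, 0]) = 0" by (simp only: eval3_simps) simp
    then show False using assms(4) by simp
  qed
  then show ?thesis by (simp add: homogenize_form_def Let_def assms(1-3))
qed

lemma fermat_foliation_eq:
  "fermat_foliation = (varY * varZ ^ 4 - varZ * varY ^ 4, varZ * varX ^ 4 - varX * varZ ^ 4,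
     varX * varY ^ 4 - varY * varX ^ 4)"
proof -
  have p: "- (affY ^ 4 - affY) = [:0, 1, 0, 0, -1:]" by (simp add: affY_def eval_nat_numeral)
  have q: "affX ^ 4 - affX = [:[:0, -1, 0, 0, 1:]:]" by (simp add: affX_def eval_nat_numeral)
  have d: "form_degree ([:0, 1, 0, 0, -1:], [:[:0, -1, 0, 0, 1:]:]) = 4"
    unfolding form_degree_def prod.case
  proof (rule Least_equality)
    show "\<forall>i j. coeff (coeff [:0, 1, 0, 0, -1:] j) i \<noteq> 0 \<or> coeff (coeff [:[:0, -1, 0, 0, 1::complex:]:] j) i \<noteq> 0 \<longrightarrow> i + j \<le> 4"
      by (auto simp: coeff_pCons one_pCons split: nat.splits if_splits)
    fix n assume *: "\<forall>i j. coeff (coeff [:0, 1, 0, 0, -1:] j) i \<noteq> 0 \<or> coeff (coeff [:[:0, -1, 0, 0, 1::complex:]:] j) i \<noteq> 0 \<longrightarrow> i + j \<le> n"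
    show "4 \<le> n" using *[rule_format, of 4 0] by (simp add: eval_nat_numeral)
  qed
  have P: "homogenize_poly 4 [:0, 1, 0, 0, -1:] = varY * varZ ^ 3 - varY ^ 4"
    by (rule eval3_inject) (simp add: eval3_homogenize_poly eval_nat_numeral)
  have Q: "homogenize_poly 4 [:[:0, -1, 0, 0, 1:]:] = varX ^ 4 - varX * varZ ^ 3"
    by (rule eval3_inject) (simp add: eval3_homogenize_poly eval_nat_numeral)
  show ?thesis
    unfolding fermat_foliation_def p q
    by (subst homogenize_form_eq[OF d P Q]) (simp_all add: algebra_simps eval_nat_numeral)
qed

lemma hesse_pencil_eq:
  "hesse_pencil = (varZ * varY * (2 * varX ^ 3 - varY ^ 3 - varZ ^ 3), varZ * varX * (2 * varY ^ 3 - varX ^ 3 - varZ ^ 3),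
     - (varX * varY * (varX ^ 3 + varY ^ 3 - 2 * varZ ^ 3)))"
proof -
  have p: "(2 * affX ^ 3 - affY ^ 3 - 1) * affY = [:0, [:-1, 0, 0, 2:], 0, 0, -1:]"
    by (simp add: affX_def affY_def eval_nat_numeral numeral_poly one_pCons)
  have q: "(2 * affY ^ 3 - affX ^ 3 - 1) * affX = [:[:0, -1, 0, 0, -1:], 0, 0, [:0, 2:]:]"
    by (simp add: affX_def affY_def eval_nat_numeral numeral_poly one_pCons)
  have d: "form_degree ([:0, [:-1, 0, 0, 2:], 0, 0, -1:], [:[:0, -1, 0, 0, -1:], 0, 0, [:0, 2:]:]) = 4"
    unfolding form_degree_def prod.case
  proof (rule Least_equality)
    show "\<forall>i j. coeff (coeff [:0, [:-1, 0, 0, 2:], 0, 0, -1:] j) i \<noteq> 0 \<or>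
        coeff (coeff [:[:0, -1, 0, 0, -1:], 0, 0, [:0, 2::complex:]:] j) i \<noteq> 0 \<longrightarrow> i + j \<le> 4"
      by (auto simp: coeff_pCons one_pCons split: nat.splits if_splits)
    fix n assume *: "\<forall>i j. coeff (coeff [:0, [:-1, 0, 0, 2:], 0, 0, -1:] j) i \<noteq> 0 \<or>
        coeff (coeff [:[:0, -1, 0, 0, -1:], 0, 0, [:0, 2::complex:]:] j) i \<noteq> 0 \<longrightarrow> i + j \<le> n"
    show "4 \<le> n" using *[rule_format, of 4 0] by (simp add: eval_nat_numeral)
  qed
  have e: "eval3 2 v = 2" for v by (simp add: eval3_def)
  have P: "homogenize_poly 4 [:0, [:-1, 0, 0, 2:], 0, 0, -1:] = varY * (2 * varX ^ 3 - varY ^ 3 - varZ ^ 3)"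
    by (rule eval3_inject) (simp add: eval3_homogenize_poly e eval_nat_numeral algebra_simps)
  have Q: "homogenize_poly 4 [:[:0, -1, 0, 0, -1:], 0, 0, [:0, 2:]:] = varX * (2 * varY ^ 3 - varX ^ 3 - varZ ^ 3)"
    by (rule eval3_inject) (simp add: eval3_homogenize_poly e eval_nat_numeral algebra_simps)
  show ?thesis
    unfolding hesse_pencil_def p q
    by (subst homogenize_form_eq[OF d P Q]) (simp_all add: e mult.assoc, simp add: algebra_simps)
qed

lemma represents_fermat: "represents fermat_field fermat_foliation"
proof -
  have "coeff_form fermat_foliation v = cross v (fermat_field v)" for v
    by (simp add: fermat_foliation_eq coeff_form_def vec3_eq_iff fermat_field_def)
  then show ?thesis unfolding represents_def using hompoly_fermat_field by blast
qed

lemma represents_hesse: "represents hesse_field hesse_pencil"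
proof -
  have "eval3 2 v = 2" for v by (simp add: eval3_def)
  then have "coeff_form hesse_pencil v = cross v (hesse_field v)" for v
    by (simp add: hesse_pencil_eq coeff_form_def vec3_eq_iff hesse_field_def algebra_simps)
  then show ?thesis unfolding represents_def using hompoly_hesse_field by blast
qed

lemma reduced_convex_fermat: "reduced_convex 4 fermat_foliation"
  using foliation_fermat[folded fermat_foliation_eq] fermat_lines(1)
  unfolding reduced_convex_def invariant_line_iff[OF represents_fermat] by simp

lemma reduced_convex_hesse: "reduced_convex 4 hesse_pencil"
  using foliation_hesse[folded hesse_pencil_eq] hesse_lines(1)
  unfolding reduced_convex_def invariant_line_iff[OF represents_hesse] by simp

section \<open>Classification\<close>

theorem theoremB:
  shows "reduced_convex 4 fermat_foliation \<and> reduced_convex 4 hesse_pencil \<and>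
    (\<forall>\<omega>. reduced_convex 4 \<omega> \<longrightarrow>
       foliation_iso \<omega> fermat_foliation \<or> foliation_iso \<omega> hesse_pencil)"
proof (intro conjI allI impI)
  show "reduced_convex 4 fermat_foliation" by (rule reduced_convex_fermat)
  show "reduced_convex 4 hesse_pencil" by (rule reduced_convex_hesse)
  fix \<omega> assume con: "reduced_convex 4 \<omega>"
  then have "foliation 4 \<omega>" by (simp add: reduced_convex_def)
  then obtain Z where rep: "represents Z \<omega>" by (rule vector_field_exists)
  interpret convex4 Z by (rule reduced_convex_convex4[OF con rep])
  show "foliation_iso \<omega> fermat_foliation \<or> foliation_iso \<omega> hesse_pencil"
  proof (cases rule: classification_of_lines)
    case (fermat m1 m2 m3)
    have "foliation_iso \<omega> fermat_foliation"
    proof (rule foliation_unique[OF _ _ represents_fermat con rep fermat(1) fermat_normals(1-4) fermat_lines(2)])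
      show "foliation 4 fermat_foliation" using reduced_convex_fermat by (simp add: reduced_convex_def)
      have "eval3 (fst fermat_foliation) (vector [0, 1, 2]) \<noteq> 0" by (simp add: fermat_foliation_eq)
      then show "fst fermat_foliation \<noteq> 0" by auto
      fix n assume "n \<in> fermat_normals"
      then show "inv_line (plane (n $ 1 *s m1 + n $ 2 *s m2 + n $ 3 *s m3))"
        using fermat(2-4) fermat(5-7) by (auto simp: fermat_normals_def S_def algebra_simps)
    qed
    then show ?thesis ..
  next
    case (hesse m1 m2 m3)
    have "foliation_iso \<omega> hesse_pencil"
    proof (rule foliation_unique[OF _ _ represents_hesse con rep hesse(1) hesse_normals(1-4) hesse_lines(2)])
      show "foliation 4 hesse_pencil" using reduced_convex_hesse by (simp add: reduced_convex_def)
      have "eval3 (fst hesse_pencil) (vector [1, 1, 2]) \<noteq> 0" by (simp add: hesse_pencil_eq eval3_def[of 2])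
      then show "fst hesse_pencil \<noteq> 0" by auto
      fix n assume "n \<in> hesse_normals"
      then show "inv_line (plane (n $ 1 *s m1 + n $ 2 *s m2 + n $ 3 *s m3))"
        using hesse(2-5) by (auto simp: hesse_normals_def S_def)
    qed
    then show ?thesis ..
  qed
qed

end
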